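(* Let $\varphi:\mathbb{D}\to\mathbb{D}$ be a holomorphic function such that there exists a parabolic semiflow $(\varphi_t)_{t\ge0}$ with $\varphi=\varphi_1$. Let $\Omega$ be its Koenigs domain and assume that $\Omega$ is contained in a horizontal half-plane of the form $\{w\in\mathbb{C}:\operatorname{Im}(w)>-\eta\}$, $\eta>0$, and that $\partial\Omega$ is contained in a horizontal strip. Assume further that $\operatorname{int}(\overline{\Omega})=\Omega$ and that $\mathbb{C}\setminus\overline{\Omega}$ is connected. Then, for $C_\varphi\in\mathcal{L}(H^p)$, $1\le p<\infty$, $$\operatorname{Ext}(C_\varphi)=\mathbb{T}.$$
   Context: $\mathbb{D}$ is the open unit disc of $\mathbb{C}$ and $\mathbb{T}$ the unit circle. For $1\le p<\infty$, $H^p$ is the Banach space of holomorphic $f:\mathbb{D}\to\mathbb{C}$ with $\|f\|_{H^p}=\left(\sup_{0<r<1}\int_0^{2\pi}|f(re^{i\theta})|^p\,d\theta\right)^{1/p}<\infty$. For holomorphic $\varphi:\mathbb{D}\to\mathbb{D}$, $C_\varphi f=f\circ\varphi$, a bounded operator on $H^p$. For a complex Banach space $X$, $\mathcal{L}(X)$ is the algebra of bounded linear operators on $X$. For $T\in\mathcal{L}(X)$, a number $\lambda\in\mathbb{C}$ is an extended eigenvalue of $T$ if there exists a non-zero $A\in\mathcal{L}(X)$ with $TA=\lambda AT$; $\operatorname{Ext}(T)$ is the set of extended eigenvalues of $T$. Semiflows. A holomorphic semiflow is a family $(\varphi_t)_{t\ge0}$ of holomorphic self-maps of $\mathbb{D}$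 with $\varphi_0(z)=z$, $\varphi_{t+s}=\varphi_t\circ\varphi_s$ for all $t,s\geq 0$, and $\varphi_t\to\varphi_s$ uniformly on compact subsets of $\mathbb{D}$ as $t\to s$. It is elliptic if $\varphi_{t_0}(z_0)=z_0$ for some $t_0>0$ and $z_0\in\mathbb{D}$. If it is not elliptic, there is a unique $\tau\in\mathbb{T}$ (the Denjoy–Wolff point) such that $\varphi_t\to\tau$ uniformly on compact subsets as $t\to\infty$, and there is $\alpha\le 0$ such that $\varphi_t'$ has non-tangential limit $e^{t\alpha}$ at $\tau$ for all $t\geq 0$; the semiflow is hyperbolic if $\alpha<0$ and parabolic if $\alpha=0$. For a non-elliptic semiflow there is a univalent function $h:\mathbb{D}\to\mathbb{C}$ (the Koenigs function), unique up to an additive constant, with $\varphi_t(z)=h^{-1}(h(z)+t)$ for all $z\in\mathbb{D}$, $t\ge0$. The Koenigs domain is $\Omega=h(\mathbb{D})$. A horizontal strip is a set $\{w\in\mathbb{C}: a<\operatorname{Im}(w)<b\}$ with $-\infty<a<b<\infty$. Interior, closure and boundary are taken in $\mathbb{C}$. *)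

theory Defs
  imports "HOL-Complex_Analysis.Complex_Analysis"
begin

abbreviation unit_disc :: "complex set" where
  "unit_disc \<equiv> ball 0 1"

definition holomorphic_self_map :: "(complex \<Rightarrow> complex) \<Rightarrow> bool" where
  "holomorphic_self_map f \<longleftrightarrow> f holomorphic_on unit_disc \<and> f ` unit_disc \<subseteq> unit_disc"


section \<open>Hardy spaces\<close>

definition hardy_mean :: "real \<Rightarrow> (complex \<Rightarrow> complex) \<Rightarrow> real \<Rightarrow> real" where
  "hardy_mean p f r = integral {0..2 * pi} (\<lambda>\<theta>. norm (f (of_real r * cis \<theta>)) powr p)"

definition hardy_norm :: "real \<Rightarrow> (complex \<Rightarrow> complex) \<Rightarrow> real" where
  "hardy_norm p f = (SUP r\<in>{0<..<1}. hardy_mean p f r) powr (1 / p)"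

text \<open>A holomorphic function on the disc is represented by its extension by zero to all of the
  complex plane, so that equality of elements of the Hardy space is equality of HOL functions.
  Boundedness of the integral means says that the supremum in the norm is finite.\<close>

definition hardy_space :: "real \<Rightarrow> (complex \<Rightarrow> complex) set" where
  "hardy_space p = {f. f holomorphic_on unit_disc \<and> (\<forall>z. z \<notin> unit_disc \<longrightarrow> f z = 0) \<and>
     bdd_above (hardy_mean p f ` {0<..<1})}"

definition composition_operator ::
    "(complex \<Rightarrow> complex) \<Rightarrow> (complex \<Rightarrow> complex) \<Rightarrow> (complex \<Rightarrow> complex)" where
  "composition_operator \<phi> f = (\<lambda>z. if z \<in> unit_disc then f (\<phi> z) else 0)"


section \<open>Bounded operators and extended eigenvalues\<close>

text \<open>Here \<open>X\<close> is the carrier of a space of complex-valued functions with pointwise operations and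
  \<open>N\<close> is its norm. Operators are HOL functions of which only the restriction to \<open>X\<close> matters.\<close>

definition bounded_operator ::
    "('a \<Rightarrow> complex) set \<Rightarrow> (('a \<Rightarrow> complex) \<Rightarrow> real) \<Rightarrow>
     (('a \<Rightarrow> complex) \<Rightarrow> ('a \<Rightarrow> complex)) \<Rightarrow> bool" where
  "bounded_operator X N A \<longleftrightarrow>
     (\<forall>f\<in>X. A f \<in> X) \<and>
     (\<forall>f\<in>X. \<forall>g\<in>X. A (\<lambda>z. f z + g z) = (\<lambda>z. A f z + A g z)) \<and>
     (\<forall>c. \<forall>f\<in>X. A (\<lambda>z. c * f z) = (\<lambda>z. c * A f z)) \<and>
     (\<exists>K. \<forall>f\<in>X. N (A f) \<le> K * N f)"

definition extended_eigenvalues ::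
    "('a \<Rightarrow> complex) set \<Rightarrow> (('a \<Rightarrow> complex) \<Rightarrow> real) \<Rightarrow>
     (('a \<Rightarrow> complex) \<Rightarrow> ('a \<Rightarrow> complex)) \<Rightarrow> complex set" where
  "extended_eigenvalues X N T =
     {\<mu>. \<exists>A. bounded_operator X N A \<and> (\<exists>f\<in>X. A f \<noteq> (\<lambda>z. 0)) \<and>
             (\<forall>f\<in>X. T (A f) = (\<lambda>z. \<mu> * A (T f) z))}"


section \<open>Semiflows\<close>

definition semiflow :: "(real \<Rightarrow> complex \<Rightarrow> complex) \<Rightarrow> bool" where
  "semiflow \<Phi> \<longleftrightarrow>
     (\<forall>t\<ge>0. holomorphic_self_map (\<Phi> t)) \<and>
     (\<forall>z\<in>unit_disc. \<Phi> 0 z = z) \<and>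
     (\<forall>t\<ge>0. \<forall>s\<ge>0. \<forall>z\<in>unit_disc. \<Phi> (t + s) z = \<Phi> t (\<Phi> s z)) \<and>
     (\<forall>s\<ge>0. \<forall>K. compact K \<and> K \<subseteq> unit_disc \<longrightarrow> uniform_limit K \<Phi> (\<Phi> s) (at s within {0..}))"

definition elliptic :: "(real \<Rightarrow> complex \<Rightarrow> complex) \<Rightarrow> bool" where
  "elliptic \<Phi> \<longleftrightarrow> (\<exists>t>0. \<exists>z\<in>unit_disc. \<Phi> t z = z)"

definition denjoy_wolff_point :: "(real \<Rightarrow> complex \<Rightarrow> complex) \<Rightarrow> complex \<Rightarrow> bool" where
  "denjoy_wolff_point \<Phi> \<tau> \<longleftrightarrow> \<tau> \<in> sphere 0 1 \<and>
     (\<forall>K. compact K \<and> K \<subseteq> unit_disc \<longrightarrow> uniform_limit K \<Phi> (\<lambda>z. \<tau>) at_top)"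

definition stolz_region :: "complex \<Rightarrow> real \<Rightarrow> complex set" where
  "stolz_region \<tau> M = {z \<in> unit_disc. norm (\<tau> - z) < M * (1 - norm z)}"

definition nontangential_limit :: "(complex \<Rightarrow> complex) \<Rightarrow> complex \<Rightarrow> complex \<Rightarrow> bool" where
  "nontangential_limit f \<tau> l \<longleftrightarrow> (\<forall>M>1. (f \<longlongrightarrow> l) (at \<tau> within stolz_region \<tau> M))"

definition spectral_value :: "(real \<Rightarrow> complex \<Rightarrow> complex) \<Rightarrow> real \<Rightarrow> bool" where
  "spectral_value \<Phi> \<alpha> \<longleftrightarrow> \<alpha> \<le> 0 \<and>
     (\<exists>\<tau>. denjoy_wolff_point \<Phi> \<tau> \<and>
          (\<forall>t\<ge>0. nontangential_limit (deriv (\<Phi> t)) \<tau> (of_real (exp (t * \<alpha>)))))"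

definition parabolic_semiflow :: "(real \<Rightarrow> complex \<Rightarrow> complex) \<Rightarrow> bool" where
  "parabolic_semiflow \<Phi> \<longleftrightarrow> semiflow \<Phi> \<and> \<not> elliptic \<Phi> \<and> spectral_value \<Phi> 0"

definition koenigs_function ::
    "(real \<Rightarrow> complex \<Rightarrow> complex) \<Rightarrow> (complex \<Rightarrow> complex) \<Rightarrow> bool" where
  "koenigs_function \<Phi> h \<longleftrightarrow> h holomorphic_on unit_disc \<and> inj_on h unit_disc \<and>
     (\<forall>t\<ge>0. \<forall>z\<in>unit_disc. h z + of_real t \<in> h ` unit_disc \<and>
        \<Phi> t z = inv_into unit_disc h (h z + of_real t))"

definition horizontal_strip :: "real \<Rightarrow> real \<Rightarrow> complex set" where
  "horizontal_strip a b = {w. a < Im w \<and> Im w < b}"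

end

theory Submission imports Defs begin

text \<open>
  Write \<open>T\<close> for the composition operator. The Koenigs function linearizes \<open>\<phi>\<close>, \<open>h \<circ> \<phi> = h + 1\<close>, so the
  functions \<open>g\<^sub>a = e\<^sup>i\<^sup>a\<^sup>h\<close> with \<open>a \<ge> 0\<close>, which are bounded because \<open>\<Omega>\<close> lies in a half-plane, satisfy
  \<open>T g\<^sub>a = e\<^sup>i\<^sup>a g\<^sub>a\<close>. Multiplication by \<open>g\<^sub>a\<close> therefore exhibits \<open>e\<^sup>i\<^sup>a\<close> as an extended eigenvalue, and the
  circle is contained in the set of extended eigenvalues.

  Conversely let \<open>T A = \<mu> A T\<close> with \<open>\<bar>\<mu>\<bar> \<noteq> 1\<close>. Then \<open>F = A g\<^sub>a\<close> satisfies \<open>F \<circ> \<phi> = \<nu> F\<close> with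
  \<open>\<bar>\<nu>\<bar> = \<bar>\<mu>\<bar>\<close>. A parabolic Koenigs domain is not contained in a strip
  (\<open>parabolic_koenigs_domain_not_in_strip\<close>), so here \<open>\<Omega>\<close> contains an upper half-plane. Transplanted to it,
  \<open>F\<close> is multiplied by \<open>\<nu>\<close> under translation by \<open>1\<close>, hence grows geometrically in one of the two horizontal
  directions unless it vanishes; but functions of the Hardy space grow at most polynomially there. So
  \<open>F = 0\<close> (\<open>composition_eigenfunction_vanishes\<close>), and \<open>A\<close> kills every \<open>g\<^sub>a\<close>. It remains to see that the
  \<open>g\<^sub>a\<close> span a dense subspace (\<open>exp_span_dense\<close>), which is where the topological hypotheses on \<open>\<Omega>\<close> enter.

  Let \<open>B\<close> be the set of bounded functions in the Hardy norm closure of the algebra spanned by the \<open>g\<^sub>a\<close>. It contains the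
  resolvents \<open>1 / (h - w)\<close> for \<open>w\<close> far below, and then, by pushing poles through the connected complement
  of the closure of \<open>\<Omega>\<close>, for all \<open>w\<close> in that complement. After an inversion there is a univalent
  function \<open>u\<close> onto a bounded domain such that \<open>B\<close> contains \<open>1 / (u - c)\<close> for all \<open>c\<close> off the closure
  \<open>K\<close> of the image, where \<open>K\<close> has connected complement and the image as its interior. Approximate \<open>K\<close>
  from outside by simply connected domains with Riemann maps \<open>\<psi>\<^sub>n\<close>. The self-maps
  \<open>\<omega>\<^sub>n = \<psi>\<^sub>n\<^sup>-\<^sup>1 \<circ> u\<close> of the disc are in \<open>B\<close> by Cauchy's formula, and as in the kernel theorem of
  Caratheodory \<open>\<bar>\<omega>\<^sub>n' 0\<bar> \<rightarrow> 1\<close>; after a rotation \<open>\<omega>\<^sub>n\<close> tends to the identity in the Hardy norm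
  (\<open>hardy_mean_id_minus_self_map\<close>). So \<open>B\<close> contains the identity, all polynomials and all dilations
  \<open>z \<mapsto> f (r z)\<close>. Finally, dilations converge in the Hardy norm (\<open>dilations_converge\<close>); by the
  factorization \<open>f = b g\<^sup>2\<close> with \<open>\<bar>b\<bar> \<le> 1\<close> this is reduced to exponents at least \<open>2\<close>, where it follows
  from uniform convexity.
\<close>

section \<open>Integral means over circles\<close>

lemma circle_in_sphere: "0 \<le> r \<Longrightarrow> of_real r * cis \<theta> \<in> sphere 0 r"
  by (simp add: norm_mult)

lemma continuous_on_circle_param:
  assumes "continuous_on (sphere 0 r) f" "0 \<le> r"
  shows "continuous_on S (\<lambda>\<theta>. f (of_real r * cis \<theta>))"
  by (rule continuous_on_compose2[OF assms(1)])
     (use assms(2) in \<open>auto intro!: continuous_intros simp: norm_mult\<close>)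

lemma continuous_on_hardy_integrand:
  assumes "continuous_on (sphere 0 r) f" "0 \<le> r" "0 < p"
  shows "continuous_on S (\<lambda>\<theta>. norm (f (of_real r * cis \<theta>)) powr p)"
  by (rule continuous_on_powr') (use assms in \<open>auto intro!: continuous_intros continuous_on_circle_param\<close>)

lemma integrable_hardy_integrand:
  assumes "continuous_on (sphere 0 r) f" "0 \<le> r" "0 < p"
  shows "(\<lambda>\<theta>. norm (f (of_real r * cis \<theta>)) powr p) integrable_on {0..2 * pi}"
  using continuous_on_hardy_integrand[OF assms] by (rule integrable_continuous_real)

lemma hardy_mean_nonneg: "0 \<le> hardy_mean p f r"
proof (cases "(\<lambda>\<theta>. norm (f (of_real r * cis \<theta>)) powr p) integrable_on {0..2 * pi}")
  case True
  then show ?thesis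
    unfolding hardy_mean_def by (rule Henstock_Kurzweil_Integration.integral_nonneg) auto
next
  case False
  then show ?thesis
    by (simp add: hardy_mean_def not_integrable_integral)
qed

lemma hardy_mean_dilate: "hardy_mean p (\<lambda>z. f (of_real s * z)) r = hardy_mean p f (s * r)"
  by (simp add: hardy_mean_def mult.assoc)

lemma hardy_mean_cong:
  assumes "\<And>z. z \<in> sphere 0 r \<Longrightarrow> f z = g z" "0 \<le> r"
  shows "hardy_mean p f r = hardy_mean p g r"
  using assms circle_in_sphere[of r] by (simp add: hardy_mean_def)

lemma hardy_mean_zero [simp]: "hardy_mean p (\<lambda>z. 0) r = 0"
  by (simp add: hardy_mean_def)

text \<open>Two means are allowed on either side, since the inequality of Clarkson bounds a sum of two means by
  a combination of two others.\<close>

lemma hardy_mean_add_le: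
  assumes "continuous_on (sphere 0 r) k" "continuous_on (sphere 0 r) j"
    and "continuous_on (sphere 0 r) f" "continuous_on (sphere 0 r) g"
    and r: "0 \<le> r" and "0 < p"
    and le: "\<And>z. z \<in> sphere 0 r \<Longrightarrow>
      norm (k z) powr p + norm (j z) powr p \<le> A * norm (f z) powr p + B * norm (g z) powr p + C"
  shows "hardy_mean p k r + hardy_mean p j r \<le> A * hardy_mean p f r + B * hardy_mean p g r + 2 * pi * C"
proof -
  let ?i = "\<lambda>f \<theta>. norm (f (of_real r * cis \<theta>)) powr p"
  have int: "?i k integrable_on {0..2*pi}" "?i j integrable_on {0..2*pi}"
    "?i f integrable_on {0..2*pi}" "?i g integrable_on {0..2*pi}"
    using assms by (auto intro!: integrable_hardy_integrand)
  have "((\<lambda>\<theta>. A * ?i f \<theta> + B * ?i g \<theta> + C) has_integral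
          A * integral {0..2*pi} (?i f) + B * integral {0..2*pi} (?i g) + 2 * pi * C) {0..2*pi}"
    using int has_integral_const_real[of C 0 "2 * pi"]
    by (intro has_integral_add has_integral_mult_right integrable_integral) (auto simp: mult_ac)
  moreover have "((\<lambda>\<theta>. ?i k \<theta> + ?i j \<theta>) has_integral
          integral {0..2*pi} (?i k) + integral {0..2*pi} (?i j)) {0..2*pi}"
    using int by (intro has_integral_add integrable_integral)
  ultimately have "integral {0..2*pi} (?i k) + integral {0..2*pi} (?i j)
      \<le> A * integral {0..2*pi} (?i f) + B * integral {0..2*pi} (?i g) + 2 * pi * C"
    using le[OF circle_in_sphere[OF r]] by (meson has_integral_le)
  then show ?thesis
    by (simp add: hardy_mean_def)
qed

lemma hardy_mean_le:
  assumes "continuous_on (sphere 0 r) k" "continuous_on (sphere 0 r) f" "continuous_on (sphere 0 r) g"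
    and r: "0 \<le> r" and "0 < p" "0 < q" "0 < s"
    and le: "\<And>z. z \<in> sphere 0 r \<Longrightarrow>
               norm (k z) powr p \<le> A * norm (f z) powr q + B * norm (g z) powr s + C"
  shows "hardy_mean p k r \<le> A * hardy_mean q f r + B * hardy_mean s g r + 2 * pi * C"
proof -
  let ?k = "\<lambda>\<theta>. norm (k (of_real r * cis \<theta>)) powr p"
  let ?f = "\<lambda>\<theta>. norm (f (of_real r * cis \<theta>)) powr q"
  let ?g = "\<lambda>\<theta>. norm (g (of_real r * cis \<theta>)) powr s"
  have int: "?k integrable_on {0..2*pi}" "?f integrable_on {0..2*pi}" "?g integrable_on {0..2*pi}"
    using assms by (auto intro!: integrable_hardy_integrand)
  have "((\<lambda>\<theta>. A * ?f \<theta> + B * ?g \<theta> + C) has_integral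
          A * integral {0..2*pi} ?f + B * integral {0..2*pi} ?g + 2 * pi * C) {0..2*pi}"
    using int has_integral_const_real[of C 0 "2 * pi"]
    by (intro has_integral_add has_integral_mult_right integrable_integral) (auto simp: mult_ac)
  moreover have "(?k has_integral integral {0..2*pi} ?k) {0..2*pi}"
    using int by (intro integrable_integral)
  ultimately have "integral {0..2*pi} ?k
      \<le> A * integral {0..2*pi} ?f + B * integral {0..2*pi} ?g + 2 * pi * C"
    using le[OF circle_in_sphere[OF r]] by (meson has_integral_le)
  then show ?thesis
    by (simp add: hardy_mean_def)
qed

lemma hardy_mean_mono:
  assumes "continuous_on (sphere 0 r) f" "continuous_on (sphere 0 r) g" "0 \<le> r" "0 < p" "0 < q"
    and "\<And>z. z \<in> sphere 0 r \<Longrightarrow> norm (f z) powr p \<le> A * norm (g z) powr q + C"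
  shows "hardy_mean p f r \<le> A * hardy_mean q g r + 2 * pi * C"
  using hardy_mean_le[of r f g g p q q A 0 C] assms by simp

lemma hardy_mean_le_const:
  assumes "continuous_on (sphere 0 r) f" "0 \<le> r" "0 < p"
    and "\<And>z. z \<in> sphere 0 r \<Longrightarrow> norm (f z) \<le> M"
  shows "hardy_mean p f r \<le> 2 * pi * M powr p"
  using hardy_mean_mono[of r f f p p 0 "M powr p"] assms by (simp add: powr_mono2)

lemma hardy_mean_tendsto:
  assumes cont: "\<And>n. continuous_on (sphere 0 r) (F n)" and r: "0 \<le> r" and p: "0 < p"
    and bound: "\<And>n z. z \<in> sphere 0 r \<Longrightarrow> norm (F n z) \<le> M"
    and lim: "\<And>z. z \<in> sphere 0 r \<Longrightarrow> (\<lambda>n. F n z) \<longlonglongrightarrow> f z"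
  shows "(\<lambda>n. hardy_mean p (F n) r) \<longlonglongrightarrow> hardy_mean p f r"
  unfolding hardy_mean_def
proof (rule dominated_convergence)
  show "(\<lambda>\<theta>. norm (F n (of_real r * cis \<theta>)) powr p) integrable_on {0..2 * pi}" for n
    using cont r p by (rule integrable_hardy_integrand)
  show "(\<lambda>\<theta>. M powr p) integrable_on {0..2 * pi}"
    by (rule integrable_const_ivl)
  show "norm (norm (F n (of_real r * cis \<theta>)) powr p) \<le> M powr p" for n \<theta>
    using bound[OF circle_in_sphere[OF r], of n \<theta>] p by (simp add: powr_mono2)
  show "(\<lambda>n. norm (F n (of_real r * cis \<theta>)) powr p) \<longlonglongrightarrow> norm (f (of_real r * cis \<theta>)) powr p" for \<theta>
    using p by (intro tendsto_powr2 tendsto_norm lim circle_in_sphere r tendsto_const) (auto intro: always_eventually)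
qed

lemma mean_value_circle:
  fixes f :: "complex \<Rightarrow> complex"
  assumes "f holomorphic_on ball 0 R" "0 < r" "r < R"
  shows "((\<lambda>\<theta>. f (of_real r * cis \<theta>)) has_integral 2 * pi * f 0) {0..2 * pi}"
proof -
  have "f holomorphic_on cball 0 r"
    by (rule holomorphic_on_subset[OF assms(1)]) (use assms in auto)
  then have "((\<lambda>u. f u / (u - 0)) has_contour_integral (2 * of_real pi * \<i> * f 0)) (circlepath 0 r)"
    using assms by (intro Cauchy_integral_circlepath_simple) auto
  then have "((\<lambda>t. f (0 + of_real r * cis t) / (0 + of_real r * cis t - 0) * of_real r * \<i> * cis t)
       has_integral (2 * of_real pi * \<i> * f 0)) {0..2 * pi}"
    unfolding circlepath_def by (subst (asm) has_contour_integral_part_circlepath_iff) auto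
  then have "((\<lambda>t. f (of_real r * cis t) * \<i>) has_integral (2 * of_real pi * \<i> * f 0)) {0..2 * pi}"
    by (rule has_integral_eq[rotated]) (use assms in auto)
  then have "((\<lambda>t. f (of_real r * cis t) * \<i> * (-\<i>)) has_integral (2 * of_real pi * \<i> * f 0) * (-\<i>)) {0..2 * pi}"
    by (rule has_integral_mult_left)
  then show ?thesis
    by (simp add: mult.assoc) (simp add: mult.left_commute[of \<i>])
qed

lemma mean_value_circle_Re:
  assumes "f holomorphic_on ball 0 R" "0 < r" "r < R"
  shows "((\<lambda>\<theta>. Re (f (of_real r * cis \<theta>))) has_integral 2 * pi * Re (f 0)) {0..2 * pi}"
  using has_integral_Re[OF mean_value_circle[OF assms]] by simp

lemma integral_rotate:
  fixes f :: "complex \<Rightarrow> real"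
  assumes "continuous_on (sphere 0 r) f" "0 \<le> r"
  shows "integral {0..2*pi} (\<lambda>\<theta>. f (of_real r * cis (\<theta> + \<alpha>))) = integral {0..2*pi} (\<lambda>\<theta>. f (of_real r * cis \<theta>))"
proof -
  let ?g = "\<lambda>\<theta>. f (of_real r * cis \<theta>)"
  obtain \<beta> where \<beta>: "0 \<le> \<beta>" "\<beta> < 2 * pi" "cis \<alpha> = cis \<beta>"
    using Arg2pi_ge_0[of "cis \<alpha>"] Arg2pi_lt_2pi[of "cis \<alpha>"] Arg2pi_eq[of "cis \<alpha>"]
    by (metis cis_conv_exp mult_1 norm_cis of_real_1)
  have per: "?g (x + 2 * pi) = ?g x" for x
    by (simp add: cis_mult[symmetric])
  have int: "?g integrable_on {x..y}" for x y
    by (intro integrable_continuous_real continuous_on_circle_param assms)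
  have shift: "integral {x..y} (\<lambda>\<theta>. ?g (\<theta> + c)) = integral {x+c..y+c} ?g" for x y c
    using integral_shift_Icc_real[of x y ?g c] by (simp add: o_def add.commute)
  have "integral {0..2*pi} (\<lambda>\<theta>. f (of_real r * cis (\<theta> + \<alpha>))) = integral {0..2*pi} (\<lambda>\<theta>. ?g (\<theta> + \<beta>))"
    using \<beta> by (simp add: cis_mult[symmetric])
  also have "\<dots> = integral {\<beta>..2*pi+\<beta>} ?g"
    using shift[of 0 "2*pi" \<beta>] by simp
  also have "\<dots> = integral {\<beta>..2*pi} ?g + integral {2*pi..2*pi+\<beta>} ?g"
    using \<beta> int by (subst Henstock_Kurzweil_Integration.integral_combine) auto
  also have "integral {2*pi..2*pi+\<beta>} ?g = integral {0..\<beta>} ?g"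
    using shift[of 0 \<beta> "2*pi"] per by (simp add: add.commute)
  also have "integral {\<beta>..2*pi} ?g + integral {0..\<beta>} ?g = integral {0..2*pi} ?g"
    using \<beta> int by (subst add.commute, subst Henstock_Kurzweil_Integration.integral_combine) auto
  finally show ?thesis .
qed

lemma powr_above_tangent:
  fixes x y q :: real
  assumes "0 \<le> x" "0 \<le> y" "1 < q"
  shows "y powr q + q * y powr (q - 1) * (x - y) \<le> x powr q"
proof -
  consider "y = 0" | "x = 0" "0 < y" | "0 < x" "0 < y"
    using assms by linarith
  then show ?thesis
  proof cases
    case 1
    then show ?thesis by simp
  next
    case 2
    then have "y powr (q - 1) * y = y powr q"
      by (metis powr_mult_base less_eq_real_def mult.commute add_diff_cancel_left' add.commute diff_add_cancel)
    then have "y powr q + q * y powr (q - 1) * (x - y) = (1 - q) * y powr q"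
      using 2 by (simp add: algebra_simps)
    also have "\<dots> \<le> 0"
      using assms by (intro mult_nonpos_nonneg) auto
    finally show ?thesis
      using 2 by simp
  next
    case 3
    have "((\<lambda>x. x powr q) has_real_derivative q * y powr (q - 1)) (at y within {0<..})"
      using 3 by (intro has_field_derivative_at_within[OF has_real_derivative_powr])
    then have "x powr q - y powr q \<ge> q * y powr (q - 1) * (x - y)"
      using 3 assms by (intro convex_on_imp_above_tangent[OF powr_convex]) (auto simp: interior_open)
    then show ?thesis by linarith
  qed
qed

text \<open>Duality and the maximum principle. Writing \<open>G w = \<bar>w\<bar>\<^sup>q\<^sup>-\<^sup>2 \<cdot> cnj w\<close>,
  the function \<open>\<Lambda> z = \<integral> G (F (\<rho> e\<^sup>i\<^sup>\<theta>)) F (z e\<^sup>i\<^sup>\<theta>) d\<theta>\<close> is holomorphic, its value at \<open>\<rho>\<close> is the mean over the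
  circle of radius \<open>\<rho>\<close>, and by convexity of \<open>x\<^sup>q\<close> its real part on the larger circle is at most a
  convex combination of the two means. The maximum principle for the real part of \<open>\<Lambda>\<close> compares
  them.\<close>

lemma hardy_mean_increasing:
  assumes F: "F holomorphic_on ball 0 R" and q: "1 < q" and \<rho>: "0 < \<rho>" "\<rho> \<le> s" and s: "s < R"
  shows "hardy_mean q F \<rho> \<le> hardy_mean q F s"
proof -
  define G where "G w = of_real (norm w powr (q - 2)) * cnj w" for w :: complex
  have normG: "norm (G w) = norm w powr (q - 1)" for w
  proof (cases "w = 0")
    case False
    then have "norm (G w) = norm w powr (q - 2) * norm w powr 1"
      by (simp add: G_def norm_mult)
    also have "\<dots> = norm w powr (q - 1)"
      by (simp only: powr_add[symmetric]) simp
    finally show ?thesis .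
  qed (simp add: G_def)
  have Gw: "G w * w = of_real (norm w powr q)" for w
  proof (cases "w = 0")
    case False
    have "G w * w = of_real (norm w powr (q - 2)) * (w * cnj w)"
      by (simp add: G_def mult_ac)
    also have "\<dots> = of_real (norm w powr (q - 2) * norm w ^ 2)"
      by (simp add: complex_norm_square[symmetric])
    also have "norm w powr (q - 2) * norm w ^ 2 = norm w powr q"
      using powr_add[of "norm w" "q - 2" 2] by simp
    finally show ?thesis .
  qed (simp add: G_def)
  have contG: "continuous_on UNIV G"
  proof -
    have G0: "G 0 = 0"
      by (simp add: G_def)
    have "isCont G w" for w
    proof (cases "w = 0")
      case True
      have "((\<lambda>w::complex. norm w powr (q - 1)) \<longlongrightarrow> 0) (at 0)"
        using q by (intro tendsto_eq_intros tendsto_powr2[where b = "q - 1" and a = 0, simplified])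
          (auto intro!: tendsto_eq_intros)
      then have "((\<lambda>w. norm (G w)) \<longlongrightarrow> 0) (at 0)"
        by (simp add: normG)
      then show ?thesis
        using True tendsto_norm_zero_cancel[of G] by (simp add: isCont_def G0)
    next
      case False
      then show ?thesis
        unfolding G_def by (intro continuous_intros) auto
    qed
    then show ?thesis
      by (simp add: continuous_on_eq_continuous_at)
  qed
  have young: "q * Re (G w * v) \<le> norm v powr q + (q - 1) * norm w powr q" for v w
  proof -
    have "Re (G w * v) \<le> norm w powr (q - 1) * norm v"
      by (metis complex_Re_le_cmod normG norm_mult)
    then have "q * Re (G w * v) \<le> q * (norm w powr (q - 1) * norm v)"
      using q by (intro mult_left_mono) auto
    moreover have "norm w powr (q - 1) * norm w = norm w powr q"
      using norm_mult[of "G w" w] by (simp add: Gw normG)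
    then have "q * (norm w powr (q - 1) * norm w) = q * norm w powr q"
      by simp
    ultimately show ?thesis
      using powr_above_tangent[of "norm v" "norm w" q] q by (simp add: algebra_simps)
  qed
  have contF: "continuous_on (ball 0 R) F"
    using F by (rule holomorphic_on_imp_continuous_on)
  have contr: "continuous_on (sphere 0 r) F" if "0 \<le> r" "r < R" for r
    by (rule continuous_on_subset[OF contF]) (use that in auto)
  define \<gamma> where "\<gamma> \<theta> = G (F (of_real \<rho> * cis \<theta>))" for \<theta>
  have cont\<gamma>: "continuous_on S \<gamma>" for S
    unfolding \<gamma>_def using \<rho> s
    by (intro continuous_on_compose2[OF contG] continuous_on_circle_param contr) auto
  define \<Lambda> where "\<Lambda> z = integral (cbox 0 (2 * pi)) (\<lambda>\<theta>. \<gamma> \<theta> * F (z * cis \<theta>))" for z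
  have cont\<Lambda>: "continuous_on T (\<lambda>\<theta>. \<gamma> \<theta> * F (z * cis \<theta>))" if "z \<in> ball 0 R" for z T
    by (intro continuous_intros cont\<gamma> continuous_on_compose2[OF contF]) (use that in \<open>auto simp: norm_mult\<close>)
  have der: "((\<lambda>z. \<gamma> \<theta> * F (z * cis \<theta>)) has_field_derivative \<gamma> \<theta> * (deriv F (z * cis \<theta>) * cis \<theta>)) (at z)"
    if z: "z \<in> ball 0 R" for z \<theta>
  proof -
    have "(F has_field_derivative deriv F (z * cis \<theta>)) (at (z * cis \<theta>))"
      using F z by (intro holomorphic_derivI[of F "ball 0 R"]) (auto simp: norm_mult)
    moreover have "((\<lambda>z. z * cis \<theta>) has_field_derivative cis \<theta>) (at z)"
      by (auto intro!: derivative_eq_intros)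
    ultimately have "((\<lambda>z. F (z * cis \<theta>)) has_field_derivative deriv F (z * cis \<theta>) * cis \<theta>) (at z)"
      using DERIV_chain2[of F "deriv F (z * cis \<theta>)" "\<lambda>z. z * cis \<theta>" z "cis \<theta>" UNIV] by simp
    then show ?thesis
      by (rule DERIV_cmult)
  qed
  have "continuous_on (ball 0 R) (deriv F)"
    using F by (intro holomorphic_on_imp_continuous_on holomorphic_deriv) auto
  then have "continuous_on (ball 0 R \<times> cbox 0 (2 * pi)) (\<lambda>x. deriv F (fst x * cis (snd x)))"
    by (rule continuous_on_compose2[where f = "\<lambda>x. fst x * cis (snd x)"])
       (auto intro!: continuous_intros simp: norm_mult)
  moreover have "continuous_on (ball 0 R \<times> cbox 0 (2 * pi)) (\<lambda>x. \<gamma> (snd x))"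
    by (rule continuous_on_compose2[OF cont\<gamma>[of UNIV], where f = snd]) (auto intro!: continuous_intros)
  moreover have "continuous_on (ball 0 R \<times> cbox 0 (2 * pi)) (\<lambda>x. cis (snd x))"
    by (intro continuous_intros)
  ultimately have contD: "continuous_on (ball 0 R \<times> cbox 0 (2 * pi)) (\<lambda>(z, \<theta>). \<gamma> \<theta> * (deriv F (z * cis \<theta>) * cis \<theta>))"
    unfolding split_beta by (intro continuous_on_mult)
  have \<Lambda>: "\<Lambda> holomorphic_on ball 0 R"
    unfolding \<Lambda>_def
    by (rule leibniz_rule_holomorphic[where f = "\<lambda>z \<theta>. \<gamma> \<theta> * F (z * cis \<theta>)"
          and fx = "\<lambda>z \<theta>. \<gamma> \<theta> * (deriv F (z * cis \<theta>) * cis \<theta>)"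
          , OF has_field_derivative_at_within[OF der] integrable_continuous[OF cont\<Lambda>] contD convex_ball])
  have int\<Lambda>: "((\<lambda>\<theta>. Re (\<gamma> \<theta> * F (z * cis \<theta>))) has_integral Re (\<Lambda> z)) {0..2*pi}"
    if "z \<in> ball 0 R" for z :: complex
    using has_integral_Re[OF integrable_integral[OF integrable_continuous[OF cont\<Lambda>[OF that]]]]
    by (simp add: \<Lambda>_def)
  let ?B = "(hardy_mean q F s + (q - 1) * hardy_mean q F \<rho>) / q"
  have bound: "Re (\<Lambda> z) \<le> ?B" if z: "z \<in> sphere 0 s" for z :: complex
  proof -
    obtain \<alpha> where \<alpha>: "z = of_real s * cis \<alpha>"
      using z rcis_cmod_Arg[of z] by (metis mem_sphere_0 rcis_def)
    have rot: "z * cis \<theta> = of_real s * cis (\<theta> + \<alpha>)" for \<theta>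
      by (simp add: \<alpha> cis_mult[symmetric] mult_ac)
    let ?w = "\<lambda>\<theta>. F (of_real \<rho> * cis \<theta>)"
    have c: "continuous_on (sphere 0 s) (\<lambda>u. norm (F u) powr q)"
      using contr[of s] \<rho> s q by (intro continuous_on_powr') (auto intro!: continuous_intros)
    have "(\<lambda>\<theta>. norm (F (of_real s * cis (\<theta> + \<alpha>))) powr q) integrable_on {0..2*pi}"
      by (intro integrable_continuous_real continuous_on_compose2[OF c])
         (use \<rho> in \<open>auto intro!: continuous_intros simp: norm_mult\<close>)
    then have "((\<lambda>\<theta>. norm (F (z * cis \<theta>)) powr q) has_integral hardy_mean q F s) {0..2*pi}"
      using integral_rotate[OF c, of \<alpha>] \<rho> by (simp add: rot has_integral_iff hardy_mean_def)
    moreover have "((\<lambda>\<theta>. norm (?w \<theta>) powr q) has_integral hardy_mean q F \<rho>) {0..2*pi}"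
      unfolding hardy_mean_def using \<rho> s q
      by (intro integrable_integral integrable_hardy_integrand contr) auto
    ultimately have "((\<lambda>\<theta>. norm (F (z * cis \<theta>)) powr q + (q - 1) * norm (?w \<theta>) powr q) has_integral
        hardy_mean q F s + (q - 1) * hardy_mean q F \<rho>) {0..2*pi}"
      by (intro has_integral_add has_integral_mult_right)
    moreover have "((\<lambda>\<theta>. q * Re (\<gamma> \<theta> * F (z * cis \<theta>))) has_integral q * Re (\<Lambda> z)) {0..2*pi}"
      using z s by (intro has_integral_mult_right int\<Lambda>) auto
    ultimately have "q * Re (\<Lambda> z) \<le> hardy_mean q F s + (q - 1) * hardy_mean q F \<rho>"
      using young unfolding \<gamma>_def by (meson has_integral_le)
    then show ?thesis
      using q by (simp add: field_simps)
  qed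
  have "Re (\<Lambda> (of_real \<rho>)) \<le> ?B"
  proof (rule maximum_real_frontier[of \<Lambda> "cball 0 s"])
    show "\<Lambda> holomorphic_on interior (cball 0 s)" "continuous_on (closure (cball 0 s)) \<Lambda>"
      using s \<Lambda> by (auto intro!: holomorphic_on_imp_continuous_on elim!: holomorphic_on_subset)
  qed (use bound \<rho> in auto)
  moreover have "Re (\<Lambda> (of_real \<rho>)) = hardy_mean q F \<rho>"
    using int\<Lambda>[of "of_real \<rho>"] \<rho> s by (simp add: \<gamma>_def Gw hardy_mean_def integral_unique)
  ultimately have "q * hardy_mean q F \<rho> \<le> hardy_mean q F s + (q - 1) * hardy_mean q F \<rho>"
    using q by (simp add: field_simps)
  then show ?thesis
    by (simp add: algebra_simps)
qed

text \<open>Cauchy's formula over the circle halfway between the point and the boundary; the inequality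
  \<open>\<bar>F\<bar> \<le> 1 + \<bar>F\<bar>\<^sup>p\<close> brings in the mean of exponent \<open>p\<close>.\<close>

lemma hardy_growth:
  assumes F: "F holomorphic_on unit_disc" and p: "1 \<le> p"
    and N: "\<And>r. 0 < r \<Longrightarrow> r < 1 \<Longrightarrow> hardy_mean p F r \<le> N" and z: "z \<in> unit_disc"
  shows "norm (F z) \<le> (2 * pi + N) / (pi * (1 - norm z))"
proof -
  define s where "s = (1 + norm z) / 2"
  have s: "0 < s" "s < 1" "norm z < s"
    using z norm_ge_zero[of z] unfolding s_def by (auto intro: add_pos_nonneg)
  have holo: "F holomorphic_on cball 0 s"
    by (rule holomorphic_on_subset[OF F]) (use s in auto)
  then have "((\<lambda>u. F u / (u - z)) has_contour_integral (2 * of_real pi * \<i> * F z)) (circlepath 0 s)"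
    using s by (intro Cauchy_integral_circlepath_simple) auto
  then have I: "((\<lambda>t. F (0 + of_real s * cis t) / (0 + of_real s * cis t - z) * of_real s * \<i> * cis t)
       has_integral (2 * of_real pi * \<i> * F z)) {0..2 * pi}"
    unfolding circlepath_def by (subst (asm) has_contour_integral_part_circlepath_iff) auto
  have cF: "continuous_on (sphere 0 s) F"
    using holo by (intro holomorphic_on_imp_continuous_on) (auto elim: holomorphic_on_subset)
  have J: "((\<lambda>t. (1 + norm (F (of_real s * cis t)) powr p) * (2 / (1 - norm z)))
      has_integral (2 * pi + hardy_mean p F s) * (2 / (1 - norm z))) {0..2*pi}"
  proof (intro has_integral_mult_left has_integral_add)
    show "((\<lambda>t. 1) has_integral 2 * pi) {0..2*pi}"
      using has_integral_const_real[of "1::real" 0 "2*pi"] by simp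
    show "((\<lambda>t. norm (F (of_real s * cis t)) powr p) has_integral hardy_mean p F s) {0..2*pi}"
      unfolding hardy_mean_def using integrable_hardy_integrand[OF cF, of p] s p
      by (intro integrable_integral) auto
  qed
  have "norm (2 * of_real pi * \<i> * F z) \<le> (2 * pi + hardy_mean p F s) * (2 / (1 - norm z))"
    unfolding integral_unique[OF I, symmetric] integral_unique[OF J, symmetric]
  proof (rule integral_norm_bound_integral[OF has_integral_integrable[OF I] has_integral_integrable[OF J]])
    fix t
    let ?u = "of_real s * cis t"
    have u: "norm ?u = s"
      using s by (simp add: norm_mult)
    have "(1 - norm z) / 2 = s - norm z"
      by (simp add: s_def field_simps)
    also have "\<dots> \<le> norm (?u - z)"
      using norm_triangle_ineq2[of ?u z] u by simp
    finally have d: "(1 - norm z) / 2 \<le> norm (?u - z)" .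
    have pw: "norm (F ?u) \<le> 1 + norm (F ?u) powr p"
    proof (cases "norm (F ?u) \<le> 1")
      case False
      then show ?thesis
        using powr_mono[of 1 p "norm (F ?u)"] p by simp
    qed (simp add: add_increasing2)
    have "norm (F (0 + ?u) / (0 + ?u - z) * of_real s * \<i> * cis t) = norm (F ?u) * s / norm (?u - z)"
      using s by (simp add: norm_mult norm_divide)
    also have "\<dots> \<le> (1 + norm (F ?u) powr p) * 1 / ((1 - norm z) / 2)"
      using z s pw d by (intro frac_le mult_mono) auto
    finally show "norm (F (0 + ?u) / (0 + ?u - z) * of_real s * \<i> * cis t)
        \<le> (1 + norm (F ?u) powr p) * (2 / (1 - norm z))"
      by simp
  qed
  also have "\<dots> \<le> (2 * pi + N) * (2 / (1 - norm z))"
    using N[of s] s z by (intro mult_right_mono) auto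
  finally show ?thesis
    using z by (simp add: norm_mult field_simps)
qed

lemma hardy_mean_eq_0:
  assumes "continuous_on (sphere 0 (norm z)) f" "0 < p" "hardy_mean p f (norm z) = 0"
  shows "f z = 0"
proof -
  have "\<forall>\<theta>\<in>{0..2*pi}. norm (f (of_real (norm z) * cis \<theta>)) powr p = 0"
    using assms continuous_on_hardy_integrand[OF assms(1) norm_ge_zero assms(2), of "{0..2*pi}"]
    unfolding hardy_mean_def by (subst (asm) integral_eq_0_iff) auto
  moreover have "Arg2pi z \<in> {0..2*pi}"
    using Arg2pi_ge_0[of z] Arg2pi_lt_2pi[of z] by auto
  ultimately have "norm (f (of_real (norm z) * cis (Arg2pi z))) powr p = 0"
    by (rule bspec)
  then have "f (of_real (norm z) * cis (Arg2pi z)) = 0"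
    unfolding powr_eq_0_iff norm_eq_zero .
  moreover have "of_real (norm z) * cis (Arg2pi z) = z"
    unfolding cis_conv_exp by (rule Arg2pi_eq[symmetric])
  ultimately show ?thesis
    by (simp only:)
qed

section \<open>Riesz factorization and convergence of dilations\<close>

lemma powr_add_le:
  fixes x y p :: real
  assumes "0 \<le> x" "0 \<le> y" "0 < p"
  shows "(x + y) powr p \<le> 2 powr p * (x powr p + y powr p)"
proof -
  have "(x + y) powr p \<le> (2 * max x y) powr p"
    using assms by (intro powr_mono2) auto
  also have "\<dots> = 2 powr p * max x y powr p"
    using assms by (simp add: powr_mult)
  also have "\<dots> \<le> 2 powr p * (x powr p + y powr p)"
    by (intro mult_left_mono) (auto simp: max_def)
  finally show ?thesis .
qed

lemma powr_superadditive:
  fixes x y t :: real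
  assumes "0 \<le> x" "0 \<le> y" "1 \<le> t"
  shows "x powr t + y powr t \<le> (x + y) powr t"
proof -
  have eq: "u powr t = u powr (t - 1) * u" if "0 \<le> u" for u :: real
    using that powr_mult_base[of u "t - 1"] by (simp add: mult.commute)
  have "x powr t + y powr t = x powr (t - 1) * x + y powr (t - 1) * y"
    using assms by (simp add: eq)
  also have "\<dots> \<le> (x + y) powr (t - 1) * x + (x + y) powr (t - 1) * y"
    using assms by (intro add_mono mult_right_mono powr_mono2) auto
  also have "\<dots> = (x + y) powr t"
    using assms eq[of "x + y"] by (simp add: algebra_simps)
  finally show ?thesis .
qed

lemma powr_midpoint_le:
  fixes x y t :: real
  assumes "0 \<le> x" "0 \<le> y" "1 \<le> t"
  shows "((x + y) / 2) powr t \<le> (x powr t + y powr t) / 2"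
proof (cases "t = 1")
  case False
  define m where "m = (x + y) / 2"
  have "m powr t + t * m powr (t - 1) * (x - m) \<le> x powr t"
       "m powr t + t * m powr (t - 1) * (y - m) \<le> y powr t"
    using assms False by (auto intro!: powr_above_tangent simp: m_def)
  moreover have "y - m = - (x - m)"
    by (simp add: m_def field_simps)
  ultimately have "2 * m powr t \<le> x powr t + y powr t"
    by (simp add: algebra_simps)
  then show ?thesis
    by (simp add: m_def)
qed (use assms in simp)

text \<open>The parallelogram law, raised to the power \<open>q / 2\<close>, which is superadditive and convex.\<close>

lemma clarkson:
  fixes a b :: complex
  assumes q: "2 \<le> q"
  shows "norm ((a - b) / 2) powr q + norm ((a + b) / 2) powr q \<le> 1/2 * norm a powr q + 1/2 * norm b powr q"
proof -
  have sq: "norm u powr q = (norm u ^ 2) powr (q / 2)" for u :: complex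
    using powr_powr[of "norm u" 2 "q / 2"] by simp
  have par: "norm ((a - b) / 2) ^ 2 + norm ((a + b) / 2) ^ 2 = (norm a ^ 2 + norm b ^ 2) / 2"
    unfolding norm_divide power_divide cmod_power2
    by (simp add: power2_eq_square algebra_simps add_divide_distrib diff_divide_distrib)
  have "norm ((a - b) / 2) powr q + norm ((a + b) / 2) powr q
      \<le> (norm ((a - b) / 2) ^ 2 + norm ((a + b) / 2) ^ 2) powr (q / 2)"
    unfolding sq using q by (intro powr_superadditive) auto
  also have "\<dots> \<le> (norm a powr q + norm b powr q) / 2"
    unfolding par sq using q by (intro powr_midpoint_le) auto
  also have "\<dots> = 1/2 * norm a powr q + 1/2 * norm b powr q"
    by (simp add: add_divide_distrib)
  finally show ?thesis .
qed

lemma holomorphic_dilate: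
  assumes "f holomorphic_on unit_disc" "0 < r"
  shows "(\<lambda>z. f (of_real r * z)) holomorphic_on ball 0 (1 / r)"
  using assms(2)
  by (intro holomorphic_on_compose_gen[OF _ assms(1), unfolded o_def])
     (auto intro!: holomorphic_intros simp: norm_mult field_simps)

lemma continuous_on_sphere_if_holomorphic:
  assumes "f holomorphic_on ball 0 R" "r < R"
  shows "continuous_on (sphere 0 r) f"
  using holomorphic_on_imp_continuous_on[OF assms(1)]
  by (rule continuous_on_subset) (use assms(2) in auto)

lemma continuous_on_sphere_dilate:
  assumes "f holomorphic_on unit_disc" "0 < r" "r < 1" "s \<le> 1"
  shows "continuous_on (sphere 0 s) (\<lambda>z. f (of_real r * z))"
proof (rule continuous_on_sphere_if_holomorphic[OF holomorphic_dilate])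
  show "s < 1 / r"
    using assms by (smt (verit) less_divide_eq_1_pos)
qed (use assms in auto)

lemma tendsto_dilation:
  assumes "f holomorphic_on unit_disc" "z \<in> unit_disc" "r \<longlonglongrightarrow> (1::real)"
  shows "(\<lambda>n. f (of_real (r n) * z)) \<longlonglongrightarrow> f z"
proof -
  have "isCont f z"
    using assms by (intro continuous_on_interior[OF holomorphic_on_imp_continuous_on]) auto
  then show ?thesis
    by (rule isCont_tendsto_compose) (use assms(3) in \<open>auto intro!: tendsto_eq_intros\<close>)
qed

text \<open>Uniform convexity of \<open>L\<^sup>q\<close>: the mean of \<open>(f + f\<^sub>r) / 2\<close> over one circle of radius \<open>s\<^sub>0\<close> is close to
  the supremum of the means of \<open>f\<close>, hence so are the means over all larger circles, and the
  inequality of Clarkson makes \<open>f - f\<^sub>r\<close> small.\<close>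

lemma dilations_converge_ge2:
  assumes f: "f holomorphic_on unit_disc" and q: "2 \<le> q"
    and N: "\<And>s. 0 < s \<Longrightarrow> s < 1 \<Longrightarrow> hardy_mean q f s \<le> N"
    and r: "\<And>n. 0 < r n" "\<And>n. r n < 1" "r \<longlonglongrightarrow> 1" and e: "0 < e"
  shows "\<forall>\<^sub>F n in sequentially. \<forall>s. 0 < s \<and> s < 1 \<longrightarrow> hardy_mean q (\<lambda>z. f z - f (of_real (r n) * z)) s \<le> e"
proof -
  define M where "M = (SUP s\<in>{0<..<1}. hardy_mean q f s)"
  have bdd: "bdd_above (hardy_mean q f ` {0<..<1})"
    using N by (auto intro!: bdd_aboveI)
  have M: "hardy_mean q f s \<le> M" if "0 < s" "s < 1" for s
    unfolding M_def using that bdd by (intro cSUP_upper) auto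
  define e' where "e' = e / (2 * 2 powr q)"
  have e': "0 < e'"
    using e by (simp add: e'_def)
  obtain s0 where s0: "0 < s0" "s0 < 1" "M - e' < hardy_mean q f s0"
    using less_cSUP_iff[of "{0<..<1::real}" "hardy_mean q f" "M - e'"] bdd e' by (auto simp: M_def)
  define F where "F n z = (f z + f (of_real (r n) * z)) / 2" for n z
  have cf: "continuous_on (sphere 0 s) f" if "s < 1" for s
    using continuous_on_sphere_if_holomorphic f that by blast
  have cfr: "continuous_on (sphere 0 s) (\<lambda>z. f (of_real (r n) * z))" if "s < 1" for s n
    using continuous_on_sphere_dilate[OF f r(1,2)] that by simp
  have cF: "continuous_on (sphere 0 s) (F n)" if "s < 1" for s n
    unfolding F_def using cf[OF that] cfr[OF that] by (intro continuous_intros) auto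
  have "continuous_on (cball 0 s0) f"
    using holomorphic_on_imp_continuous_on[OF f] by (rule continuous_on_subset) (use s0 in auto)
  then have "bounded (f ` cball 0 s0)"
    by (intro compact_imp_bounded compact_continuous_image) auto
  then obtain K where K: "\<And>z. z \<in> cball 0 s0 \<Longrightarrow> norm (f z) \<le> K"
    unfolding bounded_iff by blast
  have "(\<lambda>n. hardy_mean q (F n) s0) \<longlonglongrightarrow> hardy_mean q f s0"
  proof (rule hardy_mean_tendsto)
    fix n and z :: complex assume z: "z \<in> sphere 0 s0"
    then have "norm (of_real (r n) * z) \<le> 1 * s0"
      unfolding norm_mult using r(1,2)[of n] by (intro mult_mono) auto
    then have "norm (f z) \<le> K" "norm (f (of_real (r n) * z)) \<le> K"
      using z by (auto intro!: K)
    then show "norm (F n z) \<le> K"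
      using norm_triangle_ineq[of "f z" "f (of_real (r n) * z)"] by (simp add: F_def norm_divide)
  next
    fix z :: complex assume z: "z \<in> sphere 0 s0"
    then have "(\<lambda>n. f (of_real (r n) * z)) \<longlonglongrightarrow> f z"
      using s0 by (intro tendsto_dilation[OF f _ r(3)]) auto
    then show "(\<lambda>n. F n z) \<longlonglongrightarrow> f z"
      unfolding F_def by (auto intro!: tendsto_eq_intros)
  qed (use s0 q cF in auto)
  then have "\<forall>\<^sub>F n in sequentially. M - e' < hardy_mean q (F n) s0"
    using s0(3) by (rule order_tendstoD)
  then show ?thesis
  proof eventually_elim
    case (elim n)
    let ?d = "\<lambda>z. (f z - f (of_real (r n) * z)) / 2"
    have cd: "continuous_on (sphere 0 s) ?d" if "s < 1" for s
      using cf[OF that] cfr[OF that] by (intro continuous_intros) auto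
    have "1 \<le> 1 / r n"
      using r(1,2)[of n] by simp
    then have holf: "(\<lambda>z. f (of_real (r n) * z)) holomorphic_on unit_disc"
      using r(1) by (intro holomorphic_on_subset[OF holomorphic_dilate[OF f]] subset_ball)
    have holF: "F n holomorphic_on unit_disc" and hold: "?d holomorphic_on unit_disc"
      unfolding F_def using f holf by (auto intro!: holomorphic_intros)
    have ge: "hardy_mean q ?d s \<le> e'" if s: "s0 \<le> s" "s < 1" for s
    proof -
      have "hardy_mean q ?d s + hardy_mean q (F n) s
          \<le> 1/2 * hardy_mean q f s + 1/2 * hardy_mean q (\<lambda>z. f (of_real (r n) * z)) s + 2 * pi * 0"
      proof (rule hardy_mean_add_le)
        fix z :: complex
        show "norm (?d z) powr q + norm (F n z) powr q
            \<le> 1/2 * norm (f z) powr q + 1/2 * norm (f (of_real (r n) * z)) powr q + 0"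
          unfolding F_def add_0_right by (rule clarkson[OF q])
      qed (use s s0 q cf cfr cd cF in auto)
      also have "\<dots> \<le> 1/2 * M + 1/2 * M + 0"
      proof -
        have "r n * s < 1"
          using r(1,2)[of n] s s0 by (smt (verit) mult_less_cancel_right2)
        then show ?thesis
          unfolding hardy_mean_dilate using M[of s] M[of "r n * s"] r(1)[of n] s s0 by simp
      qed
      finally have "hardy_mean q ?d s \<le> M - hardy_mean q (F n) s" by simp
      also have "\<dots> \<le> M - hardy_mean q (F n) s0"
        using hardy_mean_increasing[OF holF _ s0(1) s] q s by simp
      finally show ?thesis
        using elim by simp
    qed
    show ?case
    proof safe
      fix s :: real assume s: "0 < s" "s < 1"
      have "hardy_mean q (\<lambda>z. f z - f (of_real (r n) * z)) s \<le> 2 powr q * hardy_mean q ?d s + 2 * pi * 0"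
      proof (rule hardy_mean_mono)
        show "continuous_on (sphere 0 s) (\<lambda>z. f z - f (of_real (r n) * z))"
          using cf cfr s by (intro continuous_intros) auto
        show "norm (f z - f (of_real (r n) * z)) powr q \<le> 2 powr q * norm (?d z) powr q + 0" for z :: complex
          by (simp add: norm_divide powr_divide)
      qed (use s q cd in auto)
      also have "hardy_mean q ?d s \<le> e'"
      proof (cases "s0 \<le> s")
        case False
        then have "hardy_mean q ?d s \<le> hardy_mean q ?d s0"
          using hardy_mean_increasing[OF hold, of q s s0] q s s0 by auto
        also have "\<dots> \<le> e'"
          using ge[of s0] s0 by simp
        finally show ?thesis .
      qed (use ge s in auto)
      also have "2 powr q * e' + 2 * pi * 0 \<le> e"
        using e by (simp add: e'_def)
      finally show "hardy_mean q (\<lambda>z. f z - f (of_real (r n) * z)) s \<le> e" by simp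
    qed
  qed
qed

lemma norm_blaschke_le_1:
  assumes "norm a < 1" "norm z < 1"
  shows "norm ((z - a) / (1 - cnj a * z)) \<le> 1"
  using Moebius_function_norm_lt_1[OF assms, of 0] by (simp add: Moebius_function_simple)

lemma one_minus_cnj_mult_nz:
  assumes "norm a < 1" "norm z \<le> 1"
  shows "1 - cnj a * z \<noteq> 0"
proof
  assume "1 - cnj a * z = 0"
  then have "norm a * norm z = 1"
    by (metis complex_mod_cnj eq_iff_diff_eq_0 norm_mult norm_one)
  moreover have "norm a * norm z \<le> norm a * 1"
    using assms by (intro mult_left_mono) auto
  ultimately show False
    using assms by simp
qed

lemma norm_one_minus_cnj_mult_circle:
  assumes "norm z = 1"
  shows "norm (1 - cnj a * z) = norm (z - a)"
proof -
  have "z * cnj z = 1"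
    using complex_norm_square[of z] assms by simp
  then have "1 - cnj a * z = z * cnj (z - a)"
    by (simp add: algebra_simps)
  then show ?thesis
    using assms by (simp add: norm_mult del: complex_cnj_diff)
qed

text \<open>Zeros are divided out one at a time, each by the power of a Blaschke factor that matches its
  order; a Blaschke factor has modulus \<open>1\<close> on the circle, so that boundary moduli are preserved.\<close>

lemma finite_blaschke_factorization:
  assumes "F holomorphic_on ball 0 R" "1 < R" "finite {z \<in> unit_disc. F z = 0}"
  shows "\<exists>B G. B holomorphic_on unit_disc \<and> (\<forall>z\<in>unit_disc. norm (B z) \<le> 1) \<and>
    G holomorphic_on ball 0 R \<and> (\<forall>z\<in>unit_disc. G z \<noteq> 0) \<and>
    (\<forall>z\<in>unit_disc. F z = B z * G z) \<and> (\<forall>z\<in>sphere 0 1. norm (G z) = norm (F z))"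
  using assms
proof (induction "card {z \<in> unit_disc. F z = 0}" arbitrary: F)
  case 0
  then have "\<forall>z\<in>unit_disc. F z \<noteq> 0"
    by auto
  then show ?case
    using 0 by (intro exI[of _ "\<lambda>z. 1"] exI[of _ F]) auto
next
  case (Suc m)
  let ?Z = "{z \<in> unit_disc. F z = 0}"
  have "?Z \<noteq> {}"
    using Suc.hyps(2) card.empty by (metis (no_types) nat.simps(3))
  then obtain a where a: "norm a < 1" "F a = 0"
    by auto
  have aR: "a \<in> ball 0 R"
    using a Suc.prems by auto
  have "\<not> F constant_on ball 0 R"
  proof
    assume "F constant_on ball 0 R"
    then have "F z = 0" if "z \<in> ball 0 R" for z
      using a aR that unfolding constant_on_def by metis
    then have "?Z = unit_disc"
      using Suc.prems(2) by auto
    then show False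
      using Suc.prems(3) uncountable_ball[of 1 "0::complex"] countable_finite[of unit_disc] by simp
  qed
  then obtain g r n where gr: "0 < n" "0 < r" "ball a r \<subseteq> ball 0 R" "g holomorphic_on ball a r"
      "\<And>w. w \<in> ball a r \<Longrightarrow> F w = (w - a) ^ n * g w" "\<And>w. w \<in> ball a r \<Longrightarrow> g w \<noteq> 0"
    by (rule holomorphic_factor_zero_nonconstant[OF Suc.prems(1) open_ball connected_ball aR a(2)]) blast
  define G1 where "G1 z = (if z = a then g a else F z / (z - a) ^ n)" for z
  have "G1 holomorphic_on (ball 0 R - {a}) \<union> ball a r"
  proof (rule holomorphic_on_Un)
    have "(\<lambda>z. F z / (z - a) ^ n) holomorphic_on ball 0 R - {a}"
      by (intro holomorphic_intros holomorphic_on_subset[OF Suc.prems(1)]) auto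
    then show "G1 holomorphic_on ball 0 R - {a}"
      by (rule holomorphic_transform) (simp add: G1_def)
    show "G1 holomorphic_on ball a r"
      by (rule holomorphic_transform[OF gr(4)]) (use gr in \<open>simp add: G1_def\<close>)
  qed auto
  moreover have "(ball 0 R - {a}) \<union> ball a r = ball 0 R"
    using gr(2,3) aR by auto
  ultimately have G1: "G1 holomorphic_on ball 0 R"
    by simp
  define F1 where "F1 z = G1 z * (1 - cnj a * z) ^ n" for z
  have F1: "F1 holomorphic_on ball 0 R"
    unfolding F1_def using G1 by (intro holomorphic_intros)
  have nz: "1 - cnj a * z \<noteq> 0" if "norm z \<le> 1" for z
    using one_minus_cnj_mult_nz[OF a(1) that] .
  have G1a: "G1 a \<noteq> 0"
    using gr(2,6) by (simp add: G1_def)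
  have Z: "{z \<in> unit_disc. F1 z = 0} = ?Z - {a}"
    using nz G1a a by (auto simp: F1_def G1_def)
  have "card {z \<in> unit_disc. F1 z = 0} = m"
    unfolding Z using Suc.hyps(2) Suc.prems(3) a by (subst card_Diff_singleton) auto
  moreover have "finite {z \<in> unit_disc. F1 z = 0}"
    unfolding Z using Suc.prems(3) by auto
  ultimately obtain B G where BG: "B holomorphic_on unit_disc" "\<And>z. z \<in> unit_disc \<Longrightarrow> norm (B z) \<le> 1"
      "G holomorphic_on ball 0 R" "\<And>z. z \<in> unit_disc \<Longrightarrow> G z \<noteq> 0"
      "\<And>z. z \<in> unit_disc \<Longrightarrow> F1 z = B z * G z" "\<And>z. z \<in> sphere 0 1 \<Longrightarrow> norm (G z) = norm (F1 z)"
    using Suc.hyps(1)[of F1] F1 Suc.prems(2) by blast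
  define b where "b z = (z - a) / (1 - cnj a * z)" for z
  have "F z = b z ^ n * B z * G z" if z: "z \<in> unit_disc" for z
  proof -
    have "F z = G1 z * (z - a) ^ n"
      using a gr(1) by (simp add: G1_def)
    also have "\<dots> = F1 z * b z ^ n"
      using nz[of z] z by (simp add: F1_def b_def power_divide)
    finally show ?thesis
      using BG(5)[OF z] by simp
  qed
  moreover have "(\<lambda>z. b z ^ n * B z) holomorphic_on unit_disc"
    unfolding b_def using BG(1) nz by (intro holomorphic_intros) auto
  moreover have "norm (b z ^ n * B z) \<le> 1" if z: "z \<in> unit_disc" for z
    using norm_blaschke_le_1[OF a(1), of z] BG(2)[OF z] z
    by (simp add: norm_mult norm_power b_def power_le_one mult_le_one)
  moreover have "norm (G z) = norm (F z)" if z: "z \<in> sphere 0 1" for z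
  proof -
    have "z \<noteq> a"
      using a z by auto
    then show ?thesis
      using BG(6)[OF z] norm_one_minus_cnj_mult_circle[of z a] z
      by (simp add: F1_def G1_def norm_mult norm_divide norm_power)
  qed
  ultimately show ?case
    using BG(3,4) by (intro exI[of _ "\<lambda>z. b z ^ n * B z"] exI[of _ G]) auto
qed

lemma compact_subset_unit_disc:
  assumes "compact K" "K \<subseteq> unit_disc"
  obtains \<rho> where "0 < \<rho>" "\<rho> < 1" "K \<subseteq> cball 0 \<rho>"
proof (cases "K = {}")
  case True
  then show ?thesis using that[of "1/2"] by simp
next
  case False
  obtain z where z: "z \<in> K" "\<And>w. w \<in> K \<Longrightarrow> norm w \<le> norm z"
    using continuous_attains_sup[OF assms(1) False, of norm] continuous_on_norm[OF continuous_on_id] by blast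
  show ?thesis
  proof (rule that[of "(1 + norm z) / 2"])
    show "0 < (1 + norm z) / 2"
      by (simp add: add_pos_nonneg)
    show "(1 + norm z) / 2 < 1"
      using z assms(2) by auto
    have "norm w \<le> (1 + norm z) / 2" if "w \<in> K" for w
    proof -
      have "norm w < 1"
        using that assms(2) by auto
      then show ?thesis
        using z(2)[OF that] by simp
    qed
    then show "K \<subseteq> cball 0 ((1 + norm z) / 2)"
      by auto
  qed
qed

definition dilation_radius :: "nat \<Rightarrow> real" where
  "dilation_radius n = 1 - 1 / real (n + 2)"

lemma dilation_radius: "0 < dilation_radius n" "dilation_radius n < 1" "dilation_radius \<longlonglongrightarrow> 1"
proof -
  show "0 < dilation_radius n" "dilation_radius n < 1"
    by (simp_all add: dilation_radius_def)
  have "(\<lambda>n. 1 - 1 / real (n + 2)) \<longlonglongrightarrow> 1 - 0"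
    by (intro tendsto_diff tendsto_const LIMSEQ_ignore_initial_segment[OF lim_1_over_n])
  then show "dilation_radius \<longlonglongrightarrow> 1"
    by (simp add: dilation_radius_def[abs_def])
qed

text \<open>A factorization of the dilation \<open>z \<mapsto> f (r z)\<close>: after its finitely many zeros are divided out,
  the zero-free factor has a holomorphic square root, whose means of exponent \<open>2 p\<close> are those of
  the zero-free factor of exponent \<open>p\<close>.\<close>

lemma dilation_factorization:
  assumes f: "f holomorphic_on unit_disc" and p: "1 \<le> p" and r: "0 < r" "r < 1"
    and N: "hardy_mean p f r \<le> N" and nz: "\<not> (\<forall>z\<in>unit_disc. f z = 0)"
  shows "\<exists>B g. B holomorphic_on unit_disc \<and> (\<forall>z\<in>unit_disc. norm (B z) \<le> 1) \<and>
    g holomorphic_on unit_disc \<and> (\<forall>s. 0 < s \<and> s < 1 \<longrightarrow> hardy_mean (2 * p) g s \<le> N) \<and>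
    (\<forall>z\<in>unit_disc. f (of_real r * z) = B z * (g z)\<^sup>2)"
proof -
  define F where "F z = f (of_real r * z)" for z
  have R: "1 < 1 / r"
    using r by simp
  have F: "F holomorphic_on ball 0 (1 / r)"
    unfolding F_def using f r by (intro holomorphic_dilate) auto
  have fin: "finite {z \<in> unit_disc. F z = 0}"
  proof (cases "F constant_on ball 0 (1 / r)")
    case True
    then obtain c where c: "\<And>z. z \<in> ball 0 (1 / r) \<Longrightarrow> F z = c"
      by (auto simp: constant_on_def)
    have "f z = c" if "z \<in> unit_disc" for z
      using c[of "z / of_real r"] that r by (simp add: F_def norm_divide field_simps)
    then have "c \<noteq> 0"
      using nz by auto
    then have "{z \<in> unit_disc. F z = 0} = {}"
      using c R by auto
    then show ?thesis by (simp only: finite.emptyI)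
  next
    case False
    then have "finite {z \<in> cball 0 1. F z = 0}"
      using R by (intro holomorphic_compact_finite_zeros[OF F]) auto
    then show ?thesis
      by (rule finite_subset[rotated]) auto
  qed
  obtain B G where BG: "B holomorphic_on unit_disc" "\<forall>z\<in>unit_disc. norm (B z) \<le> 1"
    "G holomorphic_on ball 0 (1 / r)" "\<forall>z\<in>unit_disc. G z \<noteq> 0"
    "\<forall>z\<in>unit_disc. F z = B z * G z" "\<forall>z\<in>sphere 0 1. norm (G z) = norm (F z)"
    using finite_blaschke_factorization[OF F R fin] by blast
  have G': "G holomorphic_on unit_disc"
    by (rule holomorphic_on_subset[OF BG(3)]) (use R in auto)
  obtain g where g: "g holomorphic_on unit_disc" "\<And>z. z \<in> unit_disc \<Longrightarrow> G z = g z ^ 2"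
    using contractible_imp_holomorphic_sqrt[OF G'] BG(4) convex_imp_contractible[OF convex_ball] by blast
  have mean: "hardy_mean (2 * p) g s = hardy_mean p G s" if s: "0 < s" "s < 1" for s
  proof -
    have "norm (g z) powr (2 * p) = norm (G z) powr p" if "norm z = s" for z
      using g(2)[of z] that s powr_powr[of "norm (g z)" 2 p] by (simp add: norm_power)
    moreover have "norm (of_real s * cis \<theta>) = s" for \<theta>
      using s by (simp add: norm_mult)
    ultimately show ?thesis
      unfolding hardy_mean_def by simp
  qed
  have "hardy_mean (2 * p) g s \<le> N" if s: "0 < s" "s < 1" for s
  proof -
    have cG: "continuous_on (cball 0 1) G"
      by (rule continuous_on_subset[OF holomorphic_on_imp_continuous_on[OF BG(3)]]) (use R in auto)
    then obtain M where M: "\<And>z. z \<in> cball 0 1 \<Longrightarrow> norm (G z) \<le> M"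
      using compact_imp_bounded[OF compact_continuous_image[OF cG compact_cball]]
      unfolding bounded_iff by blast
    have in_disc: "of_real (dilation_radius n) * z \<in> unit_disc" if "norm z = 1" for n z
      using dilation_radius(1,2)[of n] that by (simp add: norm_mult)
    have "(\<lambda>n. hardy_mean p (\<lambda>z. G (of_real (dilation_radius n) * z)) 1) \<longlonglongrightarrow> hardy_mean p G 1"
    proof (rule hardy_mean_tendsto)
      show "continuous_on (sphere 0 1) (\<lambda>z. G (of_real (dilation_radius n) * z))" for n
        using continuous_on_sphere_dilate[OF G' dilation_radius(1,2)] by auto
      show "norm (G (of_real (dilation_radius n) * z)) \<le> M" if "z \<in> sphere 0 1" for n z
        using in_disc[of z n] that by (intro M) auto
      fix z :: complex assume z: "z \<in> sphere 0 1"
      have "isCont G z"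
        using z R by (intro continuous_on_interior[OF holomorphic_on_imp_continuous_on[OF BG(3)]]) auto
      then show "(\<lambda>n. G (of_real (dilation_radius n) * z)) \<longlonglongrightarrow> G z"
        by (rule isCont_tendsto_compose) (use dilation_radius(3) in \<open>auto intro!: tendsto_eq_intros\<close>)
    qed (use p in auto)
    moreover have "hardy_mean p G 1 = hardy_mean p f r"
    proof -
      have "hardy_mean p G 1 = hardy_mean p F 1"
        using BG(6) circle_in_sphere[of 1] unfolding hardy_mean_def by simp
      then show ?thesis
        by (simp add: F_def[abs_def] hardy_mean_dilate)
    qed
    ultimately have "(\<lambda>n. hardy_mean p G (dilation_radius n)) \<longlonglongrightarrow> hardy_mean p f r"
      by (simp add: hardy_mean_dilate)
    moreover have "\<forall>\<^sub>F n in sequentially. s < dilation_radius n"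
      using dilation_radius(3) s(2) by (rule order_tendstoD)
    then have "\<forall>\<^sub>F n in sequentially. hardy_mean (2 * p) g s \<le> hardy_mean p G (dilation_radius n)"
    proof eventually_elim
      case (elim n)
      then show ?case
        using hardy_mean_increasing[OF g(1), of "2 * p" s "dilation_radius n"] p s
          dilation_radius(1,2)[of n] mean by auto
    qed
    ultimately have "hardy_mean (2 * p) g s \<le> hardy_mean p f r"
      using tendsto_lowerbound sequentially_bot by blast
    then show ?thesis
      using N by simp
  qed
  then show ?thesis
    using BG(1,2,5) g unfolding F_def by (intro exI[of _ B] exI[of _ g]) auto
qed

text \<open>Letting the dilation tend to the identity, normal families give \<open>f = B g\<^sup>2\<close> on the disc, which
  is written here as the product of \<open>B g\<close> and \<open>g\<close>.\<close>

lemma riesz_factorization: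
  assumes f: "f holomorphic_on unit_disc" and p: "1 \<le> p"
    and N: "\<And>s. 0 < s \<Longrightarrow> s < 1 \<Longrightarrow> hardy_mean p f s \<le> N"
  obtains F1 F2 where "F1 holomorphic_on unit_disc" "F2 holomorphic_on unit_disc"
    "\<And>z. z \<in> unit_disc \<Longrightarrow> f z = F1 z * F2 z"
    "\<And>s. 0 < s \<Longrightarrow> s < 1 \<Longrightarrow> hardy_mean (2 * p) F1 s \<le> N"
    "\<And>s. 0 < s \<Longrightarrow> s < 1 \<Longrightarrow> hardy_mean (2 * p) F2 s \<le> N"
proof (cases "\<forall>z\<in>unit_disc. f z = 0")
  case True
  have "0 \<le> N"
    using N[of "1/2"] hardy_mean_nonneg[of p f "1/2"] by simp
  then show ?thesis
    using that[of "\<lambda>z. 0" "\<lambda>z. 0"] True by simp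
next
  case False
  let ?r = dilation_radius
  have "\<forall>n. \<exists>B g. B holomorphic_on unit_disc \<and> (\<forall>z\<in>unit_disc. norm (B z) \<le> 1) \<and>
    g holomorphic_on unit_disc \<and> (\<forall>s. 0 < s \<and> s < 1 \<longrightarrow> hardy_mean (2 * p) g s \<le> N) \<and>
    (\<forall>z\<in>unit_disc. f (of_real (?r n) * z) = B z * (g z)\<^sup>2)"
    using dilation_factorization[OF f p dilation_radius(1,2) N[OF dilation_radius(1,2)] False] by blast
  then obtain B g where B: "\<And>n. B n holomorphic_on unit_disc" "\<And>n z. z \<in> unit_disc \<Longrightarrow> norm (B n z) \<le> 1"
    and g: "\<And>n. g n holomorphic_on unit_disc"
    and gN: "\<And>n s. 0 < s \<Longrightarrow> s < 1 \<Longrightarrow> hardy_mean (2 * p) (g n) s \<le> N"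
    and fBg: "\<And>n z. z \<in> unit_disc \<Longrightarrow> f (of_real (?r n) * z) = B n z * (g n z)\<^sup>2"
    by metis
  have gbound: "norm (g n z) \<le> (2 * pi + N) / (pi * (1 - \<rho>))" if "norm z \<le> \<rho>" "\<rho> < 1" for n z \<rho>
  proof -
    have "0 \<le> N"
      using N[of "1/2"] hardy_mean_nonneg[of p f "1/2"] by simp
    have "norm (g n z) \<le> (2 * pi + N) / (pi * (1 - norm z))"
      using p that by (intro hardy_growth[OF g _ gN]) auto
    also have "\<dots> \<le> (2 * pi + N) / (pi * (1 - \<rho>))"
      using that \<open>0 \<le> N\<close> by (intro divide_left_mono mult_left_mono mult_pos_pos) auto
    finally show ?thesis .
  qed
  obtain B0 \<sigma> where B0: "B0 holomorphic_on unit_disc" "strict_mono (\<sigma> :: nat \<Rightarrow> nat)"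
      "\<And>z. z \<in> unit_disc \<Longrightarrow> (\<lambda>n. B (\<sigma> n) z) \<longlonglongrightarrow> B0 z"
  proof (rule Montel[of unit_disc "range B" B])
    show "\<exists>C. \<forall>h\<in>range B. \<forall>z\<in>K. norm (h z) \<le> C" if "K \<subseteq> unit_disc" for K
      using B(2) that by (intro exI[of _ 1]) auto
  qed (use B(1) in auto)
  obtain g0 \<tau> where g0: "g0 holomorphic_on unit_disc" "strict_mono (\<tau> :: nat \<Rightarrow> nat)"
      "\<And>z. z \<in> unit_disc \<Longrightarrow> (\<lambda>n. g (\<sigma> (\<tau> n)) z) \<longlonglongrightarrow> g0 z"
  proof (rule Montel[of unit_disc "range (\<lambda>n. g (\<sigma> n))" "\<lambda>n. g (\<sigma> n)"])
    fix K :: "complex set" assume "compact K" "K \<subseteq> unit_disc"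
    then obtain \<rho> where "\<rho> < 1" "K \<subseteq> cball 0 \<rho>"
      using compact_subset_unit_disc by metis
    then show "\<exists>C. \<forall>h\<in>range (\<lambda>n. g (\<sigma> n)). \<forall>z\<in>K. norm (h z) \<le> C"
      using gbound by (intro exI[of _ "(2 * pi + N) / (pi * (1 - \<rho>))"]) auto
  qed (use g in auto)
  have B0': "(\<lambda>n. B (\<sigma> (\<tau> n)) z) \<longlonglongrightarrow> B0 z" if "z \<in> unit_disc" for z
    using LIMSEQ_subseq_LIMSEQ[OF B0(3)[OF that] g0(2)] by (simp add: o_def)
  have B01: "norm (B0 z) \<le> 1" if "z \<in> unit_disc" for z
    using tendsto_norm[OF B0(3)[OF that]] by (rule LIMSEQ_le_const2) (use B(2) that in auto)
  have r: "(\<lambda>n. ?r (\<sigma> (\<tau> n))) \<longlonglongrightarrow> 1"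
    using LIMSEQ_subseq_LIMSEQ[OF dilation_radius(3) strict_mono_o[OF B0(2) g0(2)]] by (simp add: o_def)
  have eq: "f z = B0 z * g0 z * g0 z" if z: "z \<in> unit_disc" for z
  proof (rule LIMSEQ_unique)
    show "(\<lambda>n. f (of_real (?r (\<sigma> (\<tau> n))) * z)) \<longlonglongrightarrow> f z"
      using tendsto_dilation[OF f z r] .
    show "(\<lambda>n. f (of_real (?r (\<sigma> (\<tau> n))) * z)) \<longlonglongrightarrow> B0 z * g0 z * g0 z"
      unfolding fBg[OF z] power2_eq_square mult.assoc
      by (intro tendsto_mult B0' g0 z)
  qed
  have gmean: "hardy_mean (2 * p) g0 s \<le> N" if s: "0 < s" "s < 1" for s
  proof (rule LIMSEQ_le_const2)
    show "(\<lambda>n. hardy_mean (2 * p) (g (\<sigma> (\<tau> n))) s) \<longlonglongrightarrow> hardy_mean (2 * p) g0 s"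
    proof (rule hardy_mean_tendsto)
      show "continuous_on (sphere 0 s) (g (\<sigma> (\<tau> n)))" for n
        using continuous_on_sphere_if_holomorphic[OF g] s by auto
      show "norm (g (\<sigma> (\<tau> n)) z) \<le> (2 * pi + N) / (pi * (1 - s))" if "z \<in> sphere 0 s" for n z
        using gbound that s by auto
    qed (use s p g0(3) in auto)
  qed (use gN s in auto)
  have "hardy_mean (2 * p) (\<lambda>z. B0 z * g0 z) s \<le> N" if s: "0 < s" "s < 1" for s
  proof -
    have "hardy_mean (2 * p) (\<lambda>z. B0 z * g0 z) s \<le> 1 * hardy_mean (2 * p) g0 s + 2 * pi * 0"
    proof (rule hardy_mean_mono)
      show "continuous_on (sphere 0 s) (\<lambda>z. B0 z * g0 z)" "continuous_on (sphere 0 s) g0"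
        using continuous_on_sphere_if_holomorphic B0(1) g0(1) s by (auto intro!: continuous_intros)
      show "norm (B0 z * g0 z) powr (2 * p) \<le> 1 * norm (g0 z) powr (2 * p) + 0" if "z \<in> sphere 0 s" for z
        using B01[of z] that s p by (simp add: norm_mult powr_mono2 mult_left_le_one_le)
    qed (use s p in auto)
    then show ?thesis
      using gmean[OF s] by simp
  qed
  then show ?thesis
    using that[of "\<lambda>z. B0 z * g0 z" g0] B0(1) g0(1) eq gmean by (auto intro!: holomorphic_intros)
qed

text \<open>For \<open>p < 2\<close> the inequality of Clarkson is not available in this form, so convergence of
  dilations is proved for the two factors of exponent \<open>2 p \<ge> 2\<close> instead.\<close>

lemma dilations_converge:
  assumes f: "f holomorphic_on unit_disc" and p: "1 \<le> p"
    and N: "\<And>s. 0 < s \<Longrightarrow> s < 1 \<Longrightarrow> hardy_mean p f s \<le> N" and e: "0 < e"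
  shows "\<exists>r. 0 < r \<and> r < 1 \<and> (\<forall>s. 0 < s \<and> s < 1 \<longrightarrow> hardy_mean p (\<lambda>z. f z - f (of_real r * z)) s \<le> e)"
proof -
  obtain F G where F: "F holomorphic_on unit_disc" and G: "G holomorphic_on unit_disc"
    and eq: "\<And>z. z \<in> unit_disc \<Longrightarrow> f z = F z * G z"
    and FN: "\<And>s. 0 < s \<Longrightarrow> s < 1 \<Longrightarrow> hardy_mean (2 * p) F s \<le> N"
    and GN: "\<And>s. 0 < s \<Longrightarrow> s < 1 \<Longrightarrow> hardy_mean (2 * p) G s \<le> N"
    using riesz_factorization[OF f p N] by metis
  have N0: "0 \<le> N"
    using N[of "1/2"] hardy_mean_nonneg[of p f "1/2"] by simp
  \<comment> \<open>the product \<open>u v\<close> is bounded by \<open>\<delta> u\<^sup>2 + v\<^sup>2 / \<delta>\<close>, with \<open>\<delta>\<close> absorbing the bound on the means\<close>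
  define \<delta> where "\<delta> = e / (4 * 2 powr p * (N + 1))"
  have \<delta>: "0 < \<delta>"
    using e N0 by (simp add: \<delta>_def)
  define e' where "e' = \<delta> * e / (4 * 2 powr p)"
  have e': "0 < e'"
    using \<delta> e by (simp add: e'_def)
  have "\<forall>\<^sub>F n in sequentially.
      (\<forall>s. 0 < s \<and> s < 1 \<longrightarrow> hardy_mean (2 * p) (\<lambda>z. F z - F (of_real (dilation_radius n) * z)) s \<le> e') \<and>
      (\<forall>s. 0 < s \<and> s < 1 \<longrightarrow> hardy_mean (2 * p) (\<lambda>z. G z - G (of_real (dilation_radius n) * z)) s \<le> e')"
    using p by (intro eventually_conj dilations_converge_ge2[OF F _ FN dilation_radius e']
        dilations_converge_ge2[OF G _ GN dilation_radius e']) auto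
  then obtain n where n:
      "\<And>s. 0 < s \<Longrightarrow> s < 1 \<Longrightarrow> hardy_mean (2 * p) (\<lambda>z. F z - F (of_real (dilation_radius n) * z)) s \<le> e'"
      "\<And>s. 0 < s \<Longrightarrow> s < 1 \<Longrightarrow> hardy_mean (2 * p) (\<lambda>z. G z - G (of_real (dilation_radius n) * z)) s \<le> e'"
    unfolding eventually_sequentially by blast
  define r where "r = dilation_radius n"
  have r: "0 < r" "r < 1"
    using dilation_radius by (auto simp: r_def)
  define F' G' where "F' z = F (of_real r * z)" and "G' z = G (of_real r * z)" for z
  have split: "hardy_mean p (\<lambda>z. u z * v z) s \<le> e / (2 * 2 powr p)"
    if c: "continuous_on (sphere 0 s) u" "continuous_on (sphere 0 s) v" and s: "0 < s"
      and u: "hardy_mean (2 * p) u s \<le> N" and v: "hardy_mean (2 * p) v s \<le> e'" for u v s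
  proof -
    have "hardy_mean p (\<lambda>z. u z * v z) s \<le> \<delta> * hardy_mean (2 * p) u s + 1 / \<delta> * hardy_mean (2 * p) v s + 2 * pi * 0"
    proof (rule hardy_mean_le)
      fix z
      define x y where "x = norm (u z) powr p" and "y = norm (v z) powr p"
      have sq: "norm w powr (2 * p) = (norm w powr p)\<^sup>2" for w :: complex
        using powr_powr[of "norm w" p 2] by (simp add: mult.commute)
      have "0 \<le> (\<delta> * x - y)\<^sup>2 + \<delta>\<^sup>2 * x\<^sup>2 + y\<^sup>2"
        by simp
      then have "2 * (\<delta> * (x * y)) \<le> 2 * (\<delta>\<^sup>2 * x\<^sup>2 + y\<^sup>2)"
        by (simp add: power2_eq_square algebra_simps)
      then have "x * y \<le> \<delta> * x\<^sup>2 + 1 / \<delta> * y\<^sup>2"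
        using \<delta> by (simp add: field_simps power2_eq_square)
      then show "norm (u z * v z) powr p \<le> \<delta> * norm (u z) powr (2 * p) + 1 / \<delta> * norm (v z) powr (2 * p) + 0"
        by (simp add: norm_mult powr_mult sq x_def y_def)
    qed (use c s p in \<open>auto intro!: continuous_intros\<close>)
    also have "\<dots> \<le> \<delta> * (N + 1) + 1 / \<delta> * e' + 0"
      using u v \<delta> by (intro add_mono mult_left_mono) auto
    also have "\<dots> = e / (2 * 2 powr p)"
    proof -
      have "\<delta> * (N + 1) = e / (4 * 2 powr p)"
        using N0 by (simp add: \<delta>_def)
      moreover have "1 / \<delta> * e' = e / (4 * 2 powr p)"
        using \<delta> by (simp add: e'_def)
      ultimately show ?thesis
        by simp
    qed
    finally show ?thesis .
  qed
  have "hardy_mean p (\<lambda>z. f z - f (of_real r * z)) s \<le> e" if s: "0 < s" "s < 1" for s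
  proof -
    have c: "continuous_on (sphere 0 s) F" "continuous_on (sphere 0 s) G"
        "continuous_on (sphere 0 s) F'" "continuous_on (sphere 0 s) G'"
      using continuous_on_sphere_if_holomorphic[OF F s(2)] continuous_on_sphere_if_holomorphic[OF G s(2)]
        continuous_on_sphere_dilate[OF F r, of s] continuous_on_sphere_dilate[OF G r, of s] s
      unfolding F'_def G'_def by auto
    have rs: "0 < r * s" "r * s < 1"
      using r s mult_strict_mono[of r 1 s 1] by auto
    have "hardy_mean p (\<lambda>z. f z - f (of_real r * z)) s
        = hardy_mean p (\<lambda>z. F z * (G z - G' z) + G' z * (F z - F' z)) s"
    proof (rule hardy_mean_cong)
      fix z :: complex assume z: "z \<in> sphere 0 s"
      have "of_real r * z \<in> unit_disc" "z \<in> unit_disc"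
        using z r rs s by (auto simp: norm_mult)
      then show "f z - f (of_real r * z) = F z * (G z - G' z) + G' z * (F z - F' z)"
        by (simp add: eq F'_def G'_def algebra_simps)
    qed (use s in auto)
    also have "\<dots> \<le> 2 powr p * hardy_mean p (\<lambda>z. F z * (G z - G' z)) s
        + 2 powr p * hardy_mean p (\<lambda>z. G' z * (F z - F' z)) s + 2 * pi * 0"
    proof (rule hardy_mean_le)
      fix z
      have "norm (F z * (G z - G' z) + G' z * (F z - F' z)) powr p
          \<le> (norm (F z * (G z - G' z)) + norm (G' z * (F z - F' z))) powr p"
        using p by (intro powr_mono2 norm_triangle_ineq) auto
      also have "\<dots> \<le> 2 powr p * (norm (F z * (G z - G' z)) powr p + norm (G' z * (F z - F' z)) powr p)"
        using p by (intro powr_add_le) auto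
      finally show "norm (F z * (G z - G' z) + G' z * (F z - F' z)) powr p
          \<le> 2 powr p * norm (F z * (G z - G' z)) powr p + 2 powr p * norm (G' z * (F z - F' z)) powr p + 0"
        by (simp add: algebra_simps)
    qed (use c s p in \<open>auto intro!: continuous_intros\<close>)
    also have "\<dots> \<le> 2 powr p * (e / (2 * 2 powr p)) + 2 powr p * (e / (2 * 2 powr p)) + 2 * pi * 0"
    proof (intro add_mono mult_left_mono split)
      show "hardy_mean (2 * p) G' s \<le> N"
        unfolding G'_def hardy_mean_dilate using GN rs by simp
    qed (use c s n FN in \<open>auto intro!: continuous_intros simp: F'_def G'_def r_def\<close>)
    also have "\<dots> = e"
      by simp
    finally show ?thesis .
  qed
  then show ?thesis
    using r by blast
qed

section \<open>The Schwarz--Pick inequality and its boundary version\<close>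

lemma norm_sq_one_minus_cnj_mult:
  fixes a z :: complex
  shows "(norm (1 - cnj a * z))\<^sup>2 - (norm (z - a))\<^sup>2 = (1 - (norm z)\<^sup>2) * (1 - (norm a)\<^sup>2)"
  by (simp add: cmod_power2) (simp add: power2_eq_square algebra_simps)

lemma schwarz_pick:
  assumes f: "f holomorphic_on unit_disc" "f ` unit_disc \<subseteq> unit_disc"
    and a: "a \<in> unit_disc" and z: "z \<in> unit_disc"
  shows "norm (f z - f a) * norm (1 - cnj a * z) \<le> norm (z - a) * norm (1 - cnj (f a) * f z)"
proof -
  let ?M = "Moebius_function 0"
  let ?g = "\<lambda>x. ?M (f a) (f (?M (- a) x))"
  have n: "norm a < 1" "norm z < 1" "norm (f a) < 1" "norm (f z) < 1"
    using a z image_subset_iff[THEN iffD1, OF f(2)] by auto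
  have M: "?M (- a) holomorphic_on unit_disc" "?M (- a) ` unit_disc \<subseteq> unit_disc"
    using n by (auto intro!: Moebius_function_holomorphic Moebius_function_norm_lt_1)
  have "?M (f a) \<circ> (f \<circ> ?M (- a)) holomorphic_on unit_disc"
    using M f n by (intro holomorphic_on_compose_gen[of _ unit_disc _ unit_disc] Moebius_function_holomorphic)
      (auto simp: image_comp[symmetric])
  then have hol: "?g holomorphic_on unit_disc"
    by (simp add: o_def)
  have zero: "?g 0 = 0"
    by (simp add: Moebius_function_of_zero Moebius_function_eq_zero)
  have lt: "norm (?g x) < 1" if "norm x < 1" for x
  proof -
    have "?M (- a) x \<in> unit_disc"
      using Moebius_function_norm_lt_1[of "- a" x 0] n(1) that by simp
    then have "norm (f (?M (- a) x)) < 1"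
      using image_subset_iff[THEN iffD1, OF f(2)] by auto
    then show ?thesis
      using Moebius_function_norm_lt_1[OF n(3)] by simp
  qed
  have lt': "norm (?M a z) < 1"
    using Moebius_function_norm_lt_1[OF n(1,2)] .
  have "?g (?M a z) = ?M (f a) (f z)"
    using Moebius_function_compose[of "- a" a z] n by simp
  then have "norm (?M (f a) (f z)) \<le> norm (?M a z)"
    using Schwarz_Lemma(1)[OF hol zero lt lt'] by simp
  then have "norm (f z - f a) / norm (1 - cnj (f a) * f z) \<le> norm (z - a) / norm (1 - cnj a * z)"
    by (simp add: Moebius_function_simple norm_divide)
  then show ?thesis
    using one_minus_cnj_mult_nz[OF n(1) less_imp_le[OF n(2)]] one_minus_cnj_mult_nz[OF n(3) less_imp_le[OF n(4)]] by (simp add: field_simps)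
qed

lemma schwarz_pick_horodisc:
  assumes f: "f holomorphic_on unit_disc" "f ` unit_disc \<subseteq> unit_disc"
    and a: "a \<in> unit_disc" and z: "z \<in> unit_disc"
  shows "(norm (1 - cnj (f a) * f z))\<^sup>2 * ((1 - (norm z)\<^sup>2) * (1 - (norm a)\<^sup>2))
       \<le> (norm (1 - cnj a * z))\<^sup>2 * ((1 - (norm (f z))\<^sup>2) * (1 - (norm (f a))\<^sup>2))"
proof -
  let ?X = "(norm (1 - cnj a * z))\<^sup>2" and ?Y = "(norm (1 - cnj (f a) * f z))\<^sup>2"
  have "(norm (f z - f a) * norm (1 - cnj a * z))\<^sup>2 \<le> (norm (z - a) * norm (1 - cnj (f a) * f z))\<^sup>2"
    using schwarz_pick[OF assms] by (intro power_mono) auto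
  then have "(norm (f z - f a))\<^sup>2 * ?X \<le> (norm (z - a))\<^sup>2 * ?Y"
    by (simp add: power_mult_distrib)
  moreover have "(norm (f z - f a))\<^sup>2 = ?Y - (1 - (norm (f z))\<^sup>2) * (1 - (norm (f a))\<^sup>2)"
    "(norm (z - a))\<^sup>2 = ?X - (1 - (norm z)\<^sup>2) * (1 - (norm a)\<^sup>2)"
    using norm_sq_one_minus_cnj_mult[of "f a" "f z"] norm_sq_one_minus_cnj_mult[of a z] by linarith+
  ultimately show ?thesis
    by (simp add: algebra_simps)
qed

text \<open>Invariance of horodiscs at the limit point of an orbit. Since the orbit tends to the circle, it
  moves outwards infinitely often; along those steps the factor \<open>1 - \<bar>f a\<bar>\<^sup>2\<close> in the Schwarz--Pick
  inequality is at most \<open>1 - \<bar>a\<bar>\<^sup>2\<close>, and both cancel.\<close>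

lemma julia_wolff:
  assumes f: "f holomorphic_on unit_disc" "f ` unit_disc \<subseteq> unit_disc"
    and x: "\<And>n. x n \<in> unit_disc" "\<And>n. x (Suc n) = f (x n)" "x \<longlonglongrightarrow> \<tau>" and \<tau>: "norm \<tau> = 1"
    and z: "z \<in> unit_disc"
  shows "(norm (1 - cnj \<tau> * f z))\<^sup>2 * (1 - (norm z)\<^sup>2) \<le> (norm (1 - cnj \<tau> * z))\<^sup>2 * (1 - (norm (f z))\<^sup>2)"
proof (rule ccontr)
  let ?L = "\<lambda>n. (norm (1 - cnj (x (Suc n)) * f z))\<^sup>2 * (1 - (norm z)\<^sup>2)"
  let ?R = "\<lambda>n. (norm (1 - cnj (x n) * z))\<^sup>2 * (1 - (norm (f z))\<^sup>2)"
  assume "\<not> ?thesis"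
  moreover have "?L \<longlonglongrightarrow> (norm (1 - cnj \<tau> * f z))\<^sup>2 * (1 - (norm z)\<^sup>2)"
    using LIMSEQ_Suc[OF x(3)] by (intro tendsto_intros)
  moreover have "?R \<longlonglongrightarrow> (norm (1 - cnj \<tau> * z))\<^sup>2 * (1 - (norm (f z))\<^sup>2)"
    using x(3) by (intro tendsto_intros)
  ultimately have "\<forall>\<^sub>F n in sequentially. ?R n < ?L n"
    by (intro order_tendstoD(1)[of "\<lambda>n. ?L n - ?R n" _ _ 0, simplified]) (auto intro!: tendsto_diff)
  then obtain N where N: "\<And>n. N \<le> n \<Longrightarrow> ?R n < ?L n"
    by (auto simp: eventually_sequentially)
  have dec: "norm (x (Suc n)) < norm (x n)" if "N \<le> n" for n
  proof (rule ccontr)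
    assume out: "\<not> norm (x (Suc n)) < norm (x n)"
    have fz: "norm (f z) < 1" "norm (x n) < 1"
      using z x(1)[of n] image_subset_iff[THEN iffD1, OF f(2)] by auto
    have pos: "0 < 1 - (norm (x n))\<^sup>2" "0 < 1 - (norm (f z))\<^sup>2"
      using fz by (simp_all add: power_less_one_iff)
    have "?L n * (1 - (norm (x n))\<^sup>2) \<le> ?R n * (1 - (norm (x (Suc n)))\<^sup>2)"
      using schwarz_pick_horodisc[OF f x(1)[of n] z] by (simp add: x(2) mult.assoc)
    also have "\<dots> \<le> ?R n * (1 - (norm (x n))\<^sup>2)"
      using out pos by (intro mult_left_mono) (auto intro!: power_mono)
    finally have "?L n \<le> ?R n"
      using pos(1) mult_le_cancel_right_pos by blast
    then show False
      using N[OF that] by simp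
  qed
  have "norm (x n) \<le> norm (x N)" if "N \<le> n" for n
    using that by (induction n rule: dec_induct) (use dec in force)+
  then have "norm \<tau> \<le> norm (x N)"
    by (intro LIMSEQ_le_const2[OF tendsto_norm[OF x(3)]]) auto
  then show False
    using x(1)[of N] \<tau> by simp
qed

text \<open>On the radius the horodisc inequality bounds \<open>\<bar>\<tau> - f (r \<tau>)\<bar>\<^sup>2\<close> by \<open>1 - r\<close>.\<close>

lemma radial_limit_at_wolff_point:
  assumes f: "f holomorphic_on unit_disc" "f ` unit_disc \<subseteq> unit_disc"
    and x: "\<And>n. x n \<in> unit_disc" "\<And>n. x (Suc n) = f (x n)" "x \<longlonglongrightarrow> \<tau>" and \<tau>: "norm \<tau> = 1"
  shows "((\<lambda>r. f (of_real r * \<tau>)) \<longlongrightarrow> \<tau>) (at_left 1)"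
proof -
  have \<tau>1: "cnj \<tau> * \<tau> = 1"
    using complex_norm_square[of \<tau>] \<tau> by (simp add: mult.commute)
  have bound: "(norm (\<tau> - f (of_real r * \<tau>)))\<^sup>2 \<le> 1 - r" if r: "0 < r" "r < 1" for r
  proof -
    let ?z = "of_real r * \<tau>"
    have z: "?z \<in> unit_disc" "norm ?z = r"
      using r \<tau> by (auto simp: norm_mult)
    have "norm (\<tau> - f ?z) = norm (cnj \<tau> * (\<tau> - f ?z))"
      using \<tau> by (simp add: norm_mult)
    also have "\<dots> = norm (1 - cnj \<tau> * f ?z)"
      by (simp add: right_diff_distrib \<tau>1)
    finally have n: "norm (\<tau> - f ?z) = norm (1 - cnj \<tau> * f ?z)" .
    have "1 - cnj \<tau> * ?z = of_real (1 - r)"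
      using \<tau>1 by (simp add: mult.left_commute)
    then have "norm (1 - cnj \<tau> * ?z) = 1 - r"
      using r by (metis norm_of_real abs_of_pos diff_gt_0_iff_gt)
    then have "(norm (\<tau> - f ?z))\<^sup>2 * (1 - r\<^sup>2) \<le> (1 - r)\<^sup>2 * (1 - (norm (f ?z))\<^sup>2)"
      using julia_wolff[OF f x \<tau> z(1)] n z(2) by simp
    also have "\<dots> \<le> (1 - r)\<^sup>2 * 1"
      by (intro mult_left_mono) auto
    finally have "((norm (\<tau> - f ?z))\<^sup>2 * (1 + r)) * (1 - r) \<le> (1 - r) * (1 - r)"
      by (simp add: power2_eq_square algebra_simps)
    then have "(norm (\<tau> - f ?z))\<^sup>2 * (1 + r) \<le> 1 - r"
      using r by (simp add: mult_le_cancel_right_pos)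
    moreover have "(norm (\<tau> - f ?z))\<^sup>2 * 1 \<le> (norm (\<tau> - f ?z))\<^sup>2 * (1 + r)"
      using r by (intro mult_left_mono) auto
    ultimately show ?thesis by simp
  qed
  have "((\<lambda>r. (norm (\<tau> - f (of_real r * \<tau>)))\<^sup>2) \<longlongrightarrow> 0) (at_left 1)"
  proof (rule tendsto_sandwich)
    show "((\<lambda>r::real. 0) \<longlongrightarrow> (0::real)) (at_left 1)" by simp
    show "((\<lambda>r::real. 1 - r) \<longlongrightarrow> 0) (at_left 1)"
      by (auto intro!: tendsto_eq_intros)
    show "\<forall>\<^sub>F r in at_left 1. (norm (\<tau> - f (of_real r * \<tau>)))\<^sup>2 \<le> 1 - r"
      by (rule eventually_mono[OF eventually_at_left_real[of 0 1]]) (use bound in auto)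
  qed auto
  then have "((\<lambda>r. norm (\<tau> - f (of_real r * \<tau>))) \<longlongrightarrow> 0) (at_left 1)"
    using tendsto_real_sqrt[of "\<lambda>r. (norm (\<tau> - f (of_real r * \<tau>)))\<^sup>2" 0 "at_left 1"] by simp
  then have "((\<lambda>r. \<tau> - f (of_real r * \<tau>)) \<longlongrightarrow> 0) (at_left 1)"
    by (rule tendsto_norm_zero_cancel)
  from tendsto_diff[OF tendsto_const[of \<tau>] this] show ?thesis
    by simp
qed

text \<open>The mean value estimate for \<open>f z - z\<close> on the radius between \<open>r\<close> and the boundary point \<open>\<tau>\<close>, where
  the displacement vanishes.\<close>

lemma radial_displacement:
  assumes f: "f holomorphic_on unit_disc" and \<tau>: "norm \<tau> = 1"
    and lim: "((\<lambda>r. f (of_real r * \<tau>)) \<longlongrightarrow> \<tau>) (at_left 1)"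
    and der: "((\<lambda>r. deriv f (of_real r * \<tau>)) \<longlongrightarrow> 1) (at_left 1)" and e: "0 < e"
  obtains r where "0 < r" "r < 1" "norm (f (of_real r * \<tau>) - of_real r * \<tau>) \<le> e * (1 - r)"
proof -
  have "\<forall>\<^sub>F r in at_left 1. norm (deriv f (of_real r * \<tau>) - 1) < e"
    using tendstoD[OF der e] by (simp add: dist_norm)
  then obtain b where b: "b < 1" "\<And>r. b < r \<Longrightarrow> r < 1 \<Longrightarrow> norm (deriv f (of_real r * \<tau>) - 1) < e"
    by (auto simp: eventually_at_left_field)
  define r where "r = (1 + max b 0) / 2"
  have r: "b < r" "0 < r" "r < 1"
    using b(1) by (auto simp: r_def max_def field_simps)
  let ?g = "\<lambda>z. f z - z"
  have in_disc: "of_real t * \<tau> \<in> unit_disc" if "r \<le> t" "t < 1" for t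
    using that r \<tau> by (simp add: norm_mult)
  have le: "norm (?g (of_real s * \<tau>) - ?g (of_real r * \<tau>)) \<le> e * (s - r)" if s: "r \<le> s" "s < 1" for s
  proof -
    let ?S = "closed_segment (of_real r * \<tau>) (of_real s * \<tau>)"
    have seg: "\<exists>t. r \<le> t \<and> t \<le> s \<and> z = of_real t * \<tau>" if z: "z \<in> ?S" for z
    proof -
      obtain u where u: "0 \<le> u" "u \<le> 1" "z = (1 - u) *\<^sub>R (of_real r * \<tau>) + u *\<^sub>R (of_real s * \<tau>)"
        using z by (auto simp: closed_segment_def)
      have "z = of_real (r + u * (s - r)) * \<tau>"
        unfolding u(3) by (simp add: scaleR_conv_of_real algebra_simps)
      moreover have "u * (s - r) \<le> 1 * (s - r)"
        using u s by (intro mult_right_mono) auto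
      ultimately show ?thesis
        using u s by (intro exI[of _ "r + u * (s - r)"]) auto
    qed
    have "norm (?g (of_real s * \<tau>) - ?g (of_real r * \<tau>)) \<le> e * norm (of_real s * \<tau> - of_real r * \<tau>)"
    proof (rule field_differentiable_bound[of ?S ?g "\<lambda>z. deriv f z - 1"])
      fix z assume "z \<in> ?S"
      then obtain t where t': "r \<le> t" "t \<le> s" "z = of_real t * \<tau>"
        using seg by blast
      then have t: "r \<le> t" "t < 1" "z = of_real t * \<tau>"
        using s by auto
      have "(f has_field_derivative deriv f z) (at z)"
        using holomorphic_derivI[OF f open_ball] in_disc[OF t(1,2)] unfolding t(3) by blast
      from has_field_derivative_at_within[OF DERIV_diff[OF this DERIV_ident]]
      show "(?g has_field_derivative deriv f z - 1) (at z within ?S)" .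
      show "norm (deriv f z - 1) \<le> e"
        using b(2)[of t] r t(1,2) unfolding t(3) by simp
    qed auto
    also have "norm (of_real s * \<tau> - of_real r * \<tau>) = s - r"
      using s \<tau> by (simp add: norm_mult flip: left_diff_distrib of_real_diff)
    finally show ?thesis .
  qed
  have "norm (0 - ?g (of_real r * \<tau>)) \<le> e * (1 - r)"
  proof (rule tendsto_le)
    show "((\<lambda>s. norm (?g (of_real s * \<tau>) - ?g (of_real r * \<tau>))) \<longlongrightarrow> norm (0 - ?g (of_real r * \<tau>))) (at_left 1)"
      by (intro tendsto_norm tendsto_diff tendsto_const) (auto intro!: tendsto_eq_intros lim)
    show "((\<lambda>s. e * (s - r)) \<longlongrightarrow> e * (1 - r)) (at_left 1)"
      by (intro tendsto_intros)
    show "\<forall>\<^sub>F s in at_left 1. norm (?g (of_real s * \<tau>) - ?g (of_real r * \<tau>)) \<le> e * (s - r)"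
      by (rule eventually_mono[OF eventually_at_left_real[OF r(3)]]) (use le in auto)
  qed auto
  then show ?thesis
    unfolding diff_0 norm_minus_cancel by (rule that[OF r(2,3)])
qed

lemma cayley_in_disc:
  assumes "0 < Im w"
  shows "w + \<i> \<noteq> 0" "norm ((w - \<i>) / (w + \<i>)) < 1"
proof -
  show nz: "w + \<i> \<noteq> 0"
    using assms by (auto simp: complex_eq_iff)
  have "(norm (w - \<i>))\<^sup>2 < (norm (w + \<i>))\<^sup>2"
    using assms unfolding cmod_power2 by (simp add: power2_eq_square algebra_simps)
  then have "norm (w - \<i>) < norm (w + \<i>)"
    by (rule power_less_imp_less_base) simp
  then show "norm ((w - \<i>) / (w + \<i>)) < 1"
    using nz by (simp add: norm_divide)
qed

lemma schwarz_pick_half_plane: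
  assumes E: "E holomorphic_on unit_disc" "\<And>z. z \<in> unit_disc \<Longrightarrow> 0 < Im (E z)"
    and z: "z \<in> unit_disc" and w: "w \<in> unit_disc"
  shows "norm (E w - E z) * norm (1 - cnj z * w) \<le> norm (w - z) * norm (E w - cnj (E z))"
proof -
  define C where "C z = (E z - \<i>) / (E z + \<i>)" for z
  have nz: "E z + \<i> \<noteq> 0" if "z \<in> unit_disc" for z
    using cayley_in_disc(1)[OF E(2)[OF that]] .
  have C: "C holomorphic_on unit_disc" "C ` unit_disc \<subseteq> unit_disc"
    unfolding C_def using E nz cayley_in_disc(2) by (auto intro!: holomorphic_intros)
  have nz': "cnj (E z) - \<i> \<noteq> 0"
    using nz[OF z] by (metis complex_cnj_add complex_cnj_cancel_iff complex_cnj_i complex_cnj_zero diff_conv_add_uminus)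
  have "C w - C z = 2 * \<i> * (E w - E z) / ((E w + \<i>) * (E z + \<i>))"
    using nz[OF w] nz[OF z] by (simp add: C_def field_simps)
  then have 1: "norm (C w - C z) = 2 * norm (E w - E z) / (norm (E w + \<i>) * norm (E z + \<i>))"
    by (simp add: norm_mult norm_divide)
  have "1 - cnj (C z) * C w = 2 * \<i> * (cnj (E z) - E w) / ((E w + \<i>) * (cnj (E z) - \<i>))"
  proof -
    let ?u = "cnj (E z)"
    have "1 - cnj (C z) * C w = 1 - (?u + \<i>) * (E w - \<i>) / ((E w + \<i>) * (?u - \<i>))"
      by (simp add: C_def mult.commute)
    also have "\<dots> = ((E w + \<i>) * (?u - \<i>) - (?u + \<i>) * (E w - \<i>)) / ((E w + \<i>) * (?u - \<i>))"
      using nz[OF w] nz' by (simp add: diff_divide_distrib)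
    also have "(E w + \<i>) * (?u - \<i>) - (?u + \<i>) * (E w - \<i>) = 2 * \<i> * (?u - E w)"
      by (simp add: algebra_simps)
    finally show ?thesis .
  qed
  moreover have "norm (cnj (E z) - \<i>) = norm (E z + \<i>)"
    by (metis complex_cnj_add complex_cnj_i complex_mod_cnj diff_conv_add_uminus)
  ultimately have 2: "norm (1 - cnj (C z) * C w) = 2 * norm (E w - cnj (E z)) / (norm (E w + \<i>) * norm (E z + \<i>))"
    by (simp add: norm_mult norm_divide norm_minus_commute)
  have "norm (E w + \<i>) * norm (E z + \<i>) > 0"
    using nz[OF w] nz[OF z] by simp
  then have "0 < 2 / (norm (E w + \<i>) * norm (E z + \<i>))"
    by simp
  moreover have "(norm (E w - E z) * norm (1 - cnj z * w)) * (2 / (norm (E w + \<i>) * norm (E z + \<i>)))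
      \<le> (norm (w - z) * norm (E w - cnj (E z))) * (2 / (norm (E w + \<i>) * norm (E z + \<i>)))"
    using schwarz_pick[OF C z w] unfolding 1 2 by (simp add: mult_ac)
  ultimately show ?thesis
    using mult_le_cancel_right_pos by blast
qed

section \<open>Koenigs domains of parabolic semiflows\<close>

lemma koenigs_translate:
  assumes "koenigs_function \<Phi> h" "0 \<le> t" "z \<in> unit_disc"
  shows "h (\<Phi> t z) = h z + of_real t"
proof -
  have "h z + of_real t \<in> h ` unit_disc" "\<Phi> t z = inv_into unit_disc h (h z + of_real t)"
    using assms by (auto simp: koenigs_function_def)
  then show ?thesis
    by (metis f_inv_into_f)
qed

text \<open>In a strip the translation by \<open>1\<close> moves every point by a fixed positive hyperbolic distance,
  because it becomes the multiplication by \<open>\<kappa> > 1\<close> in the half-plane model. For a parabolic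
  semiflow the displacement of \<open>\<Phi> 1\<close> along the radius to the Denjoy--Wolff point tends to zero.\<close>

lemma parabolic_koenigs_domain_not_in_strip:
  assumes par: "parabolic_semiflow \<Phi>" and h: "koenigs_function \<Phi> h" and ab: "a < b"
  shows "\<not> h ` unit_disc \<subseteq> horizontal_strip a b"
proof
  assume strip: "h ` unit_disc \<subseteq> horizontal_strip a b"
  have semiflow: "semiflow \<Phi>" and "spectral_value \<Phi> 0"
    using par by (auto simp: parabolic_semiflow_def)
  then obtain \<tau> where \<tau>: "denjoy_wolff_point \<Phi> \<tau>"
    and ang: "nontangential_limit (deriv (\<Phi> 1)) \<tau> 1"
    by (auto simp: spectral_value_def)
  have \<tau>1: "norm \<tau> = 1"
    using \<tau> by (simp add: denjoy_wolff_point_def)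
  let ?f = "\<Phi> 1"
  have f: "?f holomorphic_on unit_disc" "?f ` unit_disc \<subseteq> unit_disc"
    using semiflow by (auto simp: semiflow_def holomorphic_self_map_def)
  define x where "x n = \<Phi> (real n) 0" for n
  have xD: "x n \<in> unit_disc" for n
  proof -
    have "\<Phi> (real n) ` unit_disc \<subseteq> unit_disc"
      using semiflow by (auto simp: semiflow_def holomorphic_self_map_def)
    then show ?thesis
      unfolding x_def image_subset_iff by simp
  qed
  have xS: "x (Suc n) = ?f (x n)" for n
  proof -
    have "\<Phi> (1 + real n) 0 = \<Phi> 1 (\<Phi> (real n) 0)"
      using semiflow unfolding semiflow_def by (simp del: of_nat_Suc)
    then show ?thesis
      by (simp add: x_def)
  qed
  have "\<forall>K. compact K \<and> K \<subseteq> unit_disc \<longrightarrow> uniform_limit K \<Phi> (\<lambda>z. \<tau>) at_top"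
    using \<tau> unfolding denjoy_wolff_point_def by (rule conjunct2)
  from spec[OF this, of "{0}"] have "uniform_limit {0} \<Phi> (\<lambda>z. \<tau>) at_top"
    by simp
  then have "((\<lambda>t. \<Phi> t 0) \<longlongrightarrow> \<tau>) at_top"
    by (rule tendsto_uniform_limitI) simp
  then have xlim: "x \<longlonglongrightarrow> \<tau>"
    unfolding x_def by (rule filterlim_compose[OF _ filterlim_real_sequentially])
  have der: "((\<lambda>r. deriv ?f (of_real r * \<tau>)) \<longlongrightarrow> 1) (at_left 1)"
  proof -
    have "(deriv ?f \<longlongrightarrow> 1) (at \<tau> within stolz_region \<tau> 2)"
      using ang by (simp add: nontangential_limit_def)
    moreover have "filterlim (\<lambda>r. of_real r * \<tau>) (at \<tau> within stolz_region \<tau> 2) (at_left 1)"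
      unfolding filterlim_at
    proof
      have "of_real r * \<tau> \<in> stolz_region \<tau> 2 \<and> of_real r * \<tau> \<noteq> \<tau>" if "r \<in> {0<..<1}" for r
      proof -
        have "\<tau> - of_real r * \<tau> = of_real (1 - r) * \<tau>"
          by (simp add: algebra_simps)
        then have "norm (\<tau> - of_real r * \<tau>) = 1 - r"
          using that \<tau>1 by (simp only: norm_mult norm_of_real) simp
        then show ?thesis
          using that \<tau>1 by (auto simp: stolz_region_def norm_mult)
      qed
      then show "\<forall>\<^sub>F r in at_left 1. of_real r * \<tau> \<in> stolz_region \<tau> 2 \<and> of_real r * \<tau> \<noteq> \<tau>"
        by (rule eventually_mono[OF eventually_at_left_real[OF zero_less_one]])
      show "((\<lambda>r. of_real r * \<tau>) \<longlongrightarrow> \<tau>) (at_left 1)"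
        by (auto intro!: tendsto_eq_intros)
    qed
    ultimately show ?thesis
      by (rule filterlim_compose)
  qed
  define \<kappa> where "\<kappa> = exp (pi / (b - a))"
  have \<kappa>: "1 < \<kappa>"
    using ab by (simp add: \<kappa>_def)
  define E where "E z = exp (of_real (pi / (b - a)) * (h z - \<i> * of_real a))" for z
  have "h holomorphic_on unit_disc"
    using h by (simp add: koenigs_function_def)
  then have hol: "E holomorphic_on unit_disc"
    unfolding E_def by (intro holomorphic_intros)
  have ImE: "0 < Im (E z)" if "z \<in> unit_disc" for z
  proof -
    have "h z \<in> horizontal_strip a b"
      using strip that by blast
    then have "0 < pi / (b - a) * (Im (h z) - a)" "pi / (b - a) * (Im (h z) - a) < pi"
      using ab by (auto simp: horizontal_strip_def field_simps)
    then have "0 < sin (pi / (b - a) * (Im (h z) - a))"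
      by (rule sin_gt_zero)
    then show ?thesis
      by (simp add: E_def Im_exp)
  qed
  have Ef: "E (?f z) = of_real \<kappa> * E z" if "z \<in> unit_disc" for z
  proof -
    have "h (?f z) = h z + 1"
      using koenigs_translate[OF h _ that, of 1] by simp
    then have "E (?f z) = exp (of_real (pi / (b - a)) + of_real (pi / (b - a)) * (h z - \<i> * of_real a))"
      unfolding E_def by (simp only: algebra_simps mult_1_left mult_1_right)
    then show ?thesis
      unfolding E_def \<kappa>_def exp_of_real[symmetric] exp_add .
  qed
  \<comment> \<open>any \<open>\<epsilon> < (\<kappa> - 1) / (2 \<kappa>)\<close> contradicts the lower bound on the displacement\<close>
  define \<epsilon> where "\<epsilon> = (\<kappa> - 1) / (4 * \<kappa>)"
  have \<epsilon>: "0 < \<epsilon>"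
    using \<kappa> by (simp add: \<epsilon>_def)
  obtain r where r: "0 < r" "r < 1" "norm (?f (of_real r * \<tau>) - of_real r * \<tau>) \<le> \<epsilon> * (1 - r)"
    using radial_displacement[OF f(1) \<tau>1 radial_limit_at_wolff_point[OF f xD xS xlim \<tau>1] der \<epsilon>] .
  define z where "z = of_real r * \<tau>"
  define g where "g = ?f z - z"
  have z: "z \<in> unit_disc" "norm z = r"
    using r \<tau>1 by (auto simp: z_def norm_mult)
  have fz: "?f z \<in> unit_disc"
    using f(2) z(1) by blast
  have g: "norm g \<le> \<epsilon> * (1 - r)"
    using r(3) by (simp add: g_def z_def)
  have "cnj z * z = of_real (r\<^sup>2)"
    using complex_norm_square[of z] z(2) by (simp add: mult.commute)
  then have "1 - cnj z * ?f z = of_real (1 - r\<^sup>2) - cnj z * g"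
    by (simp add: g_def algebra_simps)
  then have "norm (of_real (1 - r\<^sup>2) :: complex) - norm (cnj z * g) \<le> norm (1 - cnj z * ?f z)"
    by (metis norm_triangle_ineq2)
  moreover have "norm (of_real (1 - r\<^sup>2) :: complex) = 1 - r\<^sup>2"
    using r(1,2) by (simp add: power_le_one del: of_real_diff of_real_power)
  moreover have "norm (cnj z * g) \<le> 1 * norm g"
    unfolding norm_mult using z r by (intro mult_right_mono) auto
  moreover have "r\<^sup>2 \<le> r"
    using r by (simp add: power2_eq_square)
  ultimately have "(1 - r) - \<epsilon> * (1 - r) \<le> norm (1 - cnj z * ?f z)"
    using g by linarith
  then have low: "(1 - \<epsilon>) * (1 - r) \<le> norm (1 - cnj z * ?f z)"
    by (simp add: algebra_simps)
  have "E z \<noteq> 0"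
    by (simp add: E_def)
  have n1: "norm (E (?f z) - E z) = (\<kappa> - 1) * norm (E z)"
  proof -
    have "E (?f z) - E z = of_real (\<kappa> - 1) * E z"
      using Ef[OF z(1)] by (simp add: algebra_simps)
    then show ?thesis
      using \<kappa> by (simp only: norm_mult norm_of_real)
  qed
  have n2: "norm (E (?f z) - cnj (E z)) \<le> (\<kappa> + 1) * norm (E z)"
  proof -
    have "norm (E (?f z) - cnj (E z)) \<le> norm (E (?f z)) + norm (cnj (E z))"
      by (rule norm_triangle_ineq4)
    also have "\<dots> = (\<kappa> + 1) * norm (E z)"
      using Ef[OF z(1)] \<kappa> by (simp add: norm_mult algebra_simps)
    finally show ?thesis .
  qed
  have "(\<kappa> - 1) * norm (E z) * ((1 - \<epsilon>) * (1 - r)) \<le> norm (E (?f z) - E z) * norm (1 - cnj z * ?f z)"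
    unfolding n1 using low \<kappa> by (intro mult_left_mono) auto
  also have "\<dots> \<le> norm g * norm (E (?f z) - cnj (E z))"
    unfolding g_def by (rule schwarz_pick_half_plane[OF hol ImE z(1) fz])
  also have "\<dots> \<le> (\<epsilon> * (1 - r)) * ((\<kappa> + 1) * norm (E z))"
    using g n2 \<epsilon> r by (intro mult_mono) auto
  finally have "((\<kappa> - 1) * (1 - \<epsilon>)) * ((1 - r) * norm (E z)) \<le> (\<epsilon> * (\<kappa> + 1)) * ((1 - r) * norm (E z))"
    by (simp add: mult_ac)
  then have "(\<kappa> - 1) * (1 - \<epsilon>) \<le> \<epsilon> * (\<kappa> + 1)"
    using r(2) \<open>E z \<noteq> 0\<close> by (subst (asm) mult_le_cancel_right_pos) auto
  then have "\<kappa> - 1 \<le> 2 * (\<kappa> * \<epsilon>)"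
    by (simp add: algebra_simps)
  also have "\<dots> = (\<kappa> - 1) / 2"
    using \<kappa> by (simp add: \<epsilon>_def)
  finally show False
    using \<kappa> by simp
qed

text \<open>The half-plane above the boundary strip is connected and misses the boundary. If it missed the domain
  as well, then the domain would lie in a strip.\<close>

lemma koenigs_domain_contains_half_plane:
  assumes par: "parabolic_semiflow \<Phi>" and h: "koenigs_function \<Phi> h"
    and lower: "h ` unit_disc \<subseteq> {w. c < Im w}"
    and front: "frontier (h ` unit_disc) \<subseteq> horizontal_strip a b"
  shows "{w. b \<le> Im w} \<subseteq> h ` unit_disc"
proof (rule ccontr)
  let ?S = "{w. b \<le> Im w}" and ?\<Omega> = "h ` unit_disc"
  assume "\<not> ?S \<subseteq> ?\<Omega>"
  moreover have "connected ?S"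
    using convex_halfspace_Im_ge by (rule convex_connected)
  moreover have "?S \<inter> frontier ?\<Omega> = {}"
    using front by (auto simp: horizontal_strip_def)
  ultimately have "?S \<inter> ?\<Omega> = {}"
    using connected_Int_frontier[of ?S ?\<Omega>] by blast
  then have "?\<Omega> \<subseteq> horizontal_strip c (max b (c + 1))"
    using lower by (force simp: horizontal_strip_def)
  moreover have "c < max b (c + 1)"
    by simp
  ultimately show False
    using parabolic_koenigs_domain_not_in_strip[OF par h] by blast
qed

text \<open>Along a horizontal line a holomorphic map from a half-plane to the disc cannot approach the circle
  faster than quadratically; this is the Schwarz--Pick inequality after a Cayley transformation.\<close>

lemma half_plane_to_disc_decay:
  assumes k: "k holomorphic_on {w. b < Im w}" "k ` {w. b < Im w} \<subseteq> unit_disc"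
  obtains c where "0 < c"
    "\<And>w. b < Im w \<Longrightarrow> c * (Im w - b) \<le> (1 - norm (k w)) * (norm (w - \<i> * of_real b + \<i>))\<^sup>2"
proof -
  define \<sigma> where "\<sigma> z = \<i> * (1 + z) / (1 - z) + \<i> * of_real b" for z :: complex
  have Im\<sigma>: "b < Im (\<sigma> z)" if "norm z < 1" for z
  proof -
    have "(1 + z) * cnj (1 - z) = of_real (1 - (norm z)\<^sup>2) + (z - cnj z)"
      using complex_norm_square[of z] by (simp add: algebra_simps)
    then have "Re ((1 + z) * cnj (1 - z)) = 1 - (norm z)\<^sup>2"
      by simp
    moreover have "0 < 1 - (norm z)\<^sup>2" "1 - z \<noteq> 0"
      using that by (auto simp: power_less_one_iff)
    ultimately have "0 < Re ((1 + z) / (1 - z))"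
      by (subst complex_div_cnj) (simp del: complex_cnj_diff)
    moreover have eq: "\<sigma> z = \<i> * ((1 + z) / (1 - z)) + \<i> * of_real b"
      by (simp add: \<sigma>_def)
    have "Im (\<sigma> z) = Re ((1 + z) / (1 - z)) + b"
      unfolding eq by (simp only: plus_complex.sel Im_i_times Re_complex_of_real)
    ultimately show ?thesis
      by linarith
  qed
  define f where "f z = k (\<sigma> z)" for z
  have "\<sigma> holomorphic_on unit_disc"
    unfolding \<sigma>_def by (intro holomorphic_intros) auto
  then have "k \<circ> \<sigma> holomorphic_on unit_disc"
    using Im\<sigma> by (intro holomorphic_on_compose_gen[OF _ k(1)]) auto
  then have f: "f holomorphic_on unit_disc"
    by (simp add: f_def[abs_def] o_def)
  have fD: "f ` unit_disc \<subseteq> unit_disc"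
    using k(2) Im\<sigma> unfolding f_def image_subset_iff by simp
  have f0: "norm (f 0) < 1"
    using image_subset_iff[THEN iffD1, OF fD] by simp
  define c where "c = 2 * (1 - norm (f 0))\<^sup>2"
  show ?thesis
  proof (rule that[of c])
    show "0 < c"
      using f0 by (simp add: c_def)
    fix w assume w: "b < Im w"
    define v where "v = w - \<i> * of_real b"
    define z where "z = (v - \<i>) / (v + \<i>)"
    have v: "0 < Im v"
      using w by (simp add: v_def)
    have nz: "v + \<i> \<noteq> 0" and z: "norm z < 1"
      using cayley_in_disc[OF v] by (auto simp: z_def)
    have "1 + z = 2 * v / (v + \<i>)" "1 - z = 2 * \<i> / (v + \<i>)"
      using nz by (simp_all add: z_def field_simps)
    then have "\<sigma> z = v + \<i> * of_real b"
      using nz by (simp add: \<sigma>_def)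
    then have "\<sigma> z = w"
      by (simp add: v_def)
    then have fz: "f z = k w"
      by (simp add: f_def)
    have nfz: "norm (f z) < 1"
      using image_subset_iff[THEN iffD1, OF fD] z by simp
    have "(norm z)\<^sup>2 = (norm (v - \<i>))\<^sup>2 / (norm (v + \<i>))\<^sup>2"
      by (simp only: z_def norm_divide power_divide)
    then have "1 - (norm z)\<^sup>2 = ((norm (v + \<i>))\<^sup>2 - (norm (v - \<i>))\<^sup>2) / (norm (v + \<i>))\<^sup>2"
      using nz by (simp add: diff_divide_distrib)
    also have "(norm (v + \<i>))\<^sup>2 - (norm (v - \<i>))\<^sup>2 = 4 * Im v"
      unfolding cmod_power2 by (simp add: power2_eq_square algebra_simps)
    finally have nz2: "1 - (norm z)\<^sup>2 = 4 * Im v / (norm (v + \<i>))\<^sup>2" .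
    have "1 - norm (f 0) \<le> norm (1 - cnj (f 0) * f z)"
    proof -
      have "norm (cnj (f 0) * f z) \<le> norm (f 0) * 1"
        unfolding norm_mult complex_mod_cnj using nfz by (intro mult_left_mono) auto
      then show ?thesis
        using norm_triangle_ineq2[of 1 "cnj (f 0) * f z"] by simp
    qed
    then have "(1 - norm (f 0))\<^sup>2 * (1 - (norm z)\<^sup>2) \<le> (norm (1 - cnj (f 0) * f z))\<^sup>2 * (1 - (norm z)\<^sup>2)"
      using f0 z by (intro mult_right_mono power_mono) (auto simp: power_le_one)
    also have "\<dots> \<le> (1 - (norm (f z))\<^sup>2) * (1 - (norm (f 0))\<^sup>2)"
      using schwarz_pick_horodisc[OF f fD, of 0 z] z by simp
    also have "\<dots> \<le> (1 - (norm (f z))\<^sup>2) * 1"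
      using nfz by (intro mult_left_mono) (auto simp: power_le_one)
    also have "\<dots> = (1 - norm (f z)) * (1 + norm (f z))"
      by (simp add: power2_eq_square algebra_simps)
    also have "\<dots> \<le> (1 - norm (f z)) * 2"
      using nfz by (intro mult_left_mono) auto
    finally have "(1 - norm (f 0))\<^sup>2 * (4 * Im v / (norm (v + \<i>))\<^sup>2) \<le> (1 - norm (k w)) * 2"
      unfolding nz2 fz .
    moreover have "(1 - norm (f 0))\<^sup>2 * (4 * Im v / (norm (v + \<i>))\<^sup>2) = (c * Im v / (norm (v + \<i>))\<^sup>2) * 2"
      by (simp add: c_def)
    ultimately have "(c * Im v / (norm (v + \<i>))\<^sup>2) * 2 \<le> (1 - norm (k w)) * 2"
      by (simp only:)
    then have "c * Im v / (norm (v + \<i>))\<^sup>2 \<le> 1 - norm (k w)"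
      by (rule mult_right_le_imp_le) simp
    then show "c * (Im w - b) \<le> (1 - norm (k w)) * (norm (w - \<i> * of_real b + \<i>))\<^sup>2"
      using nz by (simp add: pos_divide_le_eq v_def)
  qed
qed

lemma quadratic_times_power_tendsto_0:
  fixes q A :: real
  assumes "0 \<le> q" "q < 1"
  shows "(\<lambda>n. q ^ n * (A + real n)\<^sup>2) \<longlonglongrightarrow> 0"
proof -
  define s where "s = sqrt q"
  have s: "0 \<le> s" "s < 1" "s\<^sup>2 = q"
    using assms by (auto simp: s_def)
  have "(\<lambda>n. (A * s ^ n + real n * s ^ n)\<^sup>2) \<longlonglongrightarrow> (A * 0 + 0)\<^sup>2"
    using s powser_times_n_limit_0[of s] by (intro tendsto_intros LIMSEQ_realpow_zero) auto
  moreover have "(A * s ^ n + real n * s ^ n)\<^sup>2 = q ^ n * (A + real n)\<^sup>2" for n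
  proof -
    have "(A * s ^ n + real n * s ^ n)\<^sup>2 = (s ^ n)\<^sup>2 * (A + real n)\<^sup>2"
      by (simp add: algebra_simps flip: power_mult_distrib)
    also have "(s ^ n)\<^sup>2 = q ^ n"
      by (metis s(3) power_mult mult.commute)
    finally show ?thesis .
  qed
  ultimately show ?thesis
    by simp
qed

text \<open>An eigenfunction for an eigenvalue \<open>\<nu>\<close> off the circle grows geometrically along one of the two
  directions of a horizontal line in the half-plane, while the growth of Hardy space functions
  transplanted to the half-plane is polynomial.\<close>

lemma composition_eigenfunction_vanishes:
  assumes h: "h holomorphic_on unit_disc" "inj_on h unit_disc"
    and half: "{w. b \<le> Im w} \<subseteq> h ` unit_disc"
    and \<phi>: "\<And>z. z \<in> unit_disc \<Longrightarrow> \<phi> z \<in> unit_disc" "\<And>z. z \<in> unit_disc \<Longrightarrow> h (\<phi> z) = h z + 1"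
    and F: "F holomorphic_on unit_disc" "\<And>z. z \<in> unit_disc \<Longrightarrow> norm (F z) \<le> C / (1 - norm z)"
    and eig: "\<And>z. z \<in> unit_disc \<Longrightarrow> F (\<phi> z) = \<nu> * F z" and \<nu>: "norm \<nu> \<noteq> 1"
    and z: "z \<in> unit_disc"
  shows "F z = 0"
proof -
  let ?H = "{w. b < Im w}"
  obtain k where k: "k holomorphic_on h ` unit_disc" "\<And>z. z \<in> unit_disc \<Longrightarrow> k (h z) = z"
    using holomorphic_has_inverse[OF h(1) open_ball h(2)] by metis
  have kH: "k w \<in> unit_disc \<and> h (k w) = w" if "b < Im w" for w
  proof -
    have "w \<in> h ` unit_disc"
      using that half by auto
    then obtain z where "z \<in> unit_disc" "w = h z"
      by blast
    then show ?thesis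
      using k(2) by simp
  qed
  have hol: "k holomorphic_on ?H"
    by (rule holomorphic_on_subset[OF k(1)]) (use half in auto)
  obtain c where c: "0 < c"
    "\<And>w. b < Im w \<Longrightarrow> c * (Im w - b) \<le> (1 - norm (k w)) * (norm (w - \<i> * of_real b + \<i>))\<^sup>2"
    using half_plane_to_disc_decay[OF hol] kH by (metis (no_types, lifting) image_subsetI mem_Collect_eq)
  have C: "0 \<le> C"
    using order_trans[OF norm_ge_zero F(2)[of 0]] by simp
  have step: "F (k (w + 1)) = \<nu> * F (k w)" if w: "b < Im w" for w
  proof -
    have "h (\<phi> (k w)) = w + 1"
      using \<phi>(2)[of "k w"] kH[OF w] by simp
    then have "k (w + 1) = \<phi> (k w)"
      using k(2)[of "\<phi> (k w)"] \<phi>(1) kH[OF w] by simp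
    then show ?thesis
      using eig[of "k w"] kH[OF w] by simp
  qed
  have iter: "F (k (w + of_nat n)) = \<nu> ^ n * F (k w)" if w: "b < Im w" for w n
  proof (induction n)
    case (Suc n)
    then show ?case
      using step[of "w + of_nat n"] w by (simp add: add_ac mult_ac)
  qed simp
  have growth: "norm (F (k w)) \<le> C / (c * (Im w - b)) * (norm (w - \<i> * of_real b + \<i>))\<^sup>2"
    if w: "b < Im w" for w
  proof -
    have pos: "0 < 1 - norm (k w)" "0 < c * (Im w - b)"
      using kH[OF w] c(1) w by auto
    have "norm (F (k w)) \<le> C / (1 - norm (k w))"
      using F(2) kH[OF w] by blast
    also have "1 / (1 - norm (k w)) \<le> (norm (w - \<i> * of_real b + \<i>))\<^sup>2 / (c * (Im w - b))"
      using c(2)[OF w] pos by (simp add: field_simps)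
    then have "C / (1 - norm (k w)) \<le> C * ((norm (w - \<i> * of_real b + \<i>))\<^sup>2 / (c * (Im w - b)))"
      using mult_left_mono[OF _ C] by fastforce
    finally show ?thesis
      by simp
  qed
  have zero: "F (k w) = 0" if w: "b < Im w" for w
  proof -
    define A where "A = norm (w - \<i> * of_real b + \<i>)"
    define D where "D = C / (c * (Im w - b))"
    have D: "0 \<le> D"
      using C c(1) w by (simp add: D_def)
    have bound: "norm (F (k (w + x))) \<le> D * (A + real n)\<^sup>2" if "x = of_nat n \<or> x = - of_nat n" for x n
    proof -
      have "Im x = 0" "norm x = real n"
        using that by auto
      moreover have "norm (w + x - \<i> * of_real b + \<i>) \<le> A + norm x"
        unfolding A_def using norm_triangle_ineq[of "w - \<i> * of_real b + \<i>" x] by (simp add: algebra_simps)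
      ultimately have "(norm (w + x - \<i> * of_real b + \<i>))\<^sup>2 \<le> (A + real n)\<^sup>2"
        by (intro power_mono) auto
      then show ?thesis
        using growth[of "w + x"] w \<open>Im x = 0\<close> mult_left_mono[OF _ D] unfolding D_def by fastforce
    qed
    have "\<exists>q. 0 \<le> q \<and> q < 1 \<and> (\<forall>n. norm (F (k w)) \<le> D * (q ^ n * (A + real n)\<^sup>2))"
    proof (cases "norm \<nu> < 1")
      case True
      have "norm (F (k w)) \<le> D * (norm \<nu> ^ n * (A + real n)\<^sup>2)" for n
      proof -
        have "norm (F (k w)) = norm \<nu> ^ n * norm (F (k (w + - of_nat n)))"
          using iter[of "w + - of_nat n" n] w by (simp add: norm_mult norm_power)
        also have "\<dots> \<le> norm \<nu> ^ n * (D * (A + real n)\<^sup>2)"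
          using bound[of "- of_nat n" n] by (intro mult_left_mono) auto
        finally show ?thesis
          by (simp add: mult_ac)
      qed
      then show ?thesis
        using True by (intro exI[of _ "norm \<nu>"]) auto
    next
      case False
      then have \<nu>1: "1 < norm \<nu>"
        using \<nu> by simp
      have "norm (F (k w)) \<le> D * (inverse (norm \<nu>) ^ n * (A + real n)\<^sup>2)" for n
      proof -
        have "norm \<nu> ^ n * norm (F (k w)) \<le> D * (A + real n)\<^sup>2"
          using bound[of "of_nat n" n] iter[OF w, of n] by (simp add: norm_mult norm_power)
        then have "norm (F (k w)) \<le> D * (A + real n)\<^sup>2 / norm \<nu> ^ n"
          using \<nu>1 order.strict_trans[OF zero_less_one \<nu>1]
          by (subst pos_le_divide_eq) (auto simp: mult.commute)
        then show ?thesis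
          by (simp add: divide_inverse power_inverse mult_ac)
      qed
      moreover have "inverse (norm \<nu>) < 1"
        using \<nu>1 by (rule inverse_less_1_iff[THEN iffD2, OF disjI2])
      ultimately show ?thesis
        by (intro exI[of _ "inverse (norm \<nu>)"]) auto
    qed
    then obtain q where q: "0 \<le> q" "q < 1" "\<And>n. norm (F (k w)) \<le> D * (q ^ n * (A + real n)\<^sup>2)"
      by blast
    have "(\<lambda>n. D * (q ^ n * (A + real n)\<^sup>2)) \<longlonglongrightarrow> D * 0"
      using quadratic_times_power_tendsto_0[OF q(1,2)] by (intro tendsto_intros)
    then have "norm (F (k w)) \<le> D * 0"
      by (rule LIMSEQ_le_const) (use q(3) in auto)
    then show ?thesis
      by simp
  qed
  let ?U = "unit_disc \<inter> h -` ?H"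
  have U: "open ?U"
    using holomorphic_on_imp_continuous_on[OF h(1)] open_halfspace_Im_gt[of b]
    by (intro continuous_open_preimage) auto
  have "k (\<i> * of_real (b + 1)) \<in> ?U"
    using kH[of "\<i> * of_real (b + 1)"] by simp
  then have ne: "?U \<noteq> {}"
    by blast
  have "F u = 0" if "u \<in> ?U" for u
    using zero[of "h u"] k(2)[of u] that by simp
  then show ?thesis
    by (rule analytic_continuation_open[OF U open_ball ne connected_ball Int_lower1 F(1) holomorphic_on_const _ z])
qed

section \<open>Algebras of bounded functions closed in the Hardy norm\<close>

definition bounded_holomorphic :: "(complex \<Rightarrow> complex) \<Rightarrow> bool" where
  "bounded_holomorphic f \<longleftrightarrow> f holomorphic_on unit_disc \<and> (\<exists>M. \<forall>z\<in>unit_disc. norm (f z) \<le> M)"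

lemma bounded_holomorphicI:
  assumes "f holomorphic_on unit_disc" "\<And>z. z \<in> unit_disc \<Longrightarrow> norm (f z) \<le> M"
  shows "bounded_holomorphic f"
  using assms unfolding bounded_holomorphic_def by blast

lemma bounded_holomorphic_cont_sphere:
  assumes "bounded_holomorphic f" "s < 1"
  shows "continuous_on (sphere 0 s) f"
  using assms(1) unfolding bounded_holomorphic_def
  by (metis holomorphic_on_imp_continuous_on continuous_on_subset assms(2) sphere_cball
      cball_subset_ball_iff dist_self add.commute add_0 order_trans)

lemma bounded_holomorphic_const: "bounded_holomorphic (\<lambda>z. c)"
  by (rule bounded_holomorphicI[of _ "norm c"]) auto

lemma bounded_holomorphic_add:
  assumes "bounded_holomorphic f" "bounded_holomorphic g"
  shows "bounded_holomorphic (\<lambda>z. f z + g z)"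
proof -
  obtain M N where M: "\<And>z. z \<in> unit_disc \<Longrightarrow> norm (f z) \<le> M" and N: "\<And>z. z \<in> unit_disc \<Longrightarrow> norm (g z) \<le> N"
    using assms unfolding bounded_holomorphic_def by metis
  show ?thesis
    using assms M N unfolding bounded_holomorphic_def
    by (intro conjI exI[of _ "M + N"] ballI norm_triangle_le add_mono holomorphic_intros) auto
qed

lemma bounded_holomorphic_mult:
  assumes "bounded_holomorphic f" "bounded_holomorphic g"
  shows "bounded_holomorphic (\<lambda>z. f z * g z)"
proof -
  obtain M N where M: "\<And>z. z \<in> unit_disc \<Longrightarrow> norm (f z) \<le> M" and N: "\<And>z. z \<in> unit_disc \<Longrightarrow> norm (g z) \<le> N"
    using assms unfolding bounded_holomorphic_def by metis
  have "norm (f z * g z) \<le> M * N" if "z \<in> unit_disc" for z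
    unfolding norm_mult using M[OF that] N[OF that] order_trans[OF norm_ge_zero M[OF that]]
    by (intro mult_mono) auto
  then show ?thesis
    using assms unfolding bounded_holomorphic_def
    by (intro conjI exI[of _ "M * N"] ballI holomorphic_intros) auto
qed

definition function_algebra :: "(complex \<Rightarrow> complex) set \<Rightarrow> bool" where
  "function_algebra S \<longleftrightarrow> (\<forall>f\<in>S. bounded_holomorphic f) \<and> (\<forall>c. (\<lambda>z. c) \<in> S) \<and>
     (\<forall>f\<in>S. \<forall>g\<in>S. (\<lambda>z. f z + g z) \<in> S \<and> (\<lambda>z. f z * g z) \<in> S)"

text \<open>Only bounded functions are admitted to the closure, because the closure of an algebra in the
  Hardy norm alone need not be closed under products.\<close>

definition hardy_closure :: "real \<Rightarrow> (complex \<Rightarrow> complex) set \<Rightarrow> (complex \<Rightarrow> complex) set" where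
  "hardy_closure p S = {f. bounded_holomorphic f \<and>
     (\<forall>e>0. \<exists>g\<in>S. \<forall>s. 0 < s \<and> s < 1 \<longrightarrow> hardy_mean p (\<lambda>z. f z - g z) s \<le> e)}"

lemma powr_norm_add_le:
  fixes u v :: complex
  assumes "0 < p"
  shows "norm (u + v) powr p \<le> 2 powr p * norm u powr p + 2 powr p * norm v powr p"
proof -
  have "norm (u + v) powr p \<le> (norm u + norm v) powr p"
    using assms by (intro powr_mono2 norm_triangle_ineq) auto
  also have "\<dots> \<le> 2 powr p * (norm u powr p + norm v powr p)"
    using assms by (intro powr_add_le) auto
  finally show ?thesis
    by (simp add: algebra_simps)
qed

lemma hardy_mean_sum_le:
  assumes "continuous_on (sphere 0 s) f" "continuous_on (sphere 0 s) g" "0 < s" "0 < p"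
  shows "hardy_mean p (\<lambda>z. f z + g z) s \<le> 2 powr p * (hardy_mean p f s + hardy_mean p g s)"
proof -
  have "hardy_mean p (\<lambda>z. f z + g z) s \<le> 2 powr p * hardy_mean p f s + 2 powr p * hardy_mean p g s + 2 * pi * 0"
    by (rule hardy_mean_le) (use assms powr_norm_add_le[OF assms(4)] in \<open>auto intro!: continuous_intros\<close>)
  then show ?thesis
    by (simp add: algebra_simps)
qed

lemma hardy_mean_mult_le:
  assumes "continuous_on (sphere 0 s) f" "continuous_on (sphere 0 s) g" "0 < s" "0 < p"
    and M: "\<And>z. z \<in> sphere 0 s \<Longrightarrow> norm (f z) \<le> M"
  shows "hardy_mean p (\<lambda>z. f z * g z) s \<le> M powr p * hardy_mean p g s"
proof -
  have "hardy_mean p (\<lambda>z. f z * g z) s \<le> M powr p * hardy_mean p g s + 2 * pi * 0"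
  proof (rule hardy_mean_mono)
    fix z :: complex assume "z \<in> sphere 0 s"
    then show "norm (f z * g z) powr p \<le> M powr p * norm (g z) powr p + 0"
      using M[of z] assms(4) by (simp add: norm_mult powr_mult powr_mono2 mult_right_mono)
  qed (use assms in \<open>auto intro!: continuous_intros\<close>)
  then show ?thesis
    by simp
qed

lemma hardy_closure_approx:
  assumes "f \<in> hardy_closure p S" "0 < e"
  obtains g where "g \<in> S" "\<And>s. 0 < s \<Longrightarrow> s < 1 \<Longrightarrow> hardy_mean p (\<lambda>z. f z - g z) s \<le> e"
  using assms unfolding hardy_closure_def by blast

text \<open>In the product \<open>f g - f' g' = g (f - f') + f' (g - g')\<close> the approximation \<open>f'\<close> is chosen first,
  since the accuracy demanded of \<open>g'\<close> depends on the bound of \<open>f'\<close>.\<close>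

lemma function_algebra_hardy_closure:
  assumes S: "function_algebra S" and p: "1 \<le> p"
  shows "function_algebra (hardy_closure p S)"
  unfolding function_algebra_def
proof (intro conjI ballI allI)
  have bS: "bounded_holomorphic f" if "f \<in> S" for f
    using S that by (auto simp: function_algebra_def)
  show bd: "bounded_holomorphic f" if "f \<in> hardy_closure p S" for f
    using that by (simp add: hardy_closure_def)
  show "(\<lambda>z. c) \<in> hardy_closure p S" for c
    using S by (auto simp: hardy_closure_def function_algebra_def bounded_holomorphic_const
        intro!: bexI[of _ "\<lambda>z. c"])
  fix f g assume f: "f \<in> hardy_closure p S" and g: "g \<in> hardy_closure p S"
  show "(\<lambda>z. f z + g z) \<in> hardy_closure p S"
    unfolding hardy_closure_def mem_Collect_eq
  proof (intro conjI allI impI)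
    show "bounded_holomorphic (\<lambda>z. f z + g z)"
      by (intro bounded_holomorphic_add bd f g)
    fix e :: real assume e: "0 < e"
    define e' where "e' = e / (2 * 2 powr p)"
    have e': "0 < e'"
      using e by (simp add: e'_def)
    obtain f' where f': "f' \<in> S" "\<And>s. 0 < s \<Longrightarrow> s < 1 \<Longrightarrow> hardy_mean p (\<lambda>z. f z - f' z) s \<le> e'"
      by (rule hardy_closure_approx[OF f e']) blast
    obtain g' where g': "g' \<in> S" "\<And>s. 0 < s \<Longrightarrow> s < 1 \<Longrightarrow> hardy_mean p (\<lambda>z. g z - g' z) s \<le> e'"
      by (rule hardy_closure_approx[OF g e']) blast
    have "hardy_mean p (\<lambda>z. f z + g z - (f' z + g' z)) s \<le> e" if s: "0 < s" "s < 1" for s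
    proof -
      have c: "continuous_on (sphere 0 s) f" "continuous_on (sphere 0 s) g"
          "continuous_on (sphere 0 s) f'" "continuous_on (sphere 0 s) g'"
        using bounded_holomorphic_cont_sphere[OF _ s(2)] bd f g bS f' g' by auto
      have "hardy_mean p (\<lambda>z. f z + g z - (f' z + g' z)) s = hardy_mean p (\<lambda>z. (f z - f' z) + (g z - g' z)) s"
        by (simp add: algebra_simps)
      also have "\<dots> \<le> 2 powr p * (hardy_mean p (\<lambda>z. f z - f' z) s + hardy_mean p (\<lambda>z. g z - g' z) s)"
        using c s p by (intro hardy_mean_sum_le) (auto intro!: continuous_intros)
      also have "\<dots> \<le> 2 powr p * (e' + e')"
        using f' g' s by (intro mult_left_mono add_mono) auto
      also have "\<dots> = e"
        by (simp add: e'_def)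
      finally show ?thesis .
    qed
    then show "\<exists>k\<in>S. \<forall>s. 0 < s \<and> s < 1 \<longrightarrow> hardy_mean p (\<lambda>z. f z + g z - k z) s \<le> e"
      using S f' g' by (intro bexI[of _ "\<lambda>z. f' z + g' z"]) (auto simp: function_algebra_def)
  qed
  show "(\<lambda>z. f z * g z) \<in> hardy_closure p S"
    unfolding hardy_closure_def mem_Collect_eq
  proof (intro conjI allI impI)
    show "bounded_holomorphic (\<lambda>z. f z * g z)"
      by (intro bounded_holomorphic_mult bd f g)
    fix e :: real assume e: "0 < e"
    obtain N where N: "\<And>z. z \<in> unit_disc \<Longrightarrow> norm (g z) \<le> N"
      using bd[OF g] unfolding bounded_holomorphic_def by blast
    define a where "a = e / (2 * 2 powr p * (N powr p + 1))"
    have N1: "0 < N powr p + 1"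
      using powr_ge_zero[of N p] by linarith
    have a: "0 < a"
      using e N1 by (simp add: a_def)
    obtain f' where f': "f' \<in> S" "\<And>s. 0 < s \<Longrightarrow> s < 1 \<Longrightarrow> hardy_mean p (\<lambda>z. f z - f' z) s \<le> a"
      by (rule hardy_closure_approx[OF f a]) blast
    obtain M where M: "\<And>z. z \<in> unit_disc \<Longrightarrow> norm (f' z) \<le> M"
      using bS[OF f'(1)] unfolding bounded_holomorphic_def by blast
    define b where "b = e / (2 * 2 powr p * (M powr p + 1))"
    have M1: "0 < M powr p + 1"
      using powr_ge_zero[of M p] by linarith
    have b: "0 < b"
      using e M1 by (simp add: b_def)
    obtain g' where g': "g' \<in> S" "\<And>s. 0 < s \<Longrightarrow> s < 1 \<Longrightarrow> hardy_mean p (\<lambda>z. g z - g' z) s \<le> b"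
      by (rule hardy_closure_approx[OF g b]) blast
    have "hardy_mean p (\<lambda>z. f z * g z - f' z * g' z) s \<le> e" if s: "0 < s" "s < 1" for s
    proof -
      have c: "continuous_on (sphere 0 s) f" "continuous_on (sphere 0 s) g"
          "continuous_on (sphere 0 s) f'" "continuous_on (sphere 0 s) g'"
        using bounded_holomorphic_cont_sphere[OF _ s(2)] bd f g bS f' g' by auto
      have "hardy_mean p (\<lambda>z. f z * g z - f' z * g' z) s
          = hardy_mean p (\<lambda>z. g z * (f z - f' z) + f' z * (g z - g' z)) s"
        by (simp add: algebra_simps)
      also have "\<dots> \<le> 2 powr p * (hardy_mean p (\<lambda>z. g z * (f z - f' z)) s + hardy_mean p (\<lambda>z. f' z * (g z - g' z)) s)"
        using c s p by (intro hardy_mean_sum_le) (auto intro!: continuous_intros)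
      also have "\<dots> \<le> 2 powr p * (N powr p * hardy_mean p (\<lambda>z. f z - f' z) s + M powr p * hardy_mean p (\<lambda>z. g z - g' z) s)"
        using c s p N M by (intro mult_left_mono add_mono hardy_mean_mult_le) (auto intro!: continuous_intros)
      also have "\<dots> \<le> 2 powr p * ((N powr p + 1) * a + (M powr p + 1) * b)"
        using f' g' s a b by (intro mult_left_mono add_mono mult_mono hardy_mean_nonneg) auto
      also have "(N powr p + 1) * a = e / (2 * 2 powr p)"
        using N1 by (simp add: a_def)
      also have "(M powr p + 1) * b = e / (2 * 2 powr p)"
        using M1 by (simp add: b_def)
      also have "2 powr p * (e / (2 * 2 powr p) + e / (2 * 2 powr p)) = e"
        by simp
      finally show ?thesis .
    qed
    then show "\<exists>k\<in>S. \<forall>s. 0 < s \<and> s < 1 \<longrightarrow> hardy_mean p (\<lambda>z. f z * g z - k z) s \<le> e"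
      using S f' g' by (intro bexI[of _ "\<lambda>z. f' z * g' z"]) (auto simp: function_algebra_def)
  qed
qed

locale hardy_closed_algebra =
  fixes p :: real and B :: "(complex \<Rightarrow> complex) set"
  assumes p: "1 \<le> p" and algebra: "function_algebra B"
    and closed: "hardy_closure p B \<subseteq> B"
begin

lemma bounded: "f \<in> B \<Longrightarrow> bounded_holomorphic f"
  using algebra by (auto simp: function_algebra_def)

lemma const: "(\<lambda>z. c) \<in> B"
  using algebra by (auto simp: function_algebra_def)

lemma add: "f \<in> B \<Longrightarrow> g \<in> B \<Longrightarrow> (\<lambda>z. f z + g z) \<in> B"
  using algebra by (auto simp: function_algebra_def)

lemma mult: "f \<in> B \<Longrightarrow> g \<in> B \<Longrightarrow> (\<lambda>z. f z * g z) \<in> B"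
  using algebra by (auto simp: function_algebra_def)

lemma power: "f \<in> B \<Longrightarrow> (\<lambda>z. f z ^ n) \<in> B"
  by (induction n) (simp_all add: const mult)

lemma sum: "(\<And>i. i \<in> I \<Longrightarrow> f i \<in> B) \<Longrightarrow> (\<lambda>z. \<Sum>i\<in>I. f i z) \<in> B"
  by (induction I rule: infinite_finite_induct) (simp_all add: const add)

lemma mean_closed:
  assumes "bounded_holomorphic f"
    and "\<And>e. 0 < e \<Longrightarrow> \<exists>g\<in>B. \<forall>s. 0 < s \<and> s < 1 \<longrightarrow> hardy_mean p (\<lambda>z. f z - g z) s \<le> e"
  shows "f \<in> B"
  using assms closed by (auto simp: hardy_closure_def)

lemma uniformly_closed:
  assumes f: "f holomorphic_on unit_disc"
    and approx: "\<And>e. 0 < e \<Longrightarrow> \<exists>g\<in>B. \<forall>z\<in>unit_disc. norm (f z - g z) \<le> e"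
  shows "f \<in> B"
proof (rule mean_closed)
  obtain g where g: "g \<in> B" "\<And>z. z \<in> unit_disc \<Longrightarrow> norm (f z - g z) \<le> 1"
    using approx[of 1] by auto
  obtain M where M: "\<And>z. z \<in> unit_disc \<Longrightarrow> norm (g z) \<le> M"
    using bounded[OF g(1)] unfolding bounded_holomorphic_def by blast
  show bf: "bounded_holomorphic f"
  proof (rule bounded_holomorphicI[OF f])
    show "norm (f z) \<le> 1 + M" if "z \<in> unit_disc" for z
      using norm_triangle_ineq[of "f z - g z" "g z"] g(2)[OF that] M[OF that] by simp
  qed
  fix e :: real assume e: "0 < e"
  define d where "d = (e / (2 * pi)) powr (1 / p)"
  have d: "0 < d" "2 * pi * d powr p = e"
    using e p by (simp_all add: d_def powr_powr)
  obtain k where k: "k \<in> B" "\<And>z. z \<in> unit_disc \<Longrightarrow> norm (f z - k z) \<le> d"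
    using approx[OF d(1)] by auto
  have "hardy_mean p (\<lambda>z. f z - k z) s \<le> e" if s: "0 < s" "s < 1" for s
    unfolding d(2)[symmetric]
    using bounded_holomorphic_cont_sphere[OF _ s(2)] bf bounded[OF k(1)] k(2) s p
    by (intro hardy_mean_le_const) (auto intro!: continuous_intros)
  then show "\<exists>g\<in>B. \<forall>s. 0 < s \<and> s < 1 \<longrightarrow> hardy_mean p (\<lambda>z. f z - g z) s \<le> e"
    using k(1) by blast
qed

lemma cong:
  assumes "f \<in> B" "\<And>z. z \<in> unit_disc \<Longrightarrow> g z = f z"
  shows "g \<in> B"
proof (rule uniformly_closed)
  show "g holomorphic_on unit_disc"
    using bounded[OF assms(1)] assms(2) unfolding bounded_holomorphic_def by (metis holomorphic_transform)
qed (use assms in \<open>auto intro!: bexI[of _ f]\<close>)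

text \<open>The geometric series converges uniformly on the disc.\<close>

lemma inverse_one_minus:
  assumes x: "x \<in> B" and \<rho>: "\<rho> < 1" "\<And>z. z \<in> unit_disc \<Longrightarrow> norm (x z) \<le> \<rho>"
  shows "(\<lambda>z. 1 / (1 - x z)) \<in> B"
proof (rule uniformly_closed)
  have \<rho>0: "0 \<le> \<rho>"
    using order_trans[OF norm_ge_zero \<rho>(2)[of 0]] by simp
  have low: "1 - \<rho> \<le> norm (1 - x z)" if "z \<in> unit_disc" for z
    using norm_triangle_ineq2[of 1 "x z"] \<rho>(2)[OF that] by simp
  then have nz: "1 - x z \<noteq> 0" if "z \<in> unit_disc" for z
    using that \<rho>(1) by fastforce
  show "(\<lambda>z. 1 / (1 - x z)) holomorphic_on unit_disc"
    using bounded[OF x] nz by (auto simp: bounded_holomorphic_def intro!: holomorphic_intros)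
  fix e :: real assume e: "0 < e"
  obtain n where n: "\<rho> ^ n < e * (1 - \<rho>)"
    using real_arch_pow_inv[of "e * (1 - \<rho>)" \<rho>] e \<rho>(1) by auto
  have "norm (1 / (1 - x z) - (\<Sum>i<n. x z ^ i)) \<le> e" if z: "z \<in> unit_disc" for z
  proof -
    have "1 / (1 - x z) - (\<Sum>i<n. x z ^ i) = x z ^ n / (1 - x z)"
      using nz[OF z] by (simp add: geometric_sum[of "x z"] field_simps)
    also have "norm \<dots> \<le> \<rho> ^ n / (1 - \<rho>)"
      unfolding norm_divide norm_power using low[OF z] \<rho> \<rho>0 z by (intro frac_le power_mono) auto
    also have "\<dots> \<le> e"
      using n \<rho>(1) by (simp add: field_simps)
    finally show ?thesis .
  qed
  then show "\<exists>g\<in>B. \<forall>z\<in>unit_disc. norm (1 / (1 - x z) - g z) \<le> e"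
    by (intro bexI[of _ "\<lambda>z. \<Sum>i<n. x z ^ i"]) (auto intro!: sum power x)
qed

end

text \<open>The mean value property evaluates the mean of a majorant that is the real part of a holomorphic
  function.\<close>

lemma hardy_mean_le_Re:
  assumes "continuous_on (sphere 0 s) k" "v holomorphic_on unit_disc" "0 < s" "s < 1" "0 < p"
    and le: "\<And>z. z \<in> sphere 0 s \<Longrightarrow> norm (k z) powr p \<le> Re (v z)"
  shows "hardy_mean p k s \<le> 2 * pi * Re (v 0)"
proof -
  have "((\<lambda>\<theta>. norm (k (of_real s * cis \<theta>)) powr p) has_integral hardy_mean p k s) {0..2*pi}"
    unfolding hardy_mean_def using assms by (intro integrable_integral integrable_hardy_integrand) auto
  moreover have "((\<lambda>\<theta>. Re (v (of_real s * cis \<theta>))) has_integral 2 * pi * Re (v 0)) {0..2*pi}"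
    using assms by (intro mean_value_circle_Re)
  ultimately show ?thesis
    using le[OF circle_in_sphere[of s]] assms(3) by (meson has_integral_le less_imp_le)
qed

text \<open>The elementary estimate behind \<open>\<delta> / (1 - e\<^sup>i\<^sup>\<delta>\<^sup>u) \<rightarrow> i / u\<close> on a half-plane: bounded everywhere, and of
  first order in \<open>\<delta> \<bar>u\<bar>\<close>.\<close>

lemma geometric_resolvent_approx:
  fixes u :: complex and \<delta> c :: real
  assumes \<delta>: "0 < \<delta>" "\<delta> * c \<le> 1" and c: "0 < c" and u: "c \<le> Im u"
  shows "norm (exp (\<i> * of_real \<delta> * u)) \<le> exp (- (\<delta> * c))"
    and "norm (\<i> / u - of_real \<delta> / (1 - exp (\<i> * of_real \<delta> * u))) \<le> 6 / c * min 1 (\<delta> * norm u)"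
proof -
  let ?x = "\<i> * of_real \<delta> * u"
  have Rex: "Re ?x = - (\<delta> * Im u)"
    by simp
  show ne: "norm (exp ?x) \<le> exp (- (\<delta> * c))"
    unfolding norm_exp_eq_Re Rex using \<delta> u by simp
  have y: "0 < \<delta> * c"
    using \<delta> c by simp
  have "exp (- (\<delta> * c)) \<le> 1 / (1 + \<delta> * c)"
    using exp_ge_add_one_self[of "\<delta> * c"] y by (simp add: exp_minus field_simps)
  also have "\<dots> \<le> 1 - \<delta> * c / 2"
  proof -
    have "1 \<le> (1 - \<delta> * c / 2) * (1 + \<delta> * c)"
      using mult_left_mono[OF \<delta>(2), of "\<delta> * c"] y by (simp add: algebra_simps)
    then show ?thesis
      using y by (simp add: pos_divide_le_eq)
  qed
  finally have "exp (- (\<delta> * c)) \<le> 1 - \<delta> * c / 2" .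
  moreover have "1 - norm (exp ?x) \<le> norm (1 - exp ?x)"
    by (metis norm_one norm_triangle_ineq2)
  ultimately have low: "\<delta> * c / 2 \<le> norm (1 - exp ?x)"
    using ne by linarith
  then have nz: "1 - exp ?x \<noteq> 0"
    using y by auto
  have unz: "u \<noteq> 0" and cu: "c \<le> norm u"
    using u c abs_Im_le_cmod[of u] by auto
  let ?R = "of_real \<delta> / (1 - exp ?x)"
  have R: "norm ?R \<le> 2 / c"
  proof -
    have "norm ?R \<le> \<delta> / (\<delta> * c / 2)"
      unfolding norm_divide using low y \<delta> by (intro frac_le) auto
    then show ?thesis
      using \<delta> by simp
  qed
  show "norm (\<i> / u - ?R) \<le> 6 / c * min 1 (\<delta> * norm u)"
  proof (cases "\<delta> * norm u \<le> 1")
    case True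
    have nx: "norm ?x = \<delta> * norm u"
      using \<delta> by (simp add: norm_mult)
    have "norm (exp ?x - (\<Sum>k\<le>1. ?x ^ k / fact k)) \<le> exp \<bar>Re ?x\<bar> * norm ?x ^ Suc 1 / fact 1"
      by (rule Taylor_exp)
    then have "norm (exp ?x - 1 - ?x) \<le> exp \<bar>Re ?x\<bar> * (norm ?x)\<^sup>2"
      by (simp add: power2_eq_square diff_diff_eq)
    moreover have "\<bar>Re ?x\<bar> \<le> 1"
      using abs_Re_le_cmod[of ?x] True unfolding nx by (rule order_trans)
    then have "exp \<bar>Re ?x\<bar> \<le> 3"
      using exp_le order_trans[of "exp \<bar>Re ?x\<bar>" "exp 1" 3] by (simp only: exp_le_cancel_iff)
    then have "exp \<bar>Re ?x\<bar> * (norm ?x)\<^sup>2 \<le> 3 * (norm ?x)\<^sup>2"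
      by (rule mult_right_mono) simp
    ultimately have T: "norm (exp ?x - 1 - ?x) \<le> 3 * (\<delta> * norm u)\<^sup>2"
      unfolding nx by (rule order_trans)
    have "\<i> / u - ?R = \<i> * (1 - exp ?x + ?x) / (u * (1 - exp ?x))"
      using nz unz by (simp add: field_simps)
    then have "\<i> / u - ?R = - (\<i> * (exp ?x - 1 - ?x) / (u * (1 - exp ?x)))"
      by (simp add: algebra_simps diff_divide_distrib add_divide_distrib)
    then have "norm (\<i> / u - ?R) = norm (exp ?x - 1 - ?x) / (norm u * norm (1 - exp ?x))"
      by (simp add: norm_mult norm_divide)
    also have "\<dots> \<le> 3 * (\<delta> * norm u)\<^sup>2 / (norm u * norm (1 - exp ?x))"
      by (intro divide_right_mono T) auto
    also have "\<dots> = 3 * (\<delta> * norm u) * norm ?R"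
      using unz \<delta> by (simp add: norm_divide power2_eq_square)
    also have "\<dots> \<le> 3 * (\<delta> * norm u) * (2 / c)"
      using R \<delta> by (intro mult_left_mono) auto
    finally show ?thesis
      using True by (simp add: min_def mult_ac)
  next
    case False
    have "norm (\<i> / u - ?R) \<le> norm (\<i> / u) + norm ?R"
      by (rule norm_triangle_ineq4)
    also have "norm (\<i> / u) \<le> 1 / c"
      using cu c by (simp add: norm_divide frac_le)
    also have "1 / c + norm ?R \<le> 1 / c + 2 / c"
      using R by simp
    also have "\<dots> \<le> 6 / c"
      using c by (simp add: field_simps)
    finally show ?thesis
      using False by (simp add: min_def)
  qed
qed

context hardy_closed_algebra
begin

text \<open>Resolvents \<open>1 / (h - w)\<close> for \<open>w\<close> below the half-plane. Uniform approximation by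
  exponentials is impossible if the image of \<open>h\<close> contains a horizontal line, since along it uniform
  limits of them are almost periodic and \<open>1 / (h - w)\<close> tends to \<open>0\<close>. The geometric
  series \<open>\<delta> / (1 - e\<^sup>i\<^sup>\<delta>\<^sup>u)\<close>, \<open>u = h - w\<close>, converges to \<open>i / u\<close> with an error controlled by
  \<open>(\<delta> \<bar>u\<bar>)\<^sup>1\<^sup>/\<^sup>2\<close>, whose means are bounded by the mean value property of the square root of \<open>- i u\<close>.\<close>

lemma resolvent_below_half_plane:
  assumes h: "h holomorphic_on unit_disc" and half: "\<And>z. z \<in> unit_disc \<Longrightarrow> \<beta> < Im (h z)"
    and E: "\<And>a. 0 \<le> a \<Longrightarrow> (\<lambda>z. exp (\<i> * of_real a * h z)) \<in> B" and w: "Im w < \<beta>"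
  shows "(\<lambda>z. 1 / (h z - w)) \<in> B"
proof -
  define c where "c = \<beta> - Im w"
  have c: "0 < c"
    using w by (simp add: c_def)
  have u: "c \<le> Im (h z - w)" if "z \<in> unit_disc" for z
    using half[OF that] by (simp add: c_def)
  have unz: "h z - w \<noteq> 0" if "z \<in> unit_disc" for z
    using u[OF that] c by auto
  have norm_ge: "c \<le> norm (h z - w)" if "z \<in> unit_disc" for z
    using u[OF that] abs_Im_le_cmod[of "h z - w"] by linarith
  define R where "R \<delta> z = of_real \<delta> * (1 / (1 - exp (\<i> * of_real \<delta> * (h z - w))))" for \<delta> :: real and z
  have RB: "R \<delta> \<in> B" if \<delta>: "0 < \<delta>" "\<delta> * c \<le> 1" for \<delta>
  proof -
    have "(\<lambda>z. exp (\<i> * of_real \<delta> * (h z - w))) = (\<lambda>z. exp (\<i> * of_real \<delta> * h z) * exp (- (\<i> * of_real \<delta> * w)))"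
      by (simp add: exp_add[symmetric] algebra_simps)
    then have "(\<lambda>z. exp (\<i> * of_real \<delta> * (h z - w))) \<in> B"
      using \<delta>(1) by (simp add: mult E const)
    moreover have "exp (- (\<delta> * c)) < 1"
      using \<delta>(1) c by simp
    ultimately have "(\<lambda>z. 1 / (1 - exp (\<i> * of_real \<delta> * (h z - w)))) \<in> B"
      using geometric_resolvent_approx(1)[OF \<delta> c u] by (rule inverse_one_minus)
    then show ?thesis
      unfolding R_def by (intro mult const)
  qed
  define f where "f z = \<i> / (h z - w)" for z
  have fB: "f \<in> B"
  proof (rule mean_closed)
    have "norm (f z) \<le> 1 / c" if "z \<in> unit_disc" for z
      using norm_ge[OF that] c by (simp add: f_def norm_divide frac_le)
    then show bf: "bounded_holomorphic f"
      unfolding f_def using h unz by (intro bounded_holomorphicI[of _ "1 / c"] holomorphic_intros) auto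
    fix e :: real assume e: "0 < e"
    define v where "v z = csqrt (- \<i> * (h z - w))" for z
    have "- \<i> * (h z - w) \<notin> \<real>\<^sub>\<le>\<^sub>0" if "z \<in> unit_disc" for z
      using u[OF that] c by (auto simp: complex_nonpos_Reals_iff)
    then have v: "v holomorphic_on unit_disc"
      unfolding v_def using h by (intro holomorphic_intros) auto
    have Rev: "sqrt (norm (h z - w)) \<le> sqrt 2 * Re (v z)" if z: "z \<in> unit_disc" for z
    proof -
      have "norm (h z - w) \<le> 2 * ((norm (h z - w) + Im (h z - w)) / 2)"
        using u[OF z] c by simp
      then show ?thesis
        by (simp add: v_def norm_mult real_sqrt_mult[symmetric])
    qed
    have Rev0: "0 \<le> Re (v 0)"
      unfolding v_def by (rule Re_csqrt)
    \<comment> \<open>\<open>\<delta>\<close> is chosen so that \<open>(6 / c)\<^sup>p (2 \<delta>)\<^sup>1\<^sup>/\<^sup>2 2 \<pi> Re (v 0) \<le> e\<close>\<close>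
    define D where "D = (6 / c) powr p * sqrt 2 * (2 * pi * (Re (v 0) + 1))"
    have D: "0 < D"
      using c Rev0 by (simp add: D_def)
    define \<delta> where "\<delta> = min (1 / c) ((e / D)\<^sup>2)"
    have \<delta>: "0 < \<delta>" "\<delta> * c \<le> 1" "sqrt \<delta> \<le> e / D"
    proof -
      show "0 < \<delta>"
        using c e D by (simp add: \<delta>_def)
      show "\<delta> * c \<le> 1"
        using c mult_right_mono[of \<delta> "1 / c" c] by (simp add: \<delta>_def)
      have "sqrt \<delta> \<le> sqrt ((e / D)\<^sup>2)"
        by (simp only: \<delta>_def real_sqrt_le_iff min.cobounded2)
      also have "sqrt ((e / D)\<^sup>2) = e / D"
        using e D by (intro real_sqrt_unique) auto
      finally show "sqrt \<delta> \<le> e / D" .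
    qed
    have "hardy_mean p (\<lambda>z. f z - R \<delta> z) s \<le> e" if s: "0 < s" "s < 1" for s
    proof -
      let ?v = "\<lambda>z. of_real ((6 / c) powr p * sqrt \<delta> * sqrt 2) * v z"
      have "hardy_mean p (\<lambda>z. f z - R \<delta> z) s \<le> 2 * pi * Re (?v 0)"
      proof (rule hardy_mean_le_Re)
        show "continuous_on (sphere 0 s) (\<lambda>z. f z - R \<delta> z)"
          using bf bounded[OF RB[OF \<delta>(1,2)]] s by (intro continuous_intros bounded_holomorphic_cont_sphere)
        show "?v holomorphic_on unit_disc"
          by (intro holomorphic_intros v)
        fix z :: complex assume "z \<in> sphere 0 s"
        then have z: "z \<in> unit_disc"
          using s by simp
        define m where "m = min 1 (\<delta> * norm (h z - w))"
        have m: "0 \<le> m" "m \<le> 1"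
          using \<delta> by (auto simp: m_def)
        have msq: "m \<le> sqrt (\<delta> * norm (h z - w))"
        proof (cases "\<delta> * norm (h z - w) \<le> 1")
          case True
          have "(\<delta> * norm (h z - w))\<^sup>2 \<le> \<delta> * norm (h z - w)"
            using True \<delta> by (simp add: power2_eq_square mult_left_le)
          then show ?thesis
            using True by (simp add: m_def real_le_rsqrt)
        next
          case False
          then show ?thesis
            by (simp add: m_def)
        qed
        have "norm (f z - R \<delta> z) \<le> 6 / c * m"
          using geometric_resolvent_approx(2)[OF \<delta>(1,2) c u[OF z]] by (simp add: f_def R_def m_def)
        then have "norm (f z - R \<delta> z) powr p \<le> (6 / c * m) powr p"
          using p by (intro powr_mono2) auto
        also have "\<dots> = (6 / c) powr p * m powr p"
          by (rule powr_mult)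
        also have "m powr p \<le> m powr 1"
          using m p by (intro powr_mono') auto
        also have "m powr 1 \<le> sqrt \<delta> * sqrt (norm (h z - w))"
          using m msq by (simp add: real_sqrt_mult)
        also have "\<dots> \<le> sqrt \<delta> * (sqrt 2 * Re (v z))"
          using Rev[OF z] \<delta> by (intro mult_left_mono) auto
        finally show "norm (f z - R \<delta> z) powr p \<le> Re (?v z)"
          by (simp add: mult_left_mono mult.assoc)
      qed (use s p in auto)
      also have "\<dots> = sqrt \<delta> * ((6 / c) powr p * sqrt 2 * (2 * pi * Re (v 0)))"
        by simp
      also have "\<dots> \<le> sqrt \<delta> * D"
        unfolding D_def using \<delta> c by (intro mult_left_mono) auto
      also have "\<dots> \<le> e / D * D"
        using \<delta>(3) D by (intro mult_right_mono) auto
      finally show ?thesis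
        using D by simp
    qed
    then show "\<exists>g\<in>B. \<forall>s. 0 < s \<and> s < 1 \<longrightarrow> hardy_mean p (\<lambda>z. f z - g z) s \<le> e"
      using RB[OF \<delta>(1,2)] by blast
  qed
  have "(\<lambda>z. (- \<i>) * f z) \<in> B"
    by (intro mult const fB)
  then show ?thesis
    by (simp add: f_def)
qed

text \<open>The poles are moved through the complement of the closed domain: \<open>1 / (h - w')\<close> is a geometric
  series in \<open>1 / (h - w)\<close> when \<open>w'\<close> is closer to \<open>w\<close> than the domain is, and connectedness does the rest.\<close>

lemma resolvent_pole_pushing:
  assumes h: "h holomorphic_on unit_disc"
    and conn: "connected (- closure (h ` unit_disc))"
    and w0: "w0 \<notin> closure (h ` unit_disc)" "(\<lambda>z. 1 / (h z - w0)) \<in> B"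
    and w: "w \<notin> closure (h ` unit_disc)"
  shows "(\<lambda>z. 1 / (h z - w)) \<in> B"
proof -
  let ?V = "- closure (h ` unit_disc)"
  define P where "P = {w \<in> ?V. (\<lambda>z. 1 / (h z - w)) \<in> B}"
  have step: "w' \<in> P" if w: "w \<in> P" and d: "ball w d \<subseteq> ?V" and w': "norm (w' - w) \<le> \<rho> * d" and \<rho>: "0 < \<rho>" "\<rho> < 1"
    and d0: "0 < d" for w w' d \<rho>
  proof -
    have "norm (w' - w) < d"
      using w' mult_strict_right_mono[OF \<rho>(2) d0] by simp
    then have "w' \<in> ball w d"
      by (simp add: dist_norm norm_minus_commute)
    then have V: "w' \<in> ?V"
      using d by blast
    have far: "d \<le> norm (h z - w)" if "z \<in> unit_disc" for z
    proof (rule ccontr)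
      assume "\<not> d \<le> norm (h z - w)"
      then have "h z \<in> ball w d"
        by (simp add: dist_norm norm_minus_commute)
      then show False
        using d that closure_subset[of "h ` unit_disc"] by blast
    qed
    define x where "x z = (w' - w) * (1 / (h z - w))" for z
    have wB: "(\<lambda>z. 1 / (h z - w)) \<in> B"
      using w by (simp add: P_def)
    then have "x \<in> B"
      unfolding x_def by (intro mult const)
    moreover have "norm (x z) \<le> \<rho>" if z: "z \<in> unit_disc" for z
    proof -
      have "norm (x z) = norm (w' - w) / norm (h z - w)"
        by (simp add: x_def norm_mult norm_divide)
      also have "\<dots> \<le> \<rho> * d / d"
        using far[OF z] w' d0 \<rho> by (intro frac_le) auto
      finally show ?thesis
        using d0 by simp
    qed
    ultimately have "(\<lambda>z. 1 / (h z - w) * (1 / (1 - x z))) \<in> B"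
      using \<rho> by (intro mult wB inverse_one_minus) auto
    moreover have "1 / (h z - w') = 1 / (h z - w) * (1 / (1 - x z))" if z: "z \<in> unit_disc" for z
    proof -
      have "h z - w \<noteq> 0"
        using far[OF z] d0 by auto
      then have "(h z - w) * (1 - x z) = h z - w'"
        by (simp add: x_def field_simps)
      then show ?thesis
        by simp
    qed
    ultimately have "(\<lambda>z. 1 / (h z - w')) \<in> B"
      by (rule cong)
    then show ?thesis
      using V by (simp add: P_def)
  qed
  have openV: "open ?V"
    by auto
  have "open P"
    unfolding open_contains_ball
  proof
    fix w assume w: "w \<in> P"
    then obtain d where d: "0 < d" "ball w d \<subseteq> ?V"
      using openV unfolding open_contains_ball P_def by blast
    have "ball w (d / 2) \<subseteq> P"
    proof
      fix w' assume "w' \<in> ball w (d / 2)"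
      then show "w' \<in> P"
        using step[OF w d(2), of w' "1/2"] d(1) by (simp add: dist_norm norm_minus_commute)
    qed
    then show "\<exists>e>0. ball w e \<subseteq> P"
      using d(1) by (intro exI[of _ "d / 2"]) auto
  qed
  moreover have "open (?V - P)"
    unfolding open_contains_ball
  proof
    fix w assume w: "w \<in> ?V - P"
    then obtain d where d: "0 < d" "ball w d \<subseteq> ?V"
      using openV unfolding open_contains_ball by blast
    have "ball w (d / 3) \<subseteq> ?V - P"
    proof
      fix w' assume w': "w' \<in> ball w (d / 3)"
      have "ball w' (2 * d / 3) \<subseteq> ball w d"
      proof
        fix y assume "y \<in> ball w' (2 * d / 3)"
        then show "y \<in> ball w d"
          using w' dist_triangle[of w y w'] by simp
      qed
      then have sub: "ball w' (2 * d / 3) \<subseteq> ?V"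
        using d(2) by blast
      have "w' \<notin> P"
      proof
        assume "w' \<in> P"
        then have "w \<in> P"
          using step[OF _ sub, of w "1/2"] w' d(1) by (simp add: dist_norm norm_minus_commute)
        then show False
          using w by simp
      qed
      moreover have "w' \<in> ball w d"
        using w' d(1) by simp
      then have "w' \<in> ?V"
        using d(2) by blast
      ultimately show "w' \<in> ?V - P"
        by simp
    qed
    then show "\<exists>e>0. ball w e \<subseteq> ?V - P"
      using d(1) by (intro exI[of _ "d / 3"]) auto
  qed
  ultimately have "P \<inter> ?V = {} \<or> (?V - P) \<inter> ?V = {}"
    using connectedD[OF conn, of P "?V - P"] by blast
  moreover have "w0 \<in> P"
    using w0 by (simp add: P_def)
  ultimately have "w \<in> P"
    using w w0 by blast
  then show ?thesis
    by (simp add: P_def)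
qed

end

section \<open>Uniform Riemann sums and Riemann maps of outer domains\<close>

lemma uniform_riemann_sums:
  fixes f :: "real \<Rightarrow> complex \<Rightarrow> complex"
  assumes K: "compact K" and cont: "continuous_on ({0..b} \<times> K) (\<lambda>x. f (fst x) (snd x))"
    and b: "0 < b" and e: "0 < e"
  shows "\<exists>n>0. \<forall>\<zeta>\<in>K. norm (integral {0..b} (\<lambda>t. f t \<zeta>) - (\<Sum>k<n. of_real (b / real n) * f (b * real k / real n) \<zeta>)) \<le> e"
proof -
  define e' where "e' = e / b"
  have e': "0 < e'"
    using e b by (simp add: e'_def)
  have "compact ({0..b} \<times> K)"
    using K by (intro compact_Times) auto
  then have "uniformly_continuous_on ({0..b} \<times> K) (\<lambda>x. f (fst x) (snd x))"
    using cont by (intro compact_uniformly_continuous)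
  then obtain d where d: "0 < d"
    "\<And>x y. x \<in> {0..b} \<times> K \<Longrightarrow> y \<in> {0..b} \<times> K \<Longrightarrow> dist y x < d \<Longrightarrow> dist (f (fst y) (snd y)) (f (fst x) (snd x)) < e'"
    using e' unfolding uniformly_continuous_on_def by metis
  obtain n :: nat where n: "0 < n" "b / real n < d"
  proof -
    obtain n :: nat where "b / d < real n"
      using reals_Archimedean2 by blast
    moreover from this have "0 < real n"
      using b d(1) by (meson divide_pos_pos order_less_trans)
    ultimately show ?thesis
      using that[of n] d(1) by (simp add: field_simps)
  qed
  let ?t = "\<lambda>k. b * real k / real n"
  have step: "?t (Suc k) = ?t k + b / real n" for k
    using n by (simp add: field_simps)
  have "norm (integral {0..b} (\<lambda>t. f t \<zeta>) - (\<Sum>k<n. of_real (b / real n) * f (?t k) \<zeta>)) \<le> e" if \<zeta>: "\<zeta> \<in> K" for \<zeta>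
  proof -
    have c: "continuous_on {x..y} (\<lambda>t. f t \<zeta>)" if "0 \<le> x" "y \<le> b" for x y
      by (rule continuous_on_compose2[OF cont, where f = "\<lambda>t. (t, \<zeta>)", simplified])
         (use that \<zeta> in \<open>auto intro!: continuous_intros\<close>)
    have "m \<le> n \<Longrightarrow> norm (integral {0..?t m} (\<lambda>t. f t \<zeta>) - (\<Sum>k<m. of_real (b / real n) * f (?t k) \<zeta>)) \<le> real m * (e' * (b / real n))" for m
    proof (induction m)
      case (Suc m)
      have t0: "0 \<le> ?t m" "?t m \<le> ?t (Suc m)"
        using b n step[of m] by auto
      have "b * real (Suc m) \<le> b * real n"
        using b Suc.prems by (intro mult_left_mono) auto
      then have t1: "?t (Suc m) \<le> b"
        using n by (simp add: pos_divide_le_eq)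
      have A: "integral {0..?t m} (\<lambda>t. f t \<zeta>) + integral {?t m..?t (Suc m)} (\<lambda>t. f t \<zeta>) = integral {0..?t (Suc m)} (\<lambda>t. f t \<zeta>)"
        using t0 t1 c[of 0 "?t (Suc m)"]
        by (intro Henstock_Kurzweil_Integration.integral_combine integrable_continuous_real) auto
      have D: "integral {?t m..?t (Suc m)} (\<lambda>t. f t \<zeta> - f (?t m) \<zeta>)
          = integral {?t m..?t (Suc m)} (\<lambda>t. f t \<zeta>) - of_real (b / real n) * f (?t m) \<zeta>"
        using c[OF t0(1) t1] t0 step[of m]
        by (subst Henstock_Kurzweil_Integration.integral_diff)
           (auto intro!: integrable_continuous_real simp: scaleR_conv_of_real)
      have "norm (integral {?t m..?t (Suc m)} (\<lambda>t. f t \<zeta> - f (?t m) \<zeta>)) \<le> e' * (?t (Suc m) - ?t m)"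
      proof (rule integral_bound)
        fix t assume t: "t \<in> {?t m..?t (Suc m)}"
        then have "dist t (?t m) < d"
          using n(2) step[of m] by (auto simp: dist_real_def)
        then show "norm (f t \<zeta> - f (?t m) \<zeta>) \<le> e'"
          using d(2)[of "(?t m, \<zeta>)" "(t, \<zeta>)"] t t0 t1 \<zeta> by (auto simp: dist_norm dist_Pair_Pair)
      qed (use t0 t1 c in \<open>auto intro!: continuous_intros\<close>)
      moreover have "?t (Suc m) - ?t m = b / real n"
        using step[of m] by simp
      ultimately have D_le: "norm (integral {?t m..?t (Suc m)} (\<lambda>t. f t \<zeta> - f (?t m) \<zeta>)) \<le> e' * (b / real n)"
        by (simp only:)
      have "integral {0..?t (Suc m)} (\<lambda>t. f t \<zeta>) - (\<Sum>k<Suc m. of_real (b / real n) * f (?t k) \<zeta>)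
          = (integral {0..?t m} (\<lambda>t. f t \<zeta>) - (\<Sum>k<m. of_real (b / real n) * f (?t k) \<zeta>))
            + integral {?t m..?t (Suc m)} (\<lambda>t. f t \<zeta> - f (?t m) \<zeta>)"
        unfolding D A[symmetric] sum.lessThan_Suc by (rule add_diff_add)
      then have "norm (integral {0..?t (Suc m)} (\<lambda>t. f t \<zeta>) - (\<Sum>k<Suc m. of_real (b / real n) * f (?t k) \<zeta>))
          \<le> real m * (e' * (b / real n)) + e' * (b / real n)"
        using norm_triangle_mono[OF Suc.IH D_le] Suc.prems by (simp only: Suc_leD)
      moreover have "real (Suc m) * (e' * (b / real n)) = real m * (e' * (b / real n)) + e' * (b / real n)"
        by (simp only: of_nat_Suc distrib_right mult_1_left add.commute)
      ultimately show ?case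
        by (simp only:)
    qed simp
    from this[of n] show ?thesis
      using n b by (simp add: e'_def)
  qed
  then show ?thesis
    using n by blast
qed

text \<open>The complement of the \<open>n\<close>-th domain contains the component at infinity of the set of points at
  distance at least \<open>1 / (n + 1)\<close> from \<open>K\<close>; it is connected, which makes the domain simply connected. As
  the complement of \<open>K\<close> is connected, a point off \<open>K\<close> is joined to infinity by a path at positive
  distance from \<open>K\<close>, so that a neighbourhood of it is eventually left out.\<close>

lemma outer_simply_connected_domains:
  fixes K :: "complex set"
  assumes K: "compact K" "connected K" "K \<noteq> {}" and conn: "connected (- K)"
  obtains G R where "\<And>n::nat. open (G n)" "\<And>n. simply_connected (G n)" "\<And>n. K \<subseteq> G n" "\<And>n. G n \<subseteq> ball 0 R"
    "\<And>c. c \<notin> K \<Longrightarrow> \<exists>e>0. \<exists>N. \<forall>n\<ge>N. ball c e \<inter> G n = {}"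
proof -
  obtain R0 where R0: "\<And>x. x \<in> K \<Longrightarrow> norm x \<le> R0"
    using compact_imp_bounded[OF K(1)] unfolding bounded_iff by blast
  define R where "R = max R0 0 + 1"
  have R: "0 < R"
    by (simp add: R_def)
  define U where "U = - ball (0::complex) R"
  have U: "connected U"
    unfolding U_def by (rule connected_complement_bounded_convex) auto
  define P :: complex where "P = of_real R"
  have PU: "P \<in> U"
    using R by (simp add: P_def U_def)
  define E where "E n = {x. \<forall>y\<in>K. 1 / real (Suc n) \<le> dist x y}" for n
  have E_closed: "closed (E n)" for n
  proof -
    have "E n = (\<Inter>y\<in>K. {x. 1 / real (Suc n) \<le> dist x y})"
      by (auto simp: E_def)
    then show ?thesis
      by (auto intro!: closed_INT closed_Collect_le continuous_intros)
  qed
  have UE: "U \<subseteq> E n" for n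
  proof
    fix x assume "x \<in> U"
    then have x: "R \<le> norm x"
      by (simp add: U_def)
    have "1 / real (Suc n) \<le> dist x y" if "y \<in> K" for y
    proof -
      have "1 / real (Suc n) \<le> 1"
        by simp
      also have "1 \<le> norm x - norm y"
        using x R0[OF that] by (simp add: R_def)
      also have "\<dots> \<le> dist x y"
        by (simp add: dist_norm norm_triangle_ineq2)
      finally show ?thesis .
    qed
    then show "x \<in> E n"
      by (simp add: E_def)
  qed
  define F where "F n = connected_component_set (E n) P" for n
  have F_closed: "closed (F n)" and F_conn: "connected (F n)" and F_E: "F n \<subseteq> E n" for n
    unfolding F_def using E_closed by (auto intro!: closed_connected_component connected_connected_component
        connected_component_subset)
  have in_F: "X \<subseteq> F n" if "connected X" "P \<in> X" "X \<subseteq> E n" for X n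
    unfolding F_def using that by (intro connected_component_maximal)
  have KF: "K \<subseteq> - F n" for n
  proof
    fix x assume "x \<in> K"
    then have "x \<notin> E n"
      unfolding E_def by (auto intro!: bexI[of _ x])
    then show "x \<in> - F n"
      using F_E by auto
  qed
  obtain k0 where k0: "k0 \<in> K"
    using K(3) by blast
  define G where "G n = connected_component_set (- F n) k0" for n
  have KG: "K \<subseteq> G n" for n
    unfolding G_def using k0 K(2) KF by (intro connected_component_maximal)
  have G_open: "open (G n)" for n
    unfolding G_def using F_closed by (intro open_connected_component) auto
  have GF: "G n \<subseteq> - F n" for n
    unfolding G_def by (rule connected_component_subset)
  have G_ball: "G n \<subseteq> ball 0 R" for n
    using GF[of n] in_F[OF U PU UE, of n] unfolding U_def by blast
  have "G n \<in> components (- F n)" for n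
    unfolding G_def using k0 KF by (intro componentsI) auto
  then have "connected (- G n)" for n
    using component_complement_connected[OF F_conn] by blast
  moreover have "connected (G n)" for n
    unfolding G_def by (rule connected_connected_component)
  moreover have "bounded (G n)" for n
    using G_ball bounded_subset[OF bounded_ball] by blast
  ultimately have G_sc: "simply_connected (G n)" for n
    using simply_connected_iff_simple[OF G_open] by blast
  have avoid: "\<exists>e>0. \<exists>N. \<forall>n\<ge>N. ball c e \<inter> G n = {}" if c: "c \<notin> K" for c
  proof -
    have "open (- K)"
      using compact_imp_closed[OF K(1)] by auto
    then have "path_connected (- K)"
      using conn connected_open_path_connected by blast
    moreover have "P \<notin> K"
    proof
      assume "P \<in> K"
      then have "dist P P \<ge> 1 / real (Suc 0)"
        using UE[of 0] PU unfolding E_def by blast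
      then show False by simp
    qed
    ultimately obtain g where g: "path g" "path_image g \<subseteq> - K" "pathstart g = c" "pathfinish g = P"
      using c unfolding path_connected_def by blast
    have "compact (path_image g)"
      using g(1) by (rule compact_path_image)
    moreover have "path_image g \<inter> K = {}"
      using g(2) by blast
    ultimately obtain d where d: "0 < d" "\<And>x y. x \<in> path_image g \<Longrightarrow> y \<in> K \<Longrightarrow> d \<le> dist x y"
      using separate_compact_closed[of "path_image g" K] compact_imp_closed[OF K(1)] by blast
    define X where "X = path_image g \<union> ball c (d / 2)"
    have cg: "c \<in> path_image g" and Pg: "P \<in> path_image g"
      using g(3,4) by (auto simp: path_image_def pathstart_def pathfinish_def)
    have "connected X"
      unfolding X_def using g(1) cg d(1)
      by (intro connected_Un connected_path_image) auto
    have X_far: "d / 2 \<le> dist x y" if "x \<in> X" "y \<in> K" for x y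
      using that(1) unfolding X_def
    proof
      assume "x \<in> path_image g"
      then show ?thesis
        using d(1) d(2)[of x y] that(2) by auto
    next
      assume "x \<in> ball c (d / 2)"
      then show ?thesis
        using d(2)[OF cg that(2)] dist_triangle[of c y x] by auto
    qed
    obtain N where N: "inverse (real (Suc N)) < d / 2"
      using reals_Archimedean[of "d / 2"] d(1) by auto
    have "ball c (d / 2) \<inter> G n = {}" if n: "N \<le> n" for n
    proof -
      have "1 / real (Suc n) \<le> 1 / real (Suc N)"
        using n by (intro divide_left_mono) auto
      then have "1 / real (Suc n) \<le> d / 2"
        using N by (simp add: inverse_eq_divide)
      then have "X \<subseteq> E n"
        using X_far unfolding E_def by (blast intro: order_trans)
      then have "X \<subseteq> F n"
        using \<open>connected X\<close> Pg by (intro in_F) (auto simp: X_def)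
      then show ?thesis
        using GF[of n] unfolding X_def by blast
    qed
    then show ?thesis
      using d(1) by (intro exI[of _ "d / 2"] conjI exI[of _ N]) auto
  qed
  show ?thesis
    using that[of G R] G_open G_sc KG G_ball avoid by blast
qed

lemma normalized_riemann_map:
  assumes "open G" "simply_connected G" "G \<noteq> UNIV" "z0 \<in> G"
  obtains v \<psi> where "v holomorphic_on G" "\<psi> holomorphic_on unit_disc" "v z0 = 0"
    "\<And>z. z \<in> G \<Longrightarrow> v z \<in> unit_disc \<and> \<psi> (v z) = z" "\<And>x. x \<in> unit_disc \<Longrightarrow> \<psi> x \<in> G \<and> v (\<psi> x) = x"
proof -
  obtain f g where fg: "f holomorphic_on G" "g holomorphic_on unit_disc"
    "\<And>z. z \<in> G \<Longrightarrow> f z \<in> unit_disc \<and> g (f z) = z" "\<And>x. x \<in> unit_disc \<Longrightarrow> g x \<in> G \<and> f (g x) = x"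
    using Riemann_mapping_theorem[of G] assms by blast
  have "f z0 \<in> unit_disc"
    using fg(3) assms(4) by blast
  then obtain m k where mk: "m (f z0) = 0" "m holomorphic_on unit_disc" "m ` unit_disc \<subseteq> unit_disc"
    "k holomorphic_on unit_disc" "k ` unit_disc \<subseteq> unit_disc"
    "\<And>z. z \<in> unit_disc \<Longrightarrow> m (k z) = z" "\<And>z. z \<in> unit_disc \<Longrightarrow> k (m z) = z"
    by (rule ball_biholomorphism_exists) blast
  show ?thesis
  proof (rule that[of "m \<circ> f" "g \<circ> k"])
    show "m \<circ> f holomorphic_on G"
      using fg mk by (intro holomorphic_on_compose_gen[of _ _ _ unit_disc]) auto
    show "g \<circ> k holomorphic_on unit_disc"
      using fg mk by (intro holomorphic_on_compose_gen[of _ _ _ unit_disc]) auto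
    show "(m \<circ> f) z0 = 0"
      using mk by simp
    show "(m \<circ> f) z \<in> unit_disc \<and> (g \<circ> k) ((m \<circ> f) z) = z" if "z \<in> G" for z
    proof -
      have "f z \<in> unit_disc"
        using fg(3) that by blast
      then show ?thesis
        using fg(3)[OF that] mk(3) mk(7)[of "f z"] by (simp add: image_subset_iff)
    qed
    show "(g \<circ> k) x \<in> G \<and> (m \<circ> f) ((g \<circ> k) x) = x" if x: "x \<in> unit_disc" for x
    proof -
      have "k x \<in> unit_disc"
        using mk(5) x by blast
      then show ?thesis
        using fg(4)[of "k x"] mk(6)[OF x] by simp
    qed
  qed
qed

text \<open>Cauchy's formula for the inverse of a conformal map. Riemann sums of this integral are combinations of
  the functions \<open>1 / (\<psi> x - \<zeta>)\<close> of \<open>\<zeta> = \<psi> y\<close> with poles \<open>\<psi> x\<close> on a curve; this is how the inverse is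
  approximated by rational functions with poles off a compact set.\<close>

lemma cauchy_inverse_formula:
  assumes \<psi>: "\<psi> holomorphic_on unit_disc" "inj_on \<psi> unit_disc"
    and r: "norm y < r" "r < 1"
  shows "((\<lambda>\<theta>. of_real r * cis \<theta> * deriv \<psi> (of_real r * cis \<theta>) / (\<psi> (of_real r * cis \<theta>) - \<psi> y)
            * (of_real r * cis \<theta>)) has_integral 2 * of_real pi * y) {0..2 * pi}"
proof -
  have r0: "0 < r"
    using r(1) norm_ge_zero[of y] by linarith
  have y: "y \<in> unit_disc"
    using r by simp
  define d where "d x = (if x = y then deriv \<psi> y else (\<psi> x - \<psi> y) / (x - y))" for x
  have d: "d holomorphic_on unit_disc"
    unfolding d_def by (rule pole_lemma_open[OF \<psi>(1) open_ball])
  have reg: "deriv \<psi> y \<noteq> 0"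
    using holomorphic_injective_imp_regular[OF \<psi>(1) open_ball \<psi>(2) y] .
  have dnz: "d x \<noteq> 0" if "x \<in> unit_disc" for x
    using reg inj_onD[OF \<psi>(2) _ that y] by (auto simp: d_def)
  define Q where "Q x = x * deriv \<psi> x / d x" for x
  have "Q holomorphic_on unit_disc"
    unfolding Q_def using d dnz \<psi>(1) by (intro holomorphic_intros holomorphic_deriv) auto
  then have "Q holomorphic_on cball 0 r"
    by (rule holomorphic_on_subset) (use r in auto)
  then have "((\<lambda>x. Q x / (x - y)) has_contour_integral (2 * of_real pi * \<i> * Q y)) (circlepath 0 r)"
    using r by (intro Cauchy_integral_circlepath_simple) auto
  then have "((\<lambda>t. Q (0 + of_real r * cis t) / (0 + of_real r * cis t - y) * of_real r * \<i> * cis t)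
       has_integral (2 * of_real pi * \<i> * Q y)) {0..2 * pi}"
    unfolding circlepath_def by (subst (asm) has_contour_integral_part_circlepath_iff) auto
  then have "((\<lambda>t. (- \<i>) * (Q (0 + of_real r * cis t) / (0 + of_real r * cis t - y) * of_real r * \<i> * cis t))
       has_integral (- \<i>) * (2 * of_real pi * \<i> * Q y)) {0..2 * pi}"
    by (rule has_integral_mult_right)
  moreover have "(- \<i>) * (2 * of_real pi * \<i> * Q y) = 2 * of_real pi * y"
    using reg by (simp add: Q_def d_def mult_ac)
  moreover have "(- \<i>) * (Q (0 + of_real r * cis t) / (0 + of_real r * cis t - y) * of_real r * \<i> * cis t)
      = of_real r * cis t * deriv \<psi> (of_real r * cis t) / (\<psi> (of_real r * cis t) - \<psi> y) * (of_real r * cis t)" for t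
  proof -
    let ?x = "of_real r * cis t"
    have "norm ?x = r"
      using r0 by (simp add: norm_mult)
    then have xy: "?x \<noteq> y"
      using r(1) by auto
    then have "Q ?x / (?x - y) = ?x * deriv \<psi> ?x / (\<psi> ?x - \<psi> y)"
      by (simp add: Q_def d_def)
    then show ?thesis
      by (simp add: mult_ac)
  qed
  ultimately show ?thesis
    by (simp only:)
qed

context hardy_closed_algebra
begin

lemma riemann_map_in_algebra:
  assumes u: "u holomorphic_on unit_disc" "u ` unit_disc \<subseteq> K" and K: "compact K"
    and poles: "\<And>c. c \<notin> K \<Longrightarrow> (\<lambda>z. 1 / (u z - c)) \<in> B"
    and G: "K \<subseteq> G" and v: "v holomorphic_on G" and \<psi>: "\<psi> holomorphic_on unit_disc"
    and v\<psi>: "\<And>z. z \<in> G \<Longrightarrow> v z \<in> unit_disc \<and> \<psi> (v z) = z" "\<And>x. x \<in> unit_disc \<Longrightarrow> \<psi> x \<in> G \<and> v (\<psi> x) = x"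
  shows "(\<lambda>z. v (u z)) \<in> B"
proof (rule uniformly_closed)
  have "v \<circ> u holomorphic_on unit_disc"
    using u G by (intro holomorphic_on_compose_gen[OF _ v]) auto
  then show "(\<lambda>z. v (u z)) holomorphic_on unit_disc"
    by (simp add: o_def)
  have inj: "inj_on \<psi> unit_disc"
    using v\<psi>(2) by (metis inj_onI)
  have "compact (v ` K)" "v ` K \<subseteq> unit_disc"
    using K G v\<psi>(1) continuous_on_subset[OF holomorphic_on_imp_continuous_on[OF v] G]
    by (auto intro!: compact_continuous_image)
  then obtain \<rho> where \<rho>: "0 < \<rho>" "\<rho> < 1" "v ` K \<subseteq> cball 0 \<rho>"
    by (rule compact_subset_unit_disc)
  define r where "r = (1 + \<rho>) / 2"
  have r: "\<rho> < r" "r < 1" "0 < r"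
    using \<rho> by (auto simp: r_def)
  define x where "x \<theta> = of_real r * cis \<theta>" for \<theta>
  have x: "norm (x \<theta>) = r" "x \<theta> \<in> unit_disc" for \<theta>
    using r by (auto simp: x_def norm_mult)
  have \<psi>K: "\<psi> (x \<theta>) \<notin> K" for \<theta>
  proof
    assume "\<psi> (x \<theta>) \<in> K"
    then have "v (\<psi> (x \<theta>)) \<in> cball 0 \<rho>"
      using \<rho>(3) by blast
    then show False
      using v\<psi>(2)[OF x(2)[of \<theta>]] x(1)[of \<theta>] r by simp
  qed
  define C where "C \<theta> = x \<theta> * deriv \<psi> (x \<theta>) * x \<theta> / (2 * of_real pi)" for \<theta>
  define J where "J \<theta> \<zeta> = C \<theta> / (\<psi> (x \<theta>) - \<zeta>)" for \<theta> \<zeta>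
  have int: "integral {0..2*pi} (\<lambda>\<theta>. J \<theta> \<zeta>) = v \<zeta>" if \<zeta>: "\<zeta> \<in> K" for \<zeta>
  proof -
    have "norm (v \<zeta>) < r"
      using \<rho>(3) \<zeta> r by auto
    moreover have "\<psi> (v \<zeta>) = \<zeta>"
      using v\<psi>(1) \<zeta> G by blast
    ultimately have "((\<lambda>\<theta>. x \<theta> * deriv \<psi> (x \<theta>) / (\<psi> (x \<theta>) - \<zeta>) * x \<theta>) has_integral 2 * of_real pi * v \<zeta>) {0..2*pi}"
      using cauchy_inverse_formula[OF \<psi> inj _ r(2), of "v \<zeta>"] by (simp add: x_def)
    then have "((\<lambda>\<theta>. x \<theta> * deriv \<psi> (x \<theta>) / (\<psi> (x \<theta>) - \<zeta>) * x \<theta> * (1 / (2 * of_real pi)))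
        has_integral 2 * of_real pi * v \<zeta> * (1 / (2 * of_real pi))) {0..2*pi}"
      by (rule has_integral_mult_left)
    then show ?thesis
      by (intro integral_unique) (simp add: J_def C_def mult_ac)
  qed
  have cont: "continuous_on ({0..2*pi} \<times> K) (\<lambda>y. J (fst y) (snd y))"
  proof -
    have cx: "continuous_on ({0..2*pi} \<times> K) (\<lambda>y. x (fst y))"
      unfolding x_def by (intro continuous_intros)
    have c1: "continuous_on ({0..2*pi} \<times> K) (\<lambda>y. \<psi> (x (fst y)))"
      by (rule continuous_on_compose2[OF holomorphic_on_imp_continuous_on[OF \<psi>] cx]) (use x in auto)
    have "deriv \<psi> holomorphic_on unit_disc"
      using \<psi> by (intro holomorphic_deriv) auto
    then have c2: "continuous_on ({0..2*pi} \<times> K) (\<lambda>y. deriv \<psi> (x (fst y)))"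
      by (intro continuous_on_compose2[OF holomorphic_on_imp_continuous_on cx]) (use x in auto)
    have "\<psi> (x (fst y)) - snd y \<noteq> 0" if "y \<in> {0..2*pi} \<times> K" for y
      using \<psi>K[of "fst y"] that by auto
    then show ?thesis
      unfolding J_def C_def using cx c1 c2 by (intro continuous_intros) auto
  qed
  fix e :: real assume e: "0 < e"
  obtain n where n: "\<And>\<zeta>. \<zeta> \<in> K \<Longrightarrow>
      norm (integral {0..2*pi} (\<lambda>t. J t \<zeta>) - (\<Sum>k<n. of_real (2*pi / real n) * J (2*pi * real k / real n) \<zeta>)) \<le> e"
    using uniform_riemann_sums[OF K cont _ e] by auto
  have eqJ: "of_real a * J \<theta> \<zeta> = - (of_real a * C \<theta>) * (1 / (\<zeta> - \<psi> (x \<theta>)))" for a \<theta> \<zeta>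
  proof -
    have "C \<theta> / (\<psi> (x \<theta>) - \<zeta>) = - (C \<theta> / (\<zeta> - \<psi> (x \<theta>)))"
      by (metis minus_diff_eq minus_divide_right)
    then show ?thesis
      by (simp add: J_def)
  qed
  let ?g = "\<lambda>z. \<Sum>k<n. of_real (2*pi / real n) * J (2*pi * real k / real n) (u z)"
  have "?g \<in> B"
    unfolding eqJ by (intro sum mult const poles \<psi>K)
  moreover have "norm (v (u z) - ?g z) \<le> e" if "z \<in> unit_disc" for z
  proof -
    have "u z \<in> K"
      using u(2) that by blast
    then show ?thesis
      using n[of "u z"] int[of "u z"] by simp
  qed
  ultimately show "\<exists>g\<in>B. \<forall>z\<in>unit_disc. norm (v (u z) - g z) \<le> e"
    by (intro bexI[of _ ?g] ballI)
qed

end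

section \<open>Density of the exponentials\<close>

text \<open>The quotient \<open>q = \<omega> / z\<close> is bounded by \<open>1\<close> and therefore satisfies \<open>\<bar>1 - q\<bar>\<^sup>2 \<le> 2 Re (1 - q)\<close>; the
  mean of the right hand side is its value at \<open>0\<close>. The parameter \<open>\<epsilon>\<close> passes from squares to first powers
  by \<open>x \<le> \<epsilon> + x\<^sup>2 / \<epsilon>\<close>.\<close>

lemma hardy_mean_id_minus_self_map:
  assumes \<omega>: "\<omega> holomorphic_on unit_disc" "\<omega> ` unit_disc \<subseteq> unit_disc" "\<omega> 0 = 0"
    and a: "deriv \<omega> 0 = of_real a" and p: "1 \<le> p" and \<epsilon>: "0 < \<epsilon>" and s: "0 < s" "s < 1"
  shows "hardy_mean p (\<lambda>z. z - \<omega> z) s \<le> 2 * pi * (2 powr p * (\<epsilon> + 2 * (1 - a) / \<epsilon>))"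
proof -
  obtain q where q: "q holomorphic_on unit_disc" "\<And>z. norm z < 1 \<Longrightarrow> \<omega> z = z * q z" "deriv \<omega> 0 = q 0"
    using Schwarz3[OF \<omega>(1,3)] by blast
  have lt: "norm (\<omega> z) < 1" if "norm z < 1" for z
    using image_subset_iff[THEN iffD1, OF \<omega>(2)] that by simp
  have q1: "norm (q z) \<le> 1" if "z \<in> unit_disc" for z
  proof (cases "z = 0")
    case True
    then show ?thesis
      using Schwarz_Lemma(2)[OF \<omega>(1,3) lt, of 0] q(3) by simp
  next
    case False
    have "norm (\<omega> z) \<le> norm z"
      using Schwarz_Lemma(1)[OF \<omega>(1,3) lt, of z] that by simp
    then show ?thesis
      using False q(2)[of z] that by (simp add: norm_mult)
  qed
  define V where "V z = of_real (2 powr p) * (of_real \<epsilon> + 2 * (1 - q z) / of_real \<epsilon>)" for z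
  have ReV: "Re (V z) = 2 powr p * (\<epsilon> + 2 * (1 - Re (q z)) / \<epsilon>)" for z
    unfolding V_def by (simp add: Re_divide_of_real)
  have "hardy_mean p (\<lambda>z. z - \<omega> z) s \<le> 2 * pi * Re (V 0)"
  proof (rule hardy_mean_le_Re)
    show "continuous_on (sphere 0 s) (\<lambda>z. z - \<omega> z)"
      using continuous_on_sphere_if_holomorphic[OF \<omega>(1) s(2)] by (intro continuous_intros)
    show "V holomorphic_on unit_disc"
      unfolding V_def using q(1) \<epsilon> by (intro holomorphic_intros) auto
    fix z :: complex assume "z \<in> sphere 0 s"
    then have z: "z \<in> unit_disc"
      using s by simp
    define x where "x = norm (1 - q z)"
    have x2: "x \<le> 2"
      unfolding x_def using norm_triangle_ineq4[of 1 "q z"] q1[OF z] by simp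
    have xsq: "x\<^sup>2 \<le> 2 * (1 - Re (q z))"
    proof -
      have "x\<^sup>2 = 1 - 2 * Re (q z) + (norm (q z))\<^sup>2"
        unfolding x_def cmod_power2 by (simp add: power2_eq_square algebra_simps)
      moreover have "(norm (q z))\<^sup>2 \<le> 1"
        using q1[OF z] by (simp add: power_le_one)
      ultimately show ?thesis
        by simp
    qed
    have x0: "0 \<le> x"
      by (simp add: x_def)
    have xe: "x \<le> \<epsilon> + x\<^sup>2 / \<epsilon>"
    proof (cases "x \<le> \<epsilon>")
      case False
      then have "x * \<epsilon> \<le> x\<^sup>2"
        using x0 by (simp add: power2_eq_square mult_left_mono)
      then have "x \<le> x\<^sup>2 / \<epsilon>"
        using \<epsilon> by (simp add: field_simps)
      then show ?thesis
        using \<epsilon> by simp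
    qed (use \<epsilon> in \<open>simp add: add_increasing2\<close>)
    have "norm (z - \<omega> z) = norm z * x"
      using q(2)[of z] z unfolding x_def by (simp add: norm_mult[symmetric] algebra_simps)
    also have "\<dots> \<le> 1 * x"
      using z x0 by (intro mult_right_mono) auto
    finally have "norm (z - \<omega> z) powr p \<le> x powr p"
      using p by (intro powr_mono2) auto
    also have "x powr p = 2 powr p * (x / 2) powr p"
      by (simp add: powr_divide)
    also have "\<dots> \<le> 2 powr p * (x / 2) powr 1"
      using x2 x0 p by (intro mult_left_mono powr_mono') auto
    also have "\<dots> \<le> 2 powr p * x"
      using x0 by simp
    also have "\<dots> \<le> 2 powr p * (\<epsilon> + x\<^sup>2 / \<epsilon>)"
      using xe by (intro mult_left_mono) auto
    also have "\<dots> \<le> 2 powr p * (\<epsilon> + 2 * (1 - Re (q z)) / \<epsilon>)"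
      using xsq \<epsilon> by (intro mult_left_mono add_left_mono divide_right_mono) auto
    finally show "norm (z - \<omega> z) powr p \<le> Re (V z)"
      unfolding ReV .
  qed (use s p in auto)
  also have "Re (V 0) = 2 powr p * (\<epsilon> + 2 * (1 - a) / \<epsilon>)"
    unfolding ReV q(3)[symmetric] a by simp
  finally show ?thesis .
qed

lemma deriv_compose_at_0:
  assumes "f holomorphic_on unit_disc" "g holomorphic_on unit_disc" "g 0 = 0"
    and "\<And>z. z \<in> unit_disc \<Longrightarrow> f (g z) = F z"
  shows "deriv F 0 = deriv f 0 * deriv g 0"
proof -
  have "(f has_field_derivative deriv f 0) (at (g 0))"
    unfolding assms(3) using holomorphic_derivI[OF assms(1) open_ball] by simp
  moreover have "(g has_field_derivative deriv g 0) (at 0)"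
    using holomorphic_derivI[OF assms(2) open_ball] by simp
  ultimately have "((\<lambda>z. f (g z)) has_field_derivative deriv f 0 * deriv g 0) (at 0)"
    using DERIV_chain2[of f "deriv f 0" g 0 "deriv g 0" UNIV] by blast
  then have "(F has_field_derivative deriv f 0 * deriv g 0) (at 0)"
    by (rule has_field_derivative_transform_within_open[OF _ open_ball[of 0 1]]) (use assms(4) in auto)
  then show ?thesis
    by (rule DERIV_imp_deriv)
qed

text \<open>Convergence of the Riemann maps \<open>\<psi>\<^sub>n\<close> of the outer domains to the Riemann map \<open>u\<close> of the inner
  domain, in the form needed here: the self-maps \<open>\<psi>\<^sub>n\<^sup>-\<^sup>1 \<circ> u\<close> have derivatives at \<open>0\<close> with modulus close
  to \<open>1\<close>. A limit of the \<open>\<psi>\<^sub>n\<close> is an open map with values in the closed set, hence in its interior, which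
  is the inner domain; the Schwarz lemma bounds its derivative by that of \<open>u\<close>.\<close>

lemma outer_riemann_maps_derivative:
  assumes u: "u holomorphic_on unit_disc" "inj_on u unit_disc"
    and int: "interior (closure (u ` unit_disc)) \<subseteq> u ` unit_disc"
    and G: "\<And>n. closure (u ` unit_disc) \<subseteq> G n" "\<And>n. G n \<subseteq> ball 0 R"
      "\<And>c. c \<notin> closure (u ` unit_disc) \<Longrightarrow> \<exists>e>0. \<exists>N. \<forall>n\<ge>N. ball c e \<inter> G n = {}"
    and v: "\<And>n. v n holomorphic_on G n" and \<psi>: "\<And>n. \<psi> n holomorphic_on unit_disc"
    and v0: "\<And>n::nat. v n (u 0) = 0"
    and v\<psi>: "\<And>n z. z \<in> G n \<Longrightarrow> v n z \<in> unit_disc \<and> \<psi> n (v n z) = z" "\<And>n x. x \<in> unit_disc \<Longrightarrow> \<psi> n x \<in> G n"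
    and b: "b < 1"
  shows "\<exists>n. b < norm (deriv (\<lambda>z. v n (u z)) 0)"
proof -
  let ?K = "closure (u ` unit_disc)"
  have uK: "u z \<in> ?K" if "z \<in> unit_disc" for z
    using that by (intro subsetD[OF closure_subset] imageI)
  define \<omega> where "\<omega> n z = v n (u z)" for n z
  have uG: "u z \<in> G n" if "z \<in> unit_disc" for n z
    using G(1) uK[OF that] by (rule subsetD)
  have \<omega>D: "\<omega> n z \<in> unit_disc" and \<psi>\<omega>: "\<psi> n (\<omega> n z) = u z" if "z \<in> unit_disc" for n z
    using v\<psi>(1)[OF uG[OF that, of n]] unfolding \<omega>_def by (rule conjunct1, rule conjunct2)
  have \<omega>0: "\<omega> n 0 = 0" for n
    by (simp add: \<omega>_def v0)
  have \<omega>hol: "\<omega> n holomorphic_on unit_disc" for n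
  proof -
    have "v n \<circ> u holomorphic_on unit_disc"
      using uG by (intro holomorphic_on_compose_gen[OF u(1) v] image_subsetI)
    then show ?thesis
      by (simp add: \<omega>_def[abs_def] o_def)
  qed
  have u'0: "deriv u 0 \<noteq> 0"
    using holomorphic_injective_imp_regular[OF u(1) open_ball u(2)] by simp
  have chain: "deriv u 0 = deriv (\<psi> n) 0 * deriv (\<omega> n) 0" for n
    by (rule deriv_compose_at_0[OF \<psi> \<omega>hol \<omega>0 \<psi>\<omega>])
  have le1: "norm (deriv (\<omega> n) 0) \<le> 1" for n
  proof -
    have "norm (\<omega> n z) < 1" if "norm z < 1" for z
      using \<omega>D[of z n] that by simp
    then show ?thesis
      using Schwarz_Lemma(2)[OF \<omega>hol \<omega>0, of n 0] by simp
  qed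
  have ge: "norm (deriv u 0) \<le> norm (deriv (\<psi> n) 0)" for n
    unfolding chain[of n] norm_mult using le1[of n] by (intro mult_left_le) auto
  obtain \<Psi> \<sigma> where \<Psi>: "\<Psi> holomorphic_on unit_disc" "strict_mono (\<sigma> :: nat \<Rightarrow> nat)"
    "\<And>x. x \<in> unit_disc \<Longrightarrow> (\<lambda>n. \<psi> (\<sigma> n) x) \<longlonglongrightarrow> \<Psi> x"
    "\<And>X. compact X \<Longrightarrow> X \<subseteq> unit_disc \<Longrightarrow> uniform_limit X (\<psi> \<circ> \<sigma>) \<Psi> sequentially"
  proof (rule Montel[of unit_disc "range \<psi>" \<psi>])
    show "\<exists>C. \<forall>h\<in>range \<psi>. \<forall>z\<in>X. norm (h z) \<le> C" if "X \<subseteq> unit_disc" for X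
    proof (intro exI[of _ R] ballI)
      fix h z assume h: "h \<in> range \<psi>" and z: "z \<in> X"
      obtain n where n: "h = \<psi> n"
        using h by blast
      have "h z \<in> ball 0 R"
        unfolding n using subsetD[OF G(2) v\<psi>(2)[OF subsetD[OF that z]]] .
      then show "norm (h z) \<le> R"
        by simp
    qed
  qed (use \<psi> in auto)
  have d\<Psi>: "(\<lambda>n. deriv (\<psi> (\<sigma> n)) 0) \<longlonglongrightarrow> deriv \<Psi> 0"
  proof -
    have ul: "uniform_limit (cball 0 (1/2)) (\<psi> \<circ> \<sigma>) \<Psi> sequentially"
      by (rule \<Psi>(4)) auto
    have ev: "\<forall>\<^sub>F n in sequentially. continuous_on (cball 0 (1/2)) ((\<psi> \<circ> \<sigma>) n) \<and>
        (\<forall>w\<in>ball 0 (1/2). ((\<psi> \<circ> \<sigma>) n has_field_derivative deriv (\<psi> (\<sigma> n)) w) (at w))"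
    proof (intro always_eventually allI conjI ballI)
      show "continuous_on (cball 0 (1/2)) ((\<psi> \<circ> \<sigma>) n)" for n
        unfolding o_def by (rule continuous_on_subset[OF holomorphic_on_imp_continuous_on[OF \<psi>]]) auto
      show "((\<psi> \<circ> \<sigma>) n has_field_derivative deriv (\<psi> (\<sigma> n)) w) (at w)" if "w \<in> ball 0 (1/2)" for n w
        unfolding o_def using holomorphic_derivI[OF \<psi> open_ball, of w] that by simp
    qed
    have half: "0 < (1/2 :: real)"
      by simp
    obtain g' where g': "\<And>w. w \<in> ball 0 (1/2) \<Longrightarrow>
        (\<Psi> has_field_derivative g' w) (at w) \<and> (\<lambda>n. deriv (\<psi> (\<sigma> n)) w) \<longlonglongrightarrow> g' w"
      by (rule has_complex_derivative_uniform_limit[OF ev ul sequentially_bot half]) blast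
    then have "deriv \<Psi> 0 = g' 0"
      using DERIV_imp_deriv[of \<Psi> "g' 0" 0] by simp
    then show ?thesis
      using g'[of 0] by simp
  qed
  have ge\<Psi>: "norm (deriv u 0) \<le> norm (deriv \<Psi> 0)"
    using tendsto_norm[OF d\<Psi>] by (rule LIMSEQ_le_const) (use ge in auto)
  have \<Psi>K: "\<Psi> ` unit_disc \<subseteq> ?K"
  proof safe
    fix x :: complex assume x: "x \<in> unit_disc"
    show "\<Psi> x \<in> ?K"
    proof (rule ccontr)
      assume "\<Psi> x \<notin> ?K"
      then obtain e N where e: "0 < e" "\<And>n. N \<le> n \<Longrightarrow> ball (\<Psi> x) e \<inter> G n = {}"
        using G(3) by metis
      have "\<forall>\<^sub>F n in sequentially. dist (\<psi> (\<sigma> n) x) (\<Psi> x) < e"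
        using tendstoD[OF \<Psi>(3)[OF x] e(1)] .
      then obtain M where M: "\<And>n. M \<le> n \<Longrightarrow> dist (\<psi> (\<sigma> n) x) (\<Psi> x) < e"
        unfolding eventually_sequentially by blast
      let ?n = "max M N"
      have "N \<le> \<sigma> ?n"
        using seq_suble[OF \<Psi>(2), of ?n] by simp
      moreover have "\<psi> (\<sigma> ?n) x \<in> ball (\<Psi> x) e"
        using M[of ?n] by (simp add: dist_commute)
      ultimately show False
        using e(2) v\<psi>(2)[OF x] by blast
    qed
  qed
  have "\<not> \<Psi> constant_on unit_disc"
  proof
    assume "\<Psi> constant_on unit_disc"
    then obtain c where "\<And>x. x \<in> unit_disc \<Longrightarrow> \<Psi> x = c"
      by (auto simp: constant_on_def)
    then have "(\<Psi> has_field_derivative 0) (at 0)"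
      by (intro has_field_derivative_transform_within_open[OF DERIV_const open_ball[of 0 1]]) auto
    then show False
      using DERIV_imp_deriv[of \<Psi> 0 0] ge\<Psi> u'0 by simp
  qed
  then have "open (\<Psi> ` unit_disc)"
    by (intro open_mapping_thm[OF \<Psi>(1)]) auto
  then have \<Psi>u: "\<Psi> ` unit_disc \<subseteq> u ` unit_disc"
    using \<Psi>K int interior_maximal by blast
  obtain k where k: "k holomorphic_on u ` unit_disc" "\<And>z. z \<in> unit_disc \<Longrightarrow> k (u z) = z"
    using holomorphic_has_inverse[OF u(1) open_ball u(2)] by metis
  define g where "g x = k (\<Psi> x)" for x
  have g_hol: "g holomorphic_on unit_disc"
    using holomorphic_on_compose_gen[OF \<Psi>(1) k(1) \<Psi>u] by (simp add: g_def[abs_def] o_def)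
  have gD: "g x \<in> unit_disc" "u (g x) = \<Psi> x" if x: "x \<in> unit_disc" for x
  proof -
    obtain z where "z \<in> unit_disc" "\<Psi> x = u z"
      using \<Psi>u x by blast
    then show "g x \<in> unit_disc" "u (g x) = \<Psi> x"
      using k(2) by (simp_all add: g_def)
  qed
  have "\<Psi> 0 = u 0"
  proof (rule LIMSEQ_unique[OF \<Psi>(3)])
    have "\<psi> (\<sigma> n) 0 = u 0" for n
      using \<psi>\<omega>[of 0 "\<sigma> n"] \<omega>0 by simp
    then show "(\<lambda>n. \<psi> (\<sigma> n) 0) \<longlonglongrightarrow> u 0"
      by simp
  qed simp
  then have g0: "g 0 = 0"
    using k(2)[of 0] by (simp add: g_def)
  have "norm (deriv g 0) \<le> 1"
  proof -
    have "norm (g z) < 1" if "norm z < 1" for z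
      using gD(1)[of z] that by simp
    then show ?thesis
      using Schwarz_Lemma(2)[OF g_hol g0, of 0] by simp
  qed
  moreover have "deriv \<Psi> 0 = deriv u 0 * deriv g 0"
    by (rule deriv_compose_at_0[OF u(1) g_hol g0 gD(2)])
  ultimately have "norm (deriv \<Psi> 0) \<le> norm (deriv u 0)"
    by (simp add: norm_mult mult_left_le)
  then have eq: "norm (deriv \<Psi> 0) = norm (deriv u 0)"
    using ge\<Psi> by simp
  have "(\<lambda>n. norm (deriv u 0) / norm (deriv (\<psi> (\<sigma> n)) 0)) \<longlonglongrightarrow> norm (deriv u 0) / norm (deriv \<Psi> 0)"
    using d\<Psi> eq u'0 by (intro tendsto_intros) auto
  moreover have "norm (deriv u 0) / norm (deriv (\<psi> (\<sigma> n)) 0) = norm (deriv (\<omega> (\<sigma> n)) 0)" for n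
  proof -
    have "deriv (\<psi> (\<sigma> n)) 0 \<noteq> 0"
      using chain[of "\<sigma> n"] u'0 by auto
    then show ?thesis
      unfolding chain[of "\<sigma> n"] norm_mult by simp
  qed
  ultimately have "(\<lambda>n. norm (deriv (\<omega> (\<sigma> n)) 0)) \<longlonglongrightarrow> 1"
    using eq u'0 by simp
  then have "\<forall>\<^sub>F n in sequentially. b < norm (deriv (\<omega> (\<sigma> n)) 0)"
    using b by (rule order_tendstoD)
  then obtain n where "b < norm (deriv (\<omega> (\<sigma> n)) 0)"
    unfolding eventually_sequentially by blast
  then show ?thesis
    unfolding \<omega>_def[abs_def] by blast
qed

context hardy_closed_algebra
begin

lemma identity_in_algebra:
  assumes u: "u holomorphic_on unit_disc" "inj_on u unit_disc" and bdd: "bounded (u ` unit_disc)"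
    and conn: "connected (- closure (u ` unit_disc))"
    and int: "interior (closure (u ` unit_disc)) \<subseteq> u ` unit_disc"
    and poles: "\<And>c. c \<notin> closure (u ` unit_disc) \<Longrightarrow> (\<lambda>z. 1 / (u z - c)) \<in> B"
  shows "(\<lambda>z. z) \<in> B"
proof -
  let ?K = "closure (u ` unit_disc)"
  have K: "compact ?K" "connected ?K" "?K \<noteq> {}"
    using bdd connected_continuous_image[OF holomorphic_on_imp_continuous_on[OF u(1)]]
    by (auto simp: compact_closure intro: connected_imp_connected_closure)
  have uK: "u z \<in> ?K" if "z \<in> unit_disc" for z
    using that by (intro subsetD[OF closure_subset] imageI)
  obtain G R where G: "\<And>n::nat. open (G n)" "\<And>n. simply_connected (G n)" "\<And>n. ?K \<subseteq> G n" "\<And>n. G n \<subseteq> ball 0 R"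
    "\<And>c. c \<notin> ?K \<Longrightarrow> \<exists>e>0. \<exists>N. \<forall>n\<ge>N. ball c e \<inter> G n = {}"
    using outer_simply_connected_domains[OF K conn] by blast
  have "\<exists>v \<psi>. v holomorphic_on G n \<and> \<psi> holomorphic_on unit_disc \<and> v (u 0) = 0 \<and>
    (\<forall>z\<in>G n. v z \<in> unit_disc \<and> \<psi> (v z) = z) \<and> (\<forall>x\<in>unit_disc. \<psi> x \<in> G n \<and> v (\<psi> x) = x)" for n
  proof -
    have "G n \<noteq> UNIV"
      using G(4)[of n] bounded_subset[OF bounded_ball] not_bounded_UNIV by metis
    moreover have "u 0 \<in> G n"
      using uK[of 0] G(3) by auto
    ultimately show ?thesis
      by (rule normalized_riemann_map[OF G(1,2)]) blast
  qed
  then obtain v \<psi> where v: "\<And>n. v n holomorphic_on G n" and \<psi>: "\<And>n. \<psi> n holomorphic_on unit_disc"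
    and v0: "\<And>n. v n (u 0) = 0"
    and v\<psi>: "\<And>n z. z \<in> G n \<Longrightarrow> v n z \<in> unit_disc \<and> \<psi> n (v n z) = z"
      "\<And>n x. x \<in> unit_disc \<Longrightarrow> \<psi> n x \<in> G n \<and> v n (\<psi> n x) = x"
    by metis
  have \<omega>B: "(\<lambda>z. v n (u z)) \<in> B" for n
    by (rule riemann_map_in_algebra[OF u(1) _ K(1) poles G(3) v \<psi> v\<psi>]) (use uK in auto)
  show ?thesis
  proof (rule mean_closed)
    show "bounded_holomorphic (\<lambda>z. z)"
      by (rule bounded_holomorphicI[of _ 1]) auto
    fix e :: real assume e: "0 < e"
    \<comment> \<open>the accuracy \<open>\<epsilon>\<^sup>2 / 2\<close> for the derivative makes the second term of the mean estimate at most \<open>\<epsilon>\<close>\<close>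
    define \<epsilon> where "\<epsilon> = e / (4 * pi * 2 powr p)"
    have \<epsilon>: "0 < \<epsilon>"
      using e by (simp add: \<epsilon>_def)
    obtain n where n: "1 - \<epsilon>\<^sup>2 / 2 < norm (deriv (\<lambda>z. v n (u z)) 0)"
      using outer_riemann_maps_derivative[OF u int G(3,4,5) v \<psi> v0 v\<psi>(1), of "1 - \<epsilon>\<^sup>2 / 2"] v\<psi>(2) \<epsilon> by auto
    define a where "a = norm (deriv (\<lambda>z. v n (u z)) 0)"
    define c where "c = (if deriv (\<lambda>z. v n (u z)) 0 = 0 then 1 else of_real a / deriv (\<lambda>z. v n (u z)) 0)"
    have c: "norm c = 1"
      by (auto simp: c_def a_def norm_divide)
    define \<omega> where "\<omega> z = c * v n (u z)" for z
    have \<omega>: "\<omega> \<in> B"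
      unfolding \<omega>_def by (intro mult const \<omega>B)
    have hol: "(\<lambda>z. v n (u z)) holomorphic_on unit_disc"
      using bounded[OF \<omega>B] by (simp add: bounded_holomorphic_def)
    have \<omega>_hol: "\<omega> holomorphic_on unit_disc"
      using bounded[OF \<omega>] by (simp add: bounded_holomorphic_def)
    have \<omega>_disc: "\<omega> ` unit_disc \<subseteq> unit_disc"
    proof safe
      fix z :: complex assume "z \<in> unit_disc"
      then have "v n (u z) \<in> unit_disc"
        using v\<psi>(1)[OF subsetD[OF G(3) uK]] by blast
      then show "\<omega> z \<in> unit_disc"
        using c by (simp add: \<omega>_def norm_mult)
    qed
    have "((\<lambda>z. v n (u z)) has_field_derivative deriv (\<lambda>z. v n (u z)) 0) (at 0)"
      using holomorphic_derivI[OF hol open_ball] by simp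
    then have "(\<omega> has_field_derivative c * deriv (\<lambda>z. v n (u z)) 0) (at 0)"
      unfolding \<omega>_def by (rule DERIV_cmult)
    then have "deriv \<omega> 0 = c * deriv (\<lambda>z. v n (u z)) 0"
      by (rule DERIV_imp_deriv)
    also have "\<dots> = of_real a"
      by (auto simp: c_def a_def)
    finally have a: "deriv \<omega> 0 = of_real a" .
    have "hardy_mean p (\<lambda>z. z - \<omega> z) s \<le> e" if s: "0 < s" "s < 1" for s
    proof -
      have "hardy_mean p (\<lambda>z. z - \<omega> z) s \<le> 2 * pi * (2 powr p * (\<epsilon> + 2 * (1 - a) / \<epsilon>))"
        using hardy_mean_id_minus_self_map[OF \<omega>_hol \<omega>_disc _ a p \<epsilon> s] v0 by (simp add: \<omega>_def)
      also have "2 * (1 - a) / \<epsilon> \<le> \<epsilon>"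
        using n \<epsilon> by (simp add: a_def pos_divide_le_eq power2_eq_square)
      then have "2 * pi * (2 powr p * (\<epsilon> + 2 * (1 - a) / \<epsilon>)) \<le> 2 * pi * (2 powr p * (\<epsilon> + \<epsilon>))"
        by (intro mult_left_mono add_left_mono) auto
      also have "\<dots> = e"
        by (simp add: \<epsilon>_def)
      finally show ?thesis .
    qed
    then show "\<exists>g\<in>B. \<forall>s. 0 < s \<and> s < 1 \<longrightarrow> hardy_mean p (\<lambda>z. z - g z) s \<le> e"
      using \<omega> by blast
  qed
qed

lemma dilation_in_algebra:
  assumes id: "(\<lambda>z. z) \<in> B" and f: "f holomorphic_on unit_disc" and r: "0 < r" "r < 1"
  shows "(\<lambda>z. f (of_real r * z)) \<in> B"
proof (rule uniformly_closed)
  have "1 \<le> 1 / r"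
    using r by simp
  then show "(\<lambda>z. f (of_real r * z)) holomorphic_on unit_disc"
    using r by (intro holomorphic_on_subset[OF holomorphic_dilate[OF f]] subset_ball)
  define a where "a n = (deriv ^^ n) f 0 / fact n" for n
  have sums: "(\<lambda>n. a n * w ^ n) sums f w" if "w \<in> unit_disc" for w
    using holomorphic_power_series[OF f that] by (simp add: a_def)
  define t where "t = (1 + r) / 2"
  have t: "r < t" "t < 1"
    using r by (auto simp: t_def)
  have "summable (\<lambda>n. a n * of_real t ^ n)"
    using sums[of "of_real t"] t r by (auto simp: sums_iff)
  then have "summable (\<lambda>n. norm (a n * of_real r ^ n))"
    by (rule powser_insidea) (use t r in auto)
  then have "uniform_limit (cball 0 r) (\<lambda>n w. \<Sum>i<n. a i * w ^ i) (\<lambda>w. \<Sum>i. a i * w ^ i) sequentially"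
  proof (rule Weierstrass_m_test[rotated])
    fix n and w :: complex assume "w \<in> cball 0 r"
    then show "norm (a n * w ^ n) \<le> norm (a n * of_real r ^ n)"
      using r by (simp add: norm_mult norm_power mult_left_mono power_mono)
  qed
  fix e :: real assume e: "0 < e"
  then have "\<forall>\<^sub>F n in sequentially. \<forall>w\<in>cball 0 r. dist (\<Sum>i<n. a i * w ^ i) (\<Sum>i. a i * w ^ i) < e"
    using \<open>uniform_limit _ _ _ _\<close> by (simp add: uniform_limit_iff)
  then obtain n where n: "\<And>w. w \<in> cball 0 r \<Longrightarrow> dist (\<Sum>i<n. a i * w ^ i) (\<Sum>i. a i * w ^ i) < e"
    unfolding eventually_sequentially by blast
  let ?g = "\<lambda>z. \<Sum>i<n. a i * (of_real r * z) ^ i"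
  have "?g \<in> B"
    by (intro sum mult const power id)
  moreover have "norm (f (of_real r * z) - ?g z) \<le> e" if z: "z \<in> unit_disc" for z
  proof -
    have w: "of_real r * z \<in> cball 0 r"
      using z r by (simp add: norm_mult mult_left_le)
    then have "of_real r * z \<in> unit_disc"
      using r by simp
    then show ?thesis
      using n[OF w] sums[of "of_real r * z"] by (simp add: sums_iff dist_norm norm_minus_commute)
  qed
  ultimately show "\<exists>g\<in>B. \<forall>z\<in>unit_disc. norm (f (of_real r * z) - g z) \<le> e"
    by (intro bexI[of _ ?g] ballI)
qed

end

text \<open>The inversion \<open>w \<mapsto> 1 / (w - w\<^sub>0)\<close> turns the domain into a bounded one and keeps the two topological
  hypotheses. The point \<open>0\<close>, the image of infinity, lies in the closure but not in its interior.\<close>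

lemma inverted_domain:
  fixes \<Omega> :: "complex set" and w0 :: complex
  defines "T \<equiv> \<lambda>w. 1 / (w - w0)"
  assumes lower: "\<Omega> \<subseteq> {w. \<beta> < Im w}" and w0: "Im w0 < \<beta>"
    and upper: "{w. b \<le> Im w} \<subseteq> \<Omega>"
    and int: "interior (closure \<Omega>) = \<Omega>" and conn: "connected (- closure \<Omega>)"
  shows "\<And>c. c \<notin> closure (T ` \<Omega>) \<Longrightarrow> c \<noteq> 0 \<and> w0 + 1 / c \<notin> closure \<Omega>"
    and "connected (- closure (T ` \<Omega>))"
    and "interior (closure (T ` \<Omega>)) \<subseteq> T ` \<Omega>"
proof -
  let ?K = "closure (T ` \<Omega>)"
  have "closure \<Omega> \<subseteq> {w. \<beta> \<le> Im w}"
    using lower by (intro closure_minimal) (auto simp: closed_halfspace_Im_ge)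
  then have cl: "\<beta> \<le> Im w" if "w \<in> closure \<Omega>" for w
    using that by blast
  have w0cl: "w0 \<notin> closure \<Omega>"
    using cl w0 by force
  have zero: "0 \<in> ?K"
    unfolding closure_approachable
  proof (intro allI impI)
    fix e :: real assume e: "0 < e"
    define y where "y = \<bar>b\<bar> + \<bar>Im w0\<bar> + 1 + 1 / e"
    have "0 < 1 / e"
      using e by simp
    then have y: "1 / e < y" "b \<le> Im w0 + y"
      unfolding y_def by linarith+
    then have y0: "0 < y"
      using e by (meson divide_pos_pos order_less_trans zero_less_one)
    have "w0 + \<i> * of_real y \<in> \<Omega>"
      using y upper by auto
    moreover have "dist (T (w0 + \<i> * of_real y)) 0 < e"
      using y y0 e by (simp add: T_def norm_divide norm_mult field_simps)
    ultimately show "\<exists>x\<in>T ` \<Omega>. dist x 0 < e"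
      by blast
  qed
  have Tcl: "T w \<in> ?K" if "w \<in> closure \<Omega>" for w
  proof -
    have "continuous_on (closure \<Omega>) T"
      unfolding T_def using w0cl by (intro continuous_intros) auto
    then have "T ` closure \<Omega> \<subseteq> ?K"
      by (rule image_closure_subset) (auto simp: closure_subset)
    then show ?thesis
      using that by blast
  qed
  show out: "c \<noteq> 0 \<and> w0 + 1 / c \<notin> closure \<Omega>" if c: "c \<notin> ?K" for c
    using Tcl[of "w0 + 1 / c"] c zero by (auto simp: T_def)
  have from_image: "w \<in> closure \<Omega>" if Tw: "T w \<in> ?K" and w: "w \<noteq> w0" for w
  proof -
    obtain x where x: "\<And>n. x n \<in> T ` \<Omega>" "x \<longlonglongrightarrow> T w"
      using Tw unfolding closure_sequential by blast
    have "T w \<noteq> 0"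
      using w by (simp add: T_def)
    then have "(\<lambda>n. w0 + 1 / x n) \<longlonglongrightarrow> w0 + 1 / T w"
      using x(2) by (intro tendsto_intros)
    moreover have "w0 + 1 / T w = w"
      by (simp add: T_def)
    moreover have "w0 + 1 / x n \<in> \<Omega>" for n
    proof -
      obtain y where "y \<in> \<Omega>" "x n = T y"
        using x(1) by blast
      then show ?thesis
        by (simp add: T_def)
    qed
    ultimately show ?thesis
      unfolding closure_sequential by (intro exI[of _ "\<lambda>n. w0 + 1 / x n"]) auto
  qed
  have "- ?K = T ` (- closure \<Omega> - {w0})"
  proof (intro equalityI subsetI)
    fix c assume "c \<in> - ?K"
    then have "c \<noteq> 0" "w0 + 1 / c \<notin> closure \<Omega>"
      using out by auto
    moreover have "c = T (w0 + 1 / c)"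
      by (simp add: T_def)
    ultimately show "c \<in> T ` (- closure \<Omega> - {w0})"
      by (intro image_eqI[of _ _ "w0 + 1 / c"]) auto
  qed (use from_image in auto)
  moreover have "continuous_on (- closure \<Omega> - {w0}) T"
    unfolding T_def by (intro continuous_intros) auto
  moreover have "connected (- closure \<Omega> - {w0})"
    using conn by (intro connected_open_delete) auto
  ultimately show "connected (- ?K)"
    using connected_continuous_image by metis
  show "interior ?K \<subseteq> T ` \<Omega>"
  proof
    fix x assume x: "x \<in> interior ?K"
    have "x \<noteq> 0"
    proof
      assume "x = 0"
      then obtain e where e: "0 < e" "ball 0 e \<subseteq> ?K"
        using x by (auto simp: mem_interior)
      let ?w = "w0 - \<i> / of_real (e / 2)"
      have Tw: "T ?w = \<i> * of_real (e / 2)"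
        using e by (simp add: T_def field_simps)
      have "norm (T ?w) < e"
        unfolding Tw norm_mult norm_of_real using e by simp
      then have "T ?w \<in> ball 0 e"
        by simp
      then have "?w \<in> closure \<Omega>"
        using e by (intro from_image) auto
      moreover have "Im ?w = Im w0 - 2 / e" "0 < 2 / e"
        using e by (simp_all add: Im_divide_of_real)
      then have "Im ?w < \<beta>"
        using w0 by linarith
      ultimately show False
        using cl[of ?w] by simp
    qed
    let ?V = "(- {w0}) \<inter> T -` interior ?K"
    have "open ?V"
      unfolding T_def by (intro continuous_open_preimage continuous_intros) auto
    moreover have "?V \<subseteq> closure \<Omega>"
      using from_image interior_subset by blast
    ultimately have "?V \<subseteq> \<Omega>"
      using int interior_maximal by blast
    moreover have "T (w0 + 1 / x) = x"
      by (simp add: T_def)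
    ultimately show "x \<in> T ` \<Omega>"
      using x \<open>x \<noteq> 0\<close> by (intro image_eqI[of _ _ "w0 + 1 / x"]) auto
  qed
qed

text \<open>The linear span of the bounded eigenfunctions \<open>e\<^sup>i\<^sup>a\<^sup>h\<close>, \<open>a \<ge> 0\<close>, of the composition operator.\<close>

inductive_set exp_span :: "(complex \<Rightarrow> complex) \<Rightarrow> (complex \<Rightarrow> complex) set" for h where
  exp: "0 \<le> a \<Longrightarrow> (\<lambda>z. c * exp (\<i> * of_real a * h z)) \<in> exp_span h"
| add: "f \<in> exp_span h \<Longrightarrow> g \<in> exp_span h \<Longrightarrow> (\<lambda>z. f z + g z) \<in> exp_span h"

lemma norm_exp_i_mult_le:
  assumes "0 \<le> a" "\<beta> \<le> Im w"
  shows "norm (exp (\<i> * of_real a * w)) \<le> exp (- (a * \<beta>))"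
  using assms by (simp add: norm_exp_eq_Re mult_left_mono)

lemma bounded_holomorphic_exp_span:
  assumes "h holomorphic_on unit_disc" "\<And>z. z \<in> unit_disc \<Longrightarrow> \<beta> < Im (h z)" "f \<in> exp_span h"
  shows "bounded_holomorphic f"
  using assms(3)
proof induction
  case (exp a c)
  show ?case
  proof (rule bounded_holomorphicI)
    show "(\<lambda>z. c * exp (\<i> * of_real a * h z)) holomorphic_on unit_disc"
      using assms(1) by (intro holomorphic_intros)
    show "norm (c * exp (\<i> * of_real a * h z)) \<le> norm c * exp (- (a * \<beta>))" if "z \<in> unit_disc" for z
      unfolding norm_mult[of c] using exp assms(2)[OF that]
      by (intro mult_left_mono norm_exp_i_mult_le) auto
  qed
qed (rule bounded_holomorphic_add)

lemma exp_span_mult: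
  assumes "f \<in> exp_span h" "g \<in> exp_span h"
  shows "(\<lambda>z. f z * g z) \<in> exp_span h"
  using assms(1)
proof induction
  case (exp a c)
  show ?case
    using assms(2)
  proof induction
    case (exp b d)
    have "(\<lambda>z. c * exp (\<i> * of_real a * h z) * (d * exp (\<i> * of_real b * h z)))
        = (\<lambda>z. (c * d) * exp (\<i> * of_real (a + b) * h z))"
      by (simp add: exp_add[symmetric] algebra_simps)
    then show ?case
      using exp_span.exp[of "a + b" "c * d" h] exp \<open>0 \<le> a\<close> by simp
  next
    case (add f g)
    then show ?case
      using exp_span.add by (simp add: distrib_left)
  qed
next
  case (add f g)
  then show ?case
    using exp_span.add by (simp add: distrib_right)
qed

lemma function_algebra_exp_span:
  assumes "h holomorphic_on unit_disc" "\<And>z. z \<in> unit_disc \<Longrightarrow> \<beta> < Im (h z)"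
  shows "function_algebra (exp_span h)"
  unfolding function_algebra_def
  using bounded_holomorphic_exp_span[OF assms] exp_span.exp[of 0 _ h] exp_span.add exp_span_mult by simp

lemma hardy_closure_superset:
  assumes "function_algebra S"
  shows "S \<subseteq> hardy_closure p S"
  using assms by (auto simp: hardy_closure_def function_algebra_def intro!: bexI[of _ f for f])

lemma hardy_closure_trans:
  assumes S: "function_algebra S" and p: "1 \<le> p" and f: "f holomorphic_on unit_disc" and e: "0 < e"
    and approx: "\<And>e. 0 < e \<Longrightarrow> \<exists>g\<in>hardy_closure p S. \<forall>s. 0 < s \<and> s < 1 \<longrightarrow> hardy_mean p (\<lambda>z. f z - g z) s \<le> e"
  shows "\<exists>g\<in>S. \<forall>s. 0 < s \<and> s < 1 \<longrightarrow> hardy_mean p (\<lambda>z. f z - g z) s \<le> e"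
proof -
  define e' where "e' = e / (2 * 2 powr p)"
  have e': "0 < e'"
    using e by (simp add: e'_def)
  obtain g where g: "g \<in> hardy_closure p S" "\<And>s. 0 < s \<Longrightarrow> s < 1 \<Longrightarrow> hardy_mean p (\<lambda>z. f z - g z) s \<le> e'"
    using approx[OF e'] by blast
  obtain k where k: "k \<in> S" "\<And>s. 0 < s \<Longrightarrow> s < 1 \<Longrightarrow> hardy_mean p (\<lambda>z. g z - k z) s \<le> e'"
    by (rule hardy_closure_approx[OF g(1) e']) blast
  have "hardy_mean p (\<lambda>z. f z - k z) s \<le> e" if s: "0 < s" "s < 1" for s
  proof -
    have "bounded_holomorphic g" "bounded_holomorphic k"
      using g(1) k(1) S by (auto simp: hardy_closure_def function_algebra_def)
    then have c: "continuous_on (sphere 0 s) f" "continuous_on (sphere 0 s) g" "continuous_on (sphere 0 s) k"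
      using bounded_holomorphic_cont_sphere[OF _ s(2)] continuous_on_sphere_if_holomorphic[OF f s(2)] by auto
    have "hardy_mean p (\<lambda>z. f z - k z) s = hardy_mean p (\<lambda>z. (f z - g z) + (g z - k z)) s"
      by simp
    also have "\<dots> \<le> 2 powr p * (hardy_mean p (\<lambda>z. f z - g z) s + hardy_mean p (\<lambda>z. g z - k z) s)"
      using c s p by (intro hardy_mean_sum_le) (auto intro!: continuous_intros)
    also have "\<dots> \<le> 2 powr p * (e' + e')"
      using g k s by (intro mult_left_mono add_mono) auto
    also have "\<dots> = e"
      by (simp add: e'_def)
    finally show ?thesis .
  qed
  then show ?thesis
    using k(1) by blast
qed

lemma hardy_closed_algebra_hardy_closure:
  assumes S: "function_algebra S" and p: "1 \<le> p"
  shows "hardy_closed_algebra p (hardy_closure p S)"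
proof
  show "hardy_closure p (hardy_closure p S) \<subseteq> hardy_closure p S"
  proof
    fix f assume f: "f \<in> hardy_closure p (hardy_closure p S)"
    then have "bounded_holomorphic f" "f holomorphic_on unit_disc"
      by (auto simp: hardy_closure_def bounded_holomorphic_def)
    moreover have "\<exists>g\<in>S. \<forall>s. 0 < s \<and> s < 1 \<longrightarrow> hardy_mean p (\<lambda>z. f z - g z) s \<le> e" if "0 < e" for e
      by (rule hardy_closure_trans[OF S p \<open>f holomorphic_on unit_disc\<close> that]) (use f in \<open>auto simp: hardy_closure_def\<close>)
    ultimately show "f \<in> hardy_closure p S"
      by (simp add: hardy_closure_def)
  qed
qed (use p function_algebra_hardy_closure[OF S p] in auto)

text \<open>Functions of the Hardy space are approximated by dilations, dilations by polynomials, and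
  polynomials by exponentials, because the identity lies in the closed algebra generated by them.\<close>

lemma exp_span_dense:
  assumes h: "h holomorphic_on unit_disc" "inj_on h unit_disc"
    and lower: "h ` unit_disc \<subseteq> {w. \<beta> < Im w}" and upper: "{w. b \<le> Im w} \<subseteq> h ` unit_disc"
    and int: "interior (closure (h ` unit_disc)) = h ` unit_disc"
    and conn: "connected (- closure (h ` unit_disc))" and p: "1 \<le> p"
    and f: "f holomorphic_on unit_disc" and N: "\<And>s. 0 < s \<Longrightarrow> s < 1 \<Longrightarrow> hardy_mean p f s \<le> N" and e: "0 < e"
  shows "\<exists>g\<in>exp_span h. \<forall>s. 0 < s \<and> s < 1 \<longrightarrow> hardy_mean p (\<lambda>z. f z - g z) s \<le> e"
proof -
  have half: "\<beta> < Im (h z)" if "z \<in> unit_disc" for z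
    using lower that by blast
  let ?B = "hardy_closure p (exp_span h)"
  have alg: "function_algebra (exp_span h)"
    by (rule function_algebra_exp_span[OF h(1) half])
  interpret hardy_closed_algebra p ?B
    by (rule hardy_closed_algebra_hardy_closure[OF alg p])
  have E: "(\<lambda>z. exp (\<i> * of_real a * h z)) \<in> ?B" if "0 \<le> a" for a
    using hardy_closure_superset[OF alg] exp_span.exp[OF that, of 1 h] by auto
  define w0 where "w0 = \<i> * of_real (\<beta> - 1)"
  have w0: "Im w0 < \<beta>"
    by (simp add: w0_def)
  have w0B: "(\<lambda>z. 1 / (h z - w0)) \<in> ?B"
    by (rule resolvent_below_half_plane[OF h(1) half E w0])
  have "closure (h ` unit_disc) \<subseteq> {w. \<beta> \<le> Im w}"
    using lower by (intro closure_minimal) (auto simp: closed_halfspace_Im_ge)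
  then have w0cl: "w0 \<notin> closure (h ` unit_disc)"
    using w0 by force
  have nz: "h z - w0 \<noteq> 0" if "z \<in> unit_disc" for z
    using half[OF that] w0 by auto
  define u where "u z = 1 / (h z - w0)" for z
  have img: "u ` unit_disc = (\<lambda>w. 1 / (w - w0)) ` (h ` unit_disc)"
    by (simp add: u_def image_image)
  note inv = inverted_domain[OF lower w0 upper int conn, folded img]
  have "(\<lambda>z. z) \<in> ?B"
  proof (rule identity_in_algebra)
    show "u holomorphic_on unit_disc"
      unfolding u_def using h(1) nz by (intro holomorphic_intros) auto
    show "inj_on u unit_disc"
    proof (rule inj_onI)
      fix x y assume "x \<in> unit_disc" "y \<in> unit_disc" "u x = u y"
      then show "x = y"
        using inj_onD[OF h(2)] nz by (simp add: u_def)
    qed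
    have "norm (u z) \<le> 1" if "z \<in> unit_disc" for z
    proof -
      have "1 \<le> \<bar>Im (h z - w0)\<bar>"
        using half[OF that] by (simp add: w0_def)
      then have "1 \<le> norm (h z - w0)"
        using abs_Im_le_cmod[of "h z - w0"] by linarith
      then show ?thesis
        by (simp add: u_def norm_divide divide_le_eq)
    qed
    then show "bounded (u ` unit_disc)"
      unfolding bounded_iff by blast
    show "connected (- closure (u ` unit_disc))" "interior (closure (u ` unit_disc)) \<subseteq> u ` unit_disc"
      by (rule inv)+
    show "(\<lambda>z. 1 / (u z - c)) \<in> ?B" if "c \<notin> closure (u ` unit_disc)" for c
    proof -
      define w where "w = w0 + 1 / c"
      have c: "c \<noteq> 0" "w \<notin> closure (h ` unit_disc)"
        using inv(1)[OF that] by (auto simp: w_def)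
      have "(\<lambda>z. - (1 / c) + - (1 / c\<^sup>2) * (1 / (h z - w))) \<in> ?B"
        by (intro add mult const resolvent_pole_pushing[OF h(1) conn w0cl w0B c(2)])
      then show ?thesis
      proof (rule cong)
        fix z :: complex assume z: "z \<in> unit_disc"
        have "h z \<in> closure (h ` unit_disc)"
          using z by (intro subsetD[OF closure_subset] imageI)
        then have "h z - w \<noteq> 0"
          using c(2) by auto
        moreover define t where "t = h z - w0"
        have "h z - w = t - 1 / c"
          by (simp add: t_def w_def)
        ultimately have "t - 1 / c \<noteq> 0"
          by simp
        then have tc: "c * t - 1 \<noteq> 0"
          using c(1) by (auto simp: field_simps)
        have "t \<noteq> 0"
          using nz[OF z] by (simp add: t_def)
        then have "1 / (u z - c) = t / (1 - c * t)"
          by (simp add: u_def t_def[symmetric] field_simps)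
        also have "\<dots> = - (1 / c) + - (1 / c\<^sup>2) * (1 / (t - 1 / c))"
        proof -
          have "t - 1 / c = (c * t - 1) / c"
            using c(1) by (simp add: field_simps)
          moreover have "1 - c * t = - (c * t - 1)"
            by simp
          ultimately show ?thesis
            using tc c(1) by (simp add: divide_simps power2_eq_square) (simp add: algebra_simps)
        qed
        finally show "1 / (u z - c) = - (1 / c) + - (1 / c\<^sup>2) * (1 / (h z - w))"
          using \<open>h z - w = t - 1 / c\<close> by simp
      qed
    qed
  qed
  then have dil: "(\<lambda>z. f (of_real r * z)) \<in> ?B" if "0 < r" "r < 1" for r
    using dilation_in_algebra[OF _ f that] by blast
  show ?thesis
  proof (rule hardy_closure_trans[OF alg p f e])
    fix e' :: real assume e': "0 < e'"
    obtain r where r: "0 < r" "r < 1" "\<And>s. 0 < s \<Longrightarrow> s < 1 \<Longrightarrow> hardy_mean p (\<lambda>z. f z - f (of_real r * z)) s \<le> e'"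
      using dilations_converge[OF f p N e'] by blast
    then show "\<exists>g\<in>?B. \<forall>s. 0 < s \<and> s < 1 \<longrightarrow> hardy_mean p (\<lambda>z. f z - g z) s \<le> e'"
      by (intro bexI[OF _ dil[OF r(1,2)]]) blast
  qed
qed

section \<open>Extended eigenvalues\<close>

definition zero_extension :: "(complex \<Rightarrow> complex) \<Rightarrow> complex \<Rightarrow> complex" where
  "zero_extension f = (\<lambda>z. if z \<in> unit_disc then f z else 0)"

lemma hardy_mean_zero_extension:
  assumes "0 < s" "s < 1"
  shows "hardy_mean p (\<lambda>z. f z - zero_extension g z) s = hardy_mean p (\<lambda>z. f z - g z) s"
  using assms by (intro hardy_mean_cong) (auto simp: zero_extension_def)

lemma hardy_spaceD:
  assumes "f \<in> hardy_space p"
  shows "f holomorphic_on unit_disc" "\<And>z. z \<notin> unit_disc \<Longrightarrow> f z = 0"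
    "\<And>s. 0 < s \<Longrightarrow> s < 1 \<Longrightarrow> hardy_mean p f s \<le> (SUP r\<in>{0<..<1}. hardy_mean p f r)"
  using assms unfolding hardy_space_def by (auto intro!: cSUP_upper)

lemma hardy_spaceI:
  assumes "f holomorphic_on unit_disc" "\<And>z. z \<notin> unit_disc \<Longrightarrow> f z = 0"
    "\<And>s. 0 < s \<Longrightarrow> s < 1 \<Longrightarrow> hardy_mean p f s \<le> N"
  shows "f \<in> hardy_space p"
  using assms unfolding hardy_space_def by (auto intro!: bdd_aboveI[of _ N])

lemma hardy_norm_le:
  assumes "\<And>s. 0 < s \<Longrightarrow> s < 1 \<Longrightarrow> hardy_mean p f s \<le> N" "1 \<le> p"
  shows "hardy_norm p f \<le> N powr (1 / p)"
proof -
  have bdd: "bdd_above (hardy_mean p f ` {0<..<1})"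
    using assms(1) by (auto intro!: bdd_aboveI[of _ N])
  have "(SUP r\<in>{0<..<1}. hardy_mean p f r) \<le> N"
    using assms(1) by (intro cSUP_least) auto
  moreover have "hardy_mean p f (1/2) \<le> (SUP r\<in>{0<..<1}. hardy_mean p f r)"
    using bdd by (intro cSUP_upper) auto
  ultimately show ?thesis
    unfolding hardy_norm_def using hardy_mean_nonneg[of p f "1/2"] assms(2)
    by (intro powr_mono2) auto
qed

lemma hardy_norm_eq_0_imp:
  assumes f: "f \<in> hardy_space p" and p: "1 \<le> p" and n: "hardy_norm p f = 0"
  shows "f = (\<lambda>z. 0)"
proof
  fix z
  have "(SUP r\<in>{0<..<1}. hardy_mean p f r) = 0"
    using n by (simp add: hardy_norm_def)
  then have zero: "hardy_mean p f s = 0" if "0 < s" "s < 1" for s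
    using hardy_spaceD(3)[OF f that] hardy_mean_nonneg[of p f s] by simp
  have nonzero: "f z = 0" if "z \<noteq> 0" for z
  proof (cases "z \<in> unit_disc")
    case True
    then show ?thesis
      using hardy_mean_eq_0[of z f p] zero[of "norm z"] that p
        continuous_on_sphere_if_holomorphic[OF hardy_spaceD(1)[OF f], of "norm z"] by simp
  qed (use hardy_spaceD(2)[OF f] in auto)
  show "f z = 0"
  proof (cases "z = 0")
    case True
    have "f 0 = 0"
    proof (rule analytic_continuation_open[of "unit_disc - {0}" unit_disc f "\<lambda>z. 0" 0])
      have "1/2 \<in> unit_disc - {0 :: complex}"
        by simp
      then show "unit_disc - {0 :: complex} \<noteq> {}"
        by blast
    qed (use nonzero hardy_spaceD(1)[OF f] in auto)
    then show ?thesis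
      using True by simp
  qed (rule nonzero)
qed

lemma zero_extension_in_hardy_space:
  assumes "bounded_holomorphic f" "1 \<le> p"
  shows "zero_extension f \<in> hardy_space p"
proof -
  obtain M where M: "\<And>z. z \<in> unit_disc \<Longrightarrow> norm (f z) \<le> M"
    using assms(1) unfolding bounded_holomorphic_def by blast
  have hol: "zero_extension f holomorphic_on unit_disc"
    using assms(1) unfolding bounded_holomorphic_def zero_extension_def
    by (auto intro: holomorphic_transform[of f])
  show ?thesis
  proof (rule hardy_spaceI[OF hol])
    fix s :: real assume s: "0 < s" "s < 1"
    show "hardy_mean p (zero_extension f) s \<le> 2 * pi * M powr p"
    proof (rule hardy_mean_le_const)
      show "continuous_on (sphere 0 s) (zero_extension f)"
        by (rule continuous_on_sphere_if_holomorphic[OF hol s(2)])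
    qed (use s assms(2) M in \<open>auto simp: zero_extension_def\<close>)
  qed (simp add: zero_extension_def)
qed

lemma hardy_space_diff:
  assumes f: "f \<in> hardy_space p" and g: "g \<in> hardy_space p" and p: "1 \<le> p"
  shows "(\<lambda>z. f z + (- 1) * g z) \<in> hardy_space p"
proof (rule hardy_spaceI)
  show hol: "(\<lambda>z. f z + (- 1) * g z) holomorphic_on unit_disc"
    using hardy_spaceD(1)[OF f] hardy_spaceD(1)[OF g] by (intro holomorphic_intros)
  show "f z + (- 1) * g z = 0" if "z \<notin> unit_disc" for z
    using hardy_spaceD(2)[OF f that] hardy_spaceD(2)[OF g that] by simp
  fix s :: real assume s: "0 < s" "s < 1"
  have c: "continuous_on (sphere 0 s) f" "continuous_on (sphere 0 s) g"
    using continuous_on_sphere_if_holomorphic s hardy_spaceD(1) f g by blast+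
  have neg: "hardy_mean p (\<lambda>z. (- 1) * g z) s = hardy_mean p g s"
    by (simp add: hardy_mean_def)
  have "hardy_mean p (\<lambda>z. f z + (- 1) * g z) s \<le> 2 powr p * (hardy_mean p f s + hardy_mean p (\<lambda>z. (- 1) * g z) s)"
    using c s p by (intro hardy_mean_sum_le) (auto intro!: continuous_intros)
  also have "\<dots> \<le> 2 powr p * ((SUP r\<in>{0<..<1}. hardy_mean p f r) + (SUP r\<in>{0<..<1}. hardy_mean p g r))"
    unfolding neg using hardy_spaceD(3)[OF f s] hardy_spaceD(3)[OF g s] by (intro mult_left_mono add_mono) auto
  finally show "hardy_mean p (\<lambda>z. f z + (- 1) * g z) s
      \<le> 2 powr p * ((SUP r\<in>{0<..<1}. hardy_mean p f r) + (SUP r\<in>{0<..<1}. hardy_mean p g r))" .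
qed

lemma bounded_operator_vanishes_if_dense_kernel:
  assumes A: "bounded_operator (hardy_space p) (hardy_norm p) A" and p: "1 \<le> p"
    and f: "f \<in> hardy_space p"
    and dense: "\<And>e. 0 < e \<Longrightarrow> \<exists>g. bounded_holomorphic g \<and> A (zero_extension g) = (\<lambda>z. 0) \<and>
      (\<forall>s. 0 < s \<and> s < 1 \<longrightarrow> hardy_mean p (\<lambda>z. f z - g z) s \<le> e)"
  shows "A f = (\<lambda>z. 0)"
proof (rule hardy_norm_eq_0_imp[OF _ p])
  show "A f \<in> hardy_space p"
    using A f by (simp add: bounded_operator_def)
  obtain K where K: "\<And>f. f \<in> hardy_space p \<Longrightarrow> hardy_norm p (A f) \<le> K * hardy_norm p f"
    using A unfolding bounded_operator_def by blast
  have le: "hardy_norm p (A f) \<le> \<bar>K\<bar> * e" if e: "0 < e" for e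
  proof -
    have "0 < e powr p"
      using e by simp
    then obtain g where g: "bounded_holomorphic g" "A (zero_extension g) = (\<lambda>z. 0)"
      "\<And>s. 0 < s \<Longrightarrow> s < 1 \<Longrightarrow> hardy_mean p (\<lambda>z. f z - g z) s \<le> e powr p"
      using dense by blast
    let ?g = "zero_extension g"
    have gH: "?g \<in> hardy_space p"
      by (rule zero_extension_in_hardy_space[OF g(1) p])
    let ?d = "\<lambda>z. f z + (- 1) * ?g z"
    have dH: "?d \<in> hardy_space p"
      by (rule hardy_space_diff[OF f gH p])
    have "(\<lambda>z. ?d z + ?g z) = f"
      by simp
    then have "A f = (\<lambda>z. A ?d z + A ?g z)"
      using A dH gH unfolding bounded_operator_def by metis
    then have "A f = A ?d"
      using g(2) by simp
    then have "hardy_norm p (A f) \<le> K * hardy_norm p ?d"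
      using K[OF dH] by simp
    also have "\<dots> \<le> \<bar>K\<bar> * hardy_norm p ?d"
      by (intro mult_right_mono) (auto simp: hardy_norm_def)
    also have "hardy_norm p ?d \<le> (e powr p) powr (1 / p)"
    proof (rule hardy_norm_le[OF _ p])
      fix s :: real assume s: "0 < s" "s < 1"
      have "hardy_mean p ?d s = hardy_mean p (\<lambda>z. f z - ?g z) s"
        by simp
      then show "hardy_mean p ?d s \<le> e powr p"
        using g(3)[OF s] hardy_mean_zero_extension[OF s, of p f g] by simp
    qed
    then have "\<bar>K\<bar> * hardy_norm p ?d \<le> \<bar>K\<bar> * e"
      using e p by (intro mult_left_mono) (auto simp: powr_powr)
    finally show ?thesis .
  qed
  have "hardy_norm p (A f) \<le> 0"
  proof (rule field_le_epsilon)
    fix e :: real assume e: "0 < e"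
    have "\<bar>K\<bar> * (e / (\<bar>K\<bar> + 1)) \<le> e"
      using e by (simp add: field_simps)
    moreover have "0 < e / (\<bar>K\<bar> + 1)"
      using e by (simp add: add_nonneg_pos)
    ultimately show "hardy_norm p (A f) \<le> 0 + e"
      using le by fastforce
  qed
  then show "hardy_norm p (A f) = 0"
    by (simp add: hardy_norm_def)
qed

lemma bounded_operator_multiplication:
  assumes g: "g holomorphic_on unit_disc" and M: "0 < M" "\<And>z. z \<in> unit_disc \<Longrightarrow> norm (g z) \<le> M" and p: "1 \<le> p"
  shows "bounded_operator (hardy_space p) (hardy_norm p) (\<lambda>f z. g z * f z)"
  unfolding bounded_operator_def
proof (intro conjI ballI allI exI)
  let ?S = "\<lambda>f. SUP r\<in>{0<..<1}. hardy_mean p f r"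
  have mean: "hardy_mean p (\<lambda>z. g z * f z) s \<le> M powr p * ?S f" if f: "f \<in> hardy_space p" and s: "0 < s" "s < 1" for f s
  proof -
    have "hardy_mean p (\<lambda>z. g z * f z) s \<le> M powr p * hardy_mean p f s"
      using continuous_on_sphere_if_holomorphic[OF g s(2)]
        continuous_on_sphere_if_holomorphic[OF hardy_spaceD(1)[OF f] s(2)] s p M
      by (intro hardy_mean_mult_le) auto
    also have "\<dots> \<le> M powr p * ?S f"
      using hardy_spaceD(3)[OF f s] by (intro mult_left_mono) auto
    finally show ?thesis .
  qed
  fix f assume f: "f \<in> hardy_space p"
  show "(\<lambda>z. g z * f z) \<in> hardy_space p"
  proof (rule hardy_spaceI[OF _ _ mean[OF f]])
    show "(\<lambda>z. g z * f z) holomorphic_on unit_disc"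
      using g hardy_spaceD(1)[OF f] by (intro holomorphic_intros)
  qed (use hardy_spaceD(2)[OF f] in auto)
  have "hardy_norm p (\<lambda>z. g z * f z) \<le> (M powr p * ?S f) powr (1 / p)"
    using mean[OF f] p by (rule hardy_norm_le)
  also have "\<dots> = M * hardy_norm p f"
    using M p by (simp add: powr_mult powr_powr hardy_norm_def)
  finally show "hardy_norm p (\<lambda>z. g z * f z) \<le> M * hardy_norm p f" .
qed (simp_all add: algebra_simps)

theorem theorem4p11:
  fixes \<phi> :: "complex \<Rightarrow> complex" and \<Phi> :: "real \<Rightarrow> complex \<Rightarrow> complex"
    and h :: "complex \<Rightarrow> complex" and \<Omega> :: "complex set" and p \<eta> :: real
  assumes "holomorphic_self_map \<phi>"
    and "parabolic_semiflow \<Phi>"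
    and "\<forall>z\<in>unit_disc. \<phi> z = \<Phi> 1 z"
    and "koenigs_function \<Phi> h"
    and "\<Omega> = h ` unit_disc"
    and "\<eta> > 0" and "\<Omega> \<subseteq> {w. Im w > - \<eta>}"
    and "\<exists>a b. a < b \<and> frontier \<Omega> \<subseteq> horizontal_strip a b"
    and "interior (closure \<Omega>) = \<Omega>"
    and "connected (- closure \<Omega>)"
    and "1 \<le> p"
  shows "extended_eigenvalues (hardy_space p) (hardy_norm p) (composition_operator \<phi>) = sphere 0 1"
proof -
  note p = \<open>1 \<le> p\<close> and \<Omega> = \<open>\<Omega> = h ` unit_disc\<close>
  have h: "h holomorphic_on unit_disc" "inj_on h unit_disc"
    using assms(4) by (auto simp: koenigs_function_def)
  have lower: "h ` unit_disc \<subseteq> {w. - \<eta> < Im w}"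
    using assms(7) \<Omega> by simp
  then have half: "- \<eta> < Im (h z)" if "z \<in> unit_disc" for z
    using that by blast
  obtain a b where "frontier (h ` unit_disc) \<subseteq> horizontal_strip a b"
    using assms(8) \<Omega> by blast
  then have upper: "{w. b \<le> Im w} \<subseteq> h ` unit_disc"
    by (rule koenigs_domain_contains_half_plane[OF assms(2,4) lower])
  have \<phi>D: "\<phi> z \<in> unit_disc" if "z \<in> unit_disc" for z
    using assms(1) that by (auto simp: holomorphic_self_map_def image_subset_iff)
  have h\<phi>: "h (\<phi> z) = h z + 1" if "z \<in> unit_disc" for z
    using koenigs_translate[OF assms(4) _ that, of 1] assms(3) that by simp
  let ?T = "composition_operator \<phi>"
  define g where "g a = zero_extension (\<lambda>z. exp (\<i> * of_real a * h z))" for a :: real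
  have bound: "bounded_holomorphic (\<lambda>z. exp (\<i> * of_real a * h z))" if "0 \<le> a" for a
    using bounded_holomorphic_exp_span[OF h(1) half exp_span.exp[OF that, of 1]] by simp
  have gH: "g a \<in> hardy_space p" if "0 \<le> a" for a
    unfolding g_def by (rule zero_extension_in_hardy_space[OF bound[OF that] p])
  have g\<phi>: "g a (\<phi> z) = cis a * g a z" if "z \<in> unit_disc" for a z
    using that \<phi>D[OF that] h\<phi>[OF that]
    by (simp add: g_def zero_extension_def cis_conv_exp exp_add[symmetric] algebra_simps)
  have Tg: "?T (g a) = (\<lambda>z. cis a * g a z)" for a
  proof
    fix z show "?T (g a) z = cis a * g a z"
      using g\<phi>[of z a] by (simp add: composition_operator_def) (simp add: g_def zero_extension_def)
  qed
  show ?thesis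
  proof (intro equalityI subsetI)
    fix \<mu> assume "\<mu> \<in> extended_eigenvalues (hardy_space p) (hardy_norm p) ?T"
    then obtain A f0 where A: "bounded_operator (hardy_space p) (hardy_norm p) A"
      and f0: "f0 \<in> hardy_space p" "A f0 \<noteq> (\<lambda>z. 0)"
      and TA: "\<And>f. f \<in> hardy_space p \<Longrightarrow> ?T (A f) = (\<lambda>z. \<mu> * A (?T f) z)"
      unfolding extended_eigenvalues_def by blast
    show "\<mu> \<in> sphere 0 1"
    proof (rule ccontr)
      assume \<mu>: "\<mu> \<notin> sphere 0 1"
      have Ag: "A (g a) = (\<lambda>z. 0)" if a: "0 \<le> a" for a
      proof
        fix z
        have AH: "A (g a) \<in> hardy_space p"
          using A gH[OF a] by (simp add: bounded_operator_def)
        have "A (?T (g a)) = (\<lambda>z. cis a * A (g a) z)"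
          unfolding Tg using A gH[OF a] by (simp add: bounded_operator_def)
        then have eig: "?T (A (g a)) = (\<lambda>z. \<mu> * (cis a * A (g a) z))"
          using TA[OF gH[OF a]] by simp
        let ?N = "SUP r\<in>{0<..<1}. hardy_mean p (A (g a)) r"
        show "A (g a) z = 0"
        proof (cases "z \<in> unit_disc")
          case True
          show ?thesis
          proof (rule composition_eigenfunction_vanishes[OF h upper \<phi>D h\<phi> hardy_spaceD(1)[OF AH] _ _ _ True])
            show "norm (A (g a) z) \<le> ((2 * pi + ?N) / pi) / (1 - norm z)" if "z \<in> unit_disc" for z
              using hardy_growth[OF hardy_spaceD(1)[OF AH] p hardy_spaceD(3)[OF AH] that] by simp
            show "A (g a) (\<phi> z) = (\<mu> * cis a) * A (g a) z" if "z \<in> unit_disc" for z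
              using fun_cong[OF eig, of z] that by (simp add: composition_operator_def mult.assoc)
            show "norm (\<mu> * cis a) \<noteq> 1"
              using \<mu> by (simp add: norm_mult)
          qed
        qed (use hardy_spaceD(2)[OF AH] in auto)
      qed
      have Aspan: "A (zero_extension k) = (\<lambda>z. 0)" if "k \<in> exp_span h" for k
        using that
      proof induction
        case (exp a c)
        have "zero_extension (\<lambda>z. c * exp (\<i> * of_real a * h z)) = (\<lambda>z. c * g a z)"
          by (auto simp: zero_extension_def g_def)
        then show ?case
          using A gH[OF exp] Ag[OF exp] by (simp add: bounded_operator_def)
      next
        case (add k l)
        have "zero_extension (\<lambda>z. k z + l z) = (\<lambda>z. zero_extension k z + zero_extension l z)"
          by (auto simp: zero_extension_def)
        moreover have "zero_extension k \<in> hardy_space p" "zero_extension l \<in> hardy_space p"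
          using add.hyps bounded_holomorphic_exp_span[OF h(1) half] zero_extension_in_hardy_space p by blast+
        ultimately show ?case
          using A add.IH by (simp add: bounded_operator_def)
      qed
      have "A f0 = (\<lambda>z. 0)"
      proof (rule bounded_operator_vanishes_if_dense_kernel[OF A p f0(1)])
        fix e :: real assume e: "0 < e"
        obtain k where "k \<in> exp_span h" "\<forall>s. 0 < s \<and> s < 1 \<longrightarrow> hardy_mean p (\<lambda>z. f0 z - k z) s \<le> e"
          using exp_span_dense[OF h lower upper _ _ p hardy_spaceD(1,3)[OF f0(1)] e] assms(9,10) \<Omega> by blast
        then show "\<exists>k. bounded_holomorphic k \<and> A (zero_extension k) = (\<lambda>z. 0) \<and>
            (\<forall>s. 0 < s \<and> s < 1 \<longrightarrow> hardy_mean p (\<lambda>z. f0 z - k z) s \<le> e)"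
          using Aspan bounded_holomorphic_exp_span[OF h(1) half] by blast
      qed
      then show False
        using f0(2) by simp
    qed
  next
    fix \<mu> :: complex assume "\<mu> \<in> sphere 0 1"
    then obtain a where a: "0 \<le> a" "\<mu> = cis a"
      using Arg2pi_ge_0[of \<mu>] Arg2pi_eq[of \<mu>] by (metis cis_conv_exp mem_sphere_0 mult_1 of_real_1)
    let ?A = "\<lambda>f z. g a z * f z"
    have "g a holomorphic_on unit_disc"
      using hardy_spaceD(1)[OF gH[OF a(1)]] .
    moreover have "norm (g a z) \<le> exp (a * \<eta>)" if "z \<in> unit_disc" for z
      using norm_exp_i_mult_le[OF a(1), of "- \<eta>" "h z"] half[OF that] that by (simp add: g_def zero_extension_def)
    ultimately have "bounded_operator (hardy_space p) (hardy_norm p) ?A"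
      by (intro bounded_operator_multiplication[of _ "exp (a * \<eta>)"] p) auto
    moreover have "zero_extension (\<lambda>z. 1) \<in> hardy_space p"
      by (intro zero_extension_in_hardy_space bounded_holomorphic_const p)
    moreover have "?A (zero_extension (\<lambda>z. 1)) \<noteq> (\<lambda>z. 0)"
    proof
      assume "?A (zero_extension (\<lambda>z. 1)) = (\<lambda>z. 0)"
      then have "g a 0 * zero_extension (\<lambda>z. 1) 0 = 0"
        by (rule fun_cong)
      then show False
        by (simp add: g_def zero_extension_def)
    qed
    moreover have "?T (?A f) = (\<lambda>z. \<mu> * ?A (?T f) z)" for f
      using g\<phi>[of _ a] by (auto simp: composition_operator_def a(2) g_def zero_extension_def)
    ultimately show "\<mu> \<in> extended_eigenvalues (hardy_space p) (hardy_norm p) ?T"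
      unfolding extended_eigenvalues_def by blast
  qed
qed

end
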